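(* Let $\Sigma$ be a finite alphabet, let $\varphi\colon\Sigma^*\to\Sigma^*$ be a morphism, let $a\in\Sigma$ and $\gamma\in\Sigma^*$ be such that $\varphi(a)=a\gamma$ and $\varphi^n(\gamma)$ is nonempty for every $n\ge 0$, let $\alpha=\varphi^\infty(a)=\lim_{n\to\infty}\varphi^n(a)$, and let $\psi\colon\Sigma^*\to\Sigma^*$ be a coding. Let $\beta=\psi(\alpha)$ and let $p_\beta$ be its subword complexity. Then either there exists $k\in\mathbb{N}=\{1,2,3,\dots\}$ such that $p_\beta(n)=\Theta(n^{1+1/k})$, or $p_\beta(n)=O(n\log n)$.
   Context: A morphism $\varphi\colon\Sigma^*\to\Sigma^*$ is a map with $\varphi(uv)=\varphi(u)\varphi(v)$ for all words $u,v$; it is a coding if $|\varphi(b)|=1$ for every letter $b\in\Sigma$. If $\varphi(a)=a\gamma$ with $\varphi^n(\gamma)$ nonempty for all $n$, then $\varphi^n(a)$ is a prefix of $\varphi^{n+1}(a)$ and the lengths tend to infinity, so the infinite word $\varphi^\infty(a)=\lim_n\varphi^n(a)$ is well defined (a pure morphic sequence); sequences $\psi(\varphi^\infty(a))$ with $\psi$ a coding are called morphic. The subword complexity of an infinite word $\beta$ is the function $p_\beta\colon\mathbb{N}\to\mathbb{N}$ where $p_\beta(n)$ is the number of distinct words of length $n$ occurring as (contiguous) subwords of $\beta$. Asymptotic notation refers to $n\to\infty$. *)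

theory Defs
  imports Complex_Main "HOL-Library.Landau_Symbols" "HOL-Library.Omega_Words_Fun"
begin

definition word_morphism :: "('a list \<Rightarrow> 'b list) \<Rightarrow> bool" where
  "word_morphism \<phi> \<longleftrightarrow> (\<forall>u v. \<phi> (u @ v) = \<phi> u @ \<phi> v)"

definition coding :: "('a list \<Rightarrow> 'b list) \<Rightarrow> bool" where
  "coding \<psi> \<longleftrightarrow> word_morphism \<psi> \<and> (\<forall>b. length (\<psi> [b]) = 1)"

definition words_converge :: "(nat \<Rightarrow> 'a list) \<Rightarrow> 'a word \<Rightarrow> bool" where
  "words_converge w x \<longleftrightarrow>
     (\<forall>i. \<forall>\<^sub>F n in sequentially. i < length (w n) \<and> w n ! i = x i)"

definition words_lim :: "(nat \<Rightarrow> 'a list) \<Rightarrow> 'a word" where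
  "words_lim w = (THE x. words_converge w x)"

definition pure_morphic :: "('a list \<Rightarrow> 'a list) \<Rightarrow> 'a \<Rightarrow> 'a word" where
  "pure_morphic \<phi> a = words_lim (\<lambda>n. (\<phi> ^^ n) [a])"

text \<open>The extension of a map on finite words to infinite words, by continuity along prefixes;
  meaningful when the images of the prefixes converge, in particular for codings.\<close>

definition image_word :: "('a list \<Rightarrow> 'b list) \<Rightarrow> 'a word \<Rightarrow> 'b word" where
  "image_word \<psi> x = words_lim (\<lambda>n. \<psi> (prefix n x))"

definition subword_complexity :: "'a word \<Rightarrow> nat \<Rightarrow> nat" where
  "subword_complexity x n = card {x [i \<rightarrow> i + n] | i. True}"

lemma words_converge_unique:
  assumes "words_converge w x" "words_converge w y"
  shows "x = y"
proof
  fix i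
  have "\<forall>\<^sub>F n in sequentially. i < length (w n) \<and> w n ! i = x i"
    and "\<forall>\<^sub>F n in sequentially. i < length (w n) \<and> w n ! i = y i"
    using assms unfolding words_converge_def by blast+
  then have "\<forall>\<^sub>F n in sequentially. x i = y i"
    by eventually_elim simp
  then show "x i = y i"
    by simp
qed

lemma words_lim_eq: "words_converge w x \<Longrightarrow> words_lim w = x"
  unfolding words_lim_def by (blast intro: the_equality words_converge_unique)

lemma morphic_iterate_Suc:
  assumes "word_morphism \<phi>" "\<phi> [a] = a # \<gamma>"
  shows "(\<phi> ^^ Suc n) [a] = (\<phi> ^^ n) [a] @ (\<phi> ^^ n) \<gamma>"
proof (induction n)
  case 0
  show ?case using assms(2) by simp
next
  case (Suc n)
  then show ?case using assms(1) by (simp add: word_morphism_def)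
qed

lemma words_converge_pure_morphic:
  assumes "word_morphism \<phi>" "\<phi> [a] = a # \<gamma>" "\<And>n. (\<phi> ^^ n) \<gamma> \<noteq> []"
  shows "words_converge (\<lambda>n. (\<phi> ^^ n) [a]) (pure_morphic \<phi> a)"
proof -
  let ?w = "\<lambda>n. (\<phi> ^^ n) [a]"
  note step = morphic_iterate_Suc[OF assms(1,2)]
  have len: "n < length (?w n)" for n
  proof (induction n)
    case (Suc n)
    moreover have "0 < length ((\<phi> ^^ n) \<gamma>)" using assms(3) by simp
    ultimately show ?case unfolding step length_append by linarith
  qed simp
  have pre: "\<exists>v. ?w (m + d) = ?w m @ v" for m d
  proof (induction d)
    case (Suc d)
    then show ?case using step[of "m + d"] by (metis add_Suc_right append.assoc)
  qed simp
  have "words_converge ?w (\<lambda>i. ?w i ! i)"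
    unfolding words_converge_def
  proof
    fix i
    have "i < length (?w n) \<and> ?w n ! i = ?w i ! i" if "n \<ge> i" for n
      using pre[of i "n - i"] len[of i] that by (auto simp: nth_append)
    then show "\<forall>\<^sub>F n in sequentially. i < length (?w n) \<and> ?w n ! i = ?w i ! i"
      by (rule eventually_sequentiallyI)
  qed
  then show ?thesis
    unfolding pure_morphic_def by (simp add: words_lim_eq)
qed

lemma coding_eq_map:
  assumes "coding \<psi>"
  shows "\<psi> u = map (\<lambda>b. hd (\<psi> [b])) u"
proof (induction u)
  case Nil
  have "\<psi> ([] @ []) = \<psi> [] @ \<psi> []" using assms unfolding coding_def word_morphism_def by blast
  then show ?case by simp
next
  case (Cons b u)
  have "\<psi> ([b] @ u) = \<psi> [b] @ \<psi> u" using assms unfolding coding_def word_morphism_def by blast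
  moreover have "\<psi> [b] = [hd (\<psi> [b])]"
    using assms unfolding coding_def by (metis One_nat_def length_0_conv length_Suc_conv list.sel(1))
  ultimately show ?case using Cons by (metis append_Cons append_Nil list.simps(9))
qed

lemma image_word_coding:
  assumes "coding \<psi>"
  shows "image_word \<psi> x = (\<lambda>i. hd (\<psi> [x i]))"
  unfolding image_word_def
proof (rule words_lim_eq)
  show "words_converge (\<lambda>n. \<psi> (prefix n x)) (\<lambda>i. hd (\<psi> [x i]))"
    unfolding words_converge_def
  proof
    fix i
    have "i < length (\<psi> (prefix n x)) \<and> \<psi> (prefix n x) ! i = hd (\<psi> [x i])"
      if "Suc i \<le> n" for n
      using that unfolding coding_eq_map[OF assms, of "prefix n x"] by simp
    then show "\<forall>\<^sub>F n in sequentially.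
        i < length (\<psi> (prefix n x)) \<and> \<psi> (prefix n x) ! i = hd (\<psi> [x i])"
      by (rule eventually_sequentiallyI)
  qed
qed

end

theory Submission
  imports Defs "HOL-Library.Sublist"
begin

text \<open>
  After deleting vanishing letters and passing to a power, \<open>\<beta>\<close> is the limit of the words
  \<open>W M [a] = g (f^M a)\<close> with \<open>f\<close> and \<open>g\<close> nonerasing, and there is a common period \<open>Q\<close> for all
  eventually constant images. Call \<open>p\<close> a break if \<open>\<beta> p \<noteq> \<beta> (p + Q)\<close>, and look at the gaps between
  consecutive breaks, that is, at the maximal runs of period \<open>Q\<close>.

  If some family of gaps grows like \<open>M^k\<close>, then there are about \<open>n^(1/k)\<close> gap lengths between
  \<open>\<epsilon> n\<close> and \<open>n/2\<close>. A window of length \<open>n\<close> that contains such a gap determines, up to boundedly many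
  choices, the gap and its position in the window, so there are at least \<open>c n^(1 + 1/k)\<close> windows.

  Conversely let \<open>k\<close> be the least exponent that occurs. By induction on the letter, the image
  \<open>W M [b]\<close> of every letter of growth \<open>O(M^(k-1))\<close> has all its breaks in one cluster of bounded
  diameter, since two clusters drifting apart would be a gap family of smaller exponent. Now assign
  to a window of length \<open>n\<close> the last level \<open>M\<close> at which it straddles two letters of an image
  \<open>W M (f x)\<close>. Each level contributes \<open>O(n)\<close> windows. At the levels \<open>M \<ge> C n^(1/k)\<close> the letters of
  growth at least \<open>M^k\<close> are longer than \<open>n\<close>, and the words around the cut consist of a limit word
  on either side and a part with at most one cluster of breaks; all these levels together
  contribute \<open>O(n)\<close> windows. If no exponent occurs, the same argument with exponentially growing
  letters needs only the levels \<open>M \<le> C log n\<close>.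
\<close>

section \<open>Eventually polynomial sequences\<close>

text \<open>The obstacle is that infinitely many levels \<open>M\<close> contribute to a single
  window length, so the high levels must be counted jointly although the words around a cut change
  with \<open>M\<close>. Passing to a power makes each recurring letter of polynomial growth
  reproduce itself in one step, \<open>f d = z @ [d] @ t\<close>. Lengths are then eventually
  polynomial instead of quasi-polynomial, and \<open>W M [d]\<close> is \<open>g d\<close> flanked
  by concatenated images of \<open>z\<close> and of \<open>t\<close>. If the images of
  \<open>t\<close> settle at a word \<open>x\<close>, their concatenation ends in more and more
  copies of \<open>x\<close>. With \<open>Q\<close> a multiple of \<open>length x\<close> these
  copies create no breaks; this is the role of the common period. Exponents of eventually polynomial
  sequences are integers. A letter whose growth is not \<open>O(M^(k-1))\<close> therefore has
  length at least \<open>c M^k\<close>, with nothing in between, and the same \<open>k\<close>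
  governs the number of gap lengths in the lower bound and the number of low levels in the upper
  bound. All hypotheses are invariant under reversal, so left ends follow from right ends.\<close>

primrec vanishing_difference :: "nat \<Rightarrow> (nat \<Rightarrow> int) \<Rightarrow> bool" where
  "vanishing_difference 0 f \<longleftrightarrow> (\<forall>\<^sub>F M in sequentially. f M = 0)"
| "vanishing_difference (Suc d) f \<longleftrightarrow> vanishing_difference d (\<lambda>M. f (Suc M) - f M)"

text \<open>Differences replace coefficients because lengths are known through recurrences for
  \<open>f (Suc M) - f M\<close>; closure under summation, \<open>evpoly_summation\<close>, is then
  immediate.\<close>

definition evpoly :: "(nat \<Rightarrow> int) \<Rightarrow> bool" where
  "evpoly f \<longleftrightarrow> (\<exists>d. vanishing_difference d f)"

definition evconst :: "(nat \<Rightarrow> 'b) \<Rightarrow> bool" where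
  "evconst f \<longleftrightarrow> (\<exists>c. \<forall>\<^sub>F M in sequentially. f M = c)"

lemma eventually_Suc: "eventually P sequentially \<Longrightarrow> \<forall>\<^sub>F M in sequentially. P (Suc M)"
  by (simp add: eventually_sequentially_Suc)

lemma vanishing_difference_Suc: "vanishing_difference d f \<Longrightarrow> vanishing_difference (Suc d) f"
proof (induction d arbitrary: f)
  case 0
  then have "\<forall>\<^sub>F M in sequentially. f M = 0" by simp
  with eventually_Suc[OF this] show ?case by (auto elim: eventually_elim2)
next
  case (Suc d)
  from Suc.IH[of "\<lambda>M. f (Suc M) - f M"] Suc.prems show ?case
    by (metis vanishing_difference.simps(2))
qed

lemma vanishing_difference_mono:
  "vanishing_difference d f \<Longrightarrow> d \<le> e \<Longrightarrow> vanishing_difference e f"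
proof (induction e)
  case (Suc e)
  then show ?case using vanishing_difference_Suc by (metis le_Suc_eq)
qed simp

lemma vanishing_difference_add:
  "vanishing_difference d f \<Longrightarrow> vanishing_difference d g \<Longrightarrow> vanishing_difference d (\<lambda>M. f M + g M)"
proof (induction d arbitrary: f g)
  case 0
  then show ?case by (auto elim: eventually_elim2)
next
  case (Suc d)
  from Suc.IH[of "\<lambda>M. f (Suc M) - f M" "\<lambda>M. g (Suc M) - g M"] Suc.prems
  show ?case by (simp add: algebra_simps)
qed

lemma vanishing_difference_uminus:
  "vanishing_difference d f \<Longrightarrow> vanishing_difference d (\<lambda>M. - f M)"
proof (induction d arbitrary: f)
  case 0
  then show ?case by simp
next
  case (Suc d)
  from Suc.IH[of "\<lambda>M. f (Suc M) - f M"] Suc.prems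
  show ?case by (simp add: algebra_simps)
qed

lemma vanishing_difference_shift:
  "vanishing_difference d (\<lambda>M. f (Suc M)) \<longleftrightarrow> vanishing_difference d f"
proof (induction d arbitrary: f)
  case 0
  show ?case by (simp add: eventually_sequentially_Suc[of "\<lambda>M. f M = 0"])
next
  case (Suc d)
  show ?case using Suc[of "\<lambda>M. f (Suc M) - f M"] by simp
qed

lemma vanishing_difference_cong:
  "\<forall>\<^sub>F M in sequentially. f M = g M \<Longrightarrow> vanishing_difference d f \<Longrightarrow> vanishing_difference d g"
proof (induction d arbitrary: f g)
  case 0
  then show ?case by (auto elim: eventually_elim2)
next
  case (Suc d)
  have "\<forall>\<^sub>F M in sequentially. f (Suc M) - f M = g (Suc M) - g M"
    using Suc.prems(1) eventually_Suc[OF Suc.prems(1)] by eventually_elim simp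
  with Suc show ?case by auto
qed

lemma evpoly_add: "evpoly f \<Longrightarrow> evpoly g \<Longrightarrow> evpoly (\<lambda>M. f M + g M)"
  unfolding evpoly_def
proof (elim exE)
  fix d e assume "vanishing_difference d f" "vanishing_difference e g"
  then have "vanishing_difference (max d e) (\<lambda>M. f M + g M)"
    by (intro vanishing_difference_add) (auto elim: vanishing_difference_mono)
  then show "\<exists>d. vanishing_difference d (\<lambda>M. f M + g M)" ..
qed

lemma evpoly_uminus: "evpoly f \<Longrightarrow> evpoly (\<lambda>M. - f M)"
  unfolding evpoly_def using vanishing_difference_uminus by blast

lemma evpoly_diff: "evpoly f \<Longrightarrow> evpoly g \<Longrightarrow> evpoly (\<lambda>M. f M - g M)"
  using evpoly_add[OF _ evpoly_uminus, of f g] by simp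

lemma evpoly_const [simp]: "evpoly (\<lambda>M. c)"
  unfolding evpoly_def by (rule exI[of _ 1]) simp

lemma evpoly_cong: "\<forall>\<^sub>F M in sequentially. f M = g M \<Longrightarrow> evpoly f \<Longrightarrow> evpoly g"
  unfolding evpoly_def using vanishing_difference_cong by blast

lemma evpoly_shift: "evpoly (\<lambda>M. f (Suc M)) \<longleftrightarrow> evpoly f"
  unfolding evpoly_def vanishing_difference_shift ..

lemma evpoly_summation:
  assumes "evpoly (\<lambda>M. f (Suc M) - f M)"
  shows "evpoly f"
  using assms unfolding evpoly_def by (metis vanishing_difference.simps(2))

section \<open>Growth rates by discrete integration\<close>

lemma power_Suc_diff_le:
  fixes x :: real
  assumes "x \<ge> 0"
  shows "(x + 1) ^ Suc j - x ^ Suc j \<le> real (Suc j) * (x + 1) ^ j"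
proof (induction j)
  case (Suc j)
  have "(x + 1) ^ Suc (Suc j) - x ^ Suc (Suc j)
      = (x + 1) * ((x + 1) ^ Suc j - x ^ Suc j) + x ^ Suc j"
    by (simp add: algebra_simps)
  also have "\<dots> \<le> (x + 1) * (real (Suc j) * (x + 1) ^ j) + (x + 1) ^ Suc j"
    by (intro add_mono mult_left_mono Suc power_mono) (use assms in auto)
  also have "\<dots> = real (Suc (Suc j)) * (x + 1) ^ Suc j" by (simp add: algebra_simps)
  finally show ?case .
qed simp

text \<open>Summing increments of order \<open>M^j\<close> gives order \<open>M^(j + 1)\<close>. For
  the lower bound, \<open>h\<close> is compared with a multiple of \<open>M^(j + 1)\<close> whose
  increments are no larger than those of \<open>h\<close>.\<close>

lemma growth_of_difference:
  fixes h :: "nat \<Rightarrow> real"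
  assumes "c > 0"
    and "\<forall>\<^sub>F M in sequentially. c * real M ^ j \<le> h (Suc M) - h M \<and> h (Suc M) - h M \<le> C * real M ^ j"
  shows "\<exists>c'>0. \<exists>C'. \<forall>\<^sub>F M in sequentially.
    c' * real M ^ Suc j \<le> h M \<and> h M \<le> C' * real M ^ Suc j \<and> h M < h (Suc M)"
proof -
  obtain N0 where N0: "\<And>M. M \<ge> N0 \<Longrightarrow>
      c * real M ^ j \<le> h (Suc M) - h M \<and> h (Suc M) - h M \<le> C * real M ^ j"
    using assms(2) unfolding eventually_sequentially by blast
  define N where "N = max N0 1"
  have N: "c * real M ^ j \<le> h (Suc M) - h M" "h (Suc M) - h M \<le> C * real M ^ j" if "M \<ge> N" for M
    using N0[of M] that by (auto simp: N_def)
  have N1: "N \<ge> 1" by (simp add: N_def)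
  have C: "C \<ge> 0"
  proof -
    have "0 < c * real N ^ j" using assms(1) N1 by simp
    then have "0 < C * real N ^ j" using N[of N] by linarith
    then show ?thesis by (simp add: zero_less_mult_iff)
  qed
  \<comment> \<open>Since \<open>M + 1 \<le> 2 M\<close>, the increments of
    \<open>c1 M^(j + 1)\<close> are at most \<open>c1 (j + 1) (2 M)^j = c M^j\<close>.\<close>
  define c1 where "c1 = c / (real (Suc j) * 2 ^ j)"
  have c1: "c1 > 0" using assms(1) by (simp add: c1_def)
  have up: "h M \<le> \<bar>h N\<bar> + C * real M ^ Suc j" if "M \<ge> N" for M
    using that
  proof (induction M rule: nat_induct_at_least)
    case base
    show ?case using C by (smt (verit) of_nat_0_le_iff zero_le_power mult_nonneg_nonneg)
  next
    case (Suc M)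
    have "h (Suc M) \<le> \<bar>h N\<bar> + (C * real M ^ Suc j + C * real M ^ j)"
      using Suc N[of M] by linarith
    also have "C * real M ^ Suc j + C * real M ^ j = C * (real (Suc M) * real M ^ j)"
      by (simp add: algebra_simps)
    also have "\<dots> \<le> C * (real (Suc M) * real (Suc M) ^ j)"
      by (intro mult_left_mono power_mono C) auto
    finally show ?case by simp
  qed
  have low: "h M \<ge> - \<bar>h N\<bar> - c1 * real N ^ Suc j + c1 * real M ^ Suc j" if "M \<ge> N" for M
    using that
  proof (induction M rule: nat_induct_at_least)
    case base
    show ?case by simp
  next
    case (Suc M)
    have "(real M + 1) ^ Suc j - real M ^ Suc j \<le> real (Suc j) * (real M + 1) ^ j"
      by (rule power_Suc_diff_le) simp
    also have "(real M + 1) ^ j \<le> (2 * real M) ^ j"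
      using Suc.hyps N1 by (intro power_mono) auto
    finally have "c1 * ((real M + 1) ^ Suc j - real M ^ Suc j) \<le> c1 * (real (Suc j) * (2 * real M) ^ j)"
      using c1 by (simp del: power_Suc)
    also have "\<dots> = c * real M ^ j"
      by (simp add: c1_def power_mult_distrib del: of_nat_Suc)
    also have "\<dots> \<le> h (Suc M) - h M" using N Suc by simp
    finally show ?case using Suc.IH by (simp add: algebra_simps)
  qed
  \<comment> \<open>\<open>K\<close> is the constant of integration to be absorbed: once
    \<open>M \<ge> 2 K / c1\<close>, it is at most half of \<open>c1 M^(j + 1)\<close>.\<close>
  define K where "K = \<bar>h N\<bar> + c1 * real N ^ Suc j"
  have K: "K \<ge> 0" using c1 by (simp add: K_def)
  have main: "c1 / 2 * real M ^ Suc j \<le> h M \<and> h M \<le> (\<bar>h N\<bar> + C) * real M ^ Suc j \<and> h M < h (Suc M)"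
    if "M \<ge> N" "real M \<ge> 2 * K / c1" for M
  proof (intro conjI)
    have M1: "real M \<ge> 1" using that N1 by simp
    then have pw: "real M \<le> real M ^ Suc j" "1 \<le> real M ^ Suc j"
      using self_le_power[of "real M" "Suc j"] by (auto simp del: power_Suc)
    have "K \<le> c1 / 2 * real M" using that(2) c1 by (simp add: field_simps)
    also have "\<dots> \<le> c1 / 2 * real M ^ Suc j" using pw c1 by (intro mult_left_mono) auto
    finally show "c1 / 2 * real M ^ Suc j \<le> h M" using low[OF that(1)] unfolding K_def by linarith
    have "\<bar>h N\<bar> * 1 \<le> \<bar>h N\<bar> * real M ^ Suc j" using pw by (intro mult_left_mono) auto
    then show "h M \<le> (\<bar>h N\<bar> + C) * real M ^ Suc j"
      using up[OF that(1)] by (simp add: algebra_simps)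
    have "0 < c * real M ^ j" using assms(1) M1 by simp
    then show "h M < h (Suc M)" using N[OF that(1)] by linarith
  qed
  have "\<forall>\<^sub>F M in sequentially. c1 / 2 * real M ^ Suc j \<le> h M \<and>
      h M \<le> (\<bar>h N\<bar> + C) * real M ^ Suc j \<and> h M < h (Suc M)"
    using eventually_ge_at_top[of N] eventually_ge_at_top[of "nat \<lceil>2 * K / c1\<rceil>"]
    by eventually_elim (rule main, simp_all only: nat_ceiling_le_eq)
  then show ?thesis using c1 by (intro exI[of _ "c1 / 2"]) auto
qed

text \<open>The strict increase makes the values distinct for large \<open>M\<close>: the lower
  bound on the complexity needs many different gap lengths, not only long gaps.\<close>

definition poly_growth :: "nat \<Rightarrow> (nat \<Rightarrow> int) \<Rightarrow> bool" where
  "poly_growth j L \<longleftrightarrow> (\<exists>c>0. \<exists>C. \<forall>\<^sub>F M in sequentially.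
     c * real M ^ j \<le> real_of_int (L M) \<and> real_of_int (L M) \<le> C * real M ^ j \<and> L M < L (Suc M))"

lemma poly_growthE_lower:
  assumes "poly_growth j L"
  obtains c where "c > 0" "\<forall>\<^sub>F M in sequentially. c * real M ^ j \<le> real_of_int (L M)"
proof -
  obtain c C where "c > 0" and ev: "\<forall>\<^sub>F M in sequentially.
     c * real M ^ j \<le> real_of_int (L M) \<and> real_of_int (L M) \<le> C * real M ^ j \<and> L M < L (Suc M)"
    using assms unfolding poly_growth_def by blast
  moreover have "\<forall>\<^sub>F M in sequentially. c * real M ^ j \<le> real_of_int (L M)"
    using ev by eventually_elim simp
  ultimately show ?thesis using that by blast
qed

text \<open>Induction on the order: the differences are eventually constant or have a growth
  exponent with a sign, and summation raises the exponent by one. A nonzero constant difference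
  counts as exponent \<open>0\<close>.\<close>

lemma vanishing_difference_trichotomy:
  "vanishing_difference d f \<Longrightarrow>
   evconst f \<or> (\<exists>j\<ge>1. poly_growth j f \<or> poly_growth j (\<lambda>M. - f M))"
proof (induction d arbitrary: f)
  case 0
  then show ?case unfolding evconst_def by auto
next
  case (Suc d)
  let ?D = "\<lambda>M. f (Suc M) - f M"
  have step: "\<exists>j\<ge>1. poly_growth j h"
    if "c > 0" "\<forall>\<^sub>F M in sequentially. c * real M ^ j \<le> real_of_int (h (Suc M) - h M) \<and>
      real_of_int (h (Suc M) - h M) \<le> C * real M ^ j" for c C j and h :: "nat \<Rightarrow> int"
    using growth_of_difference[of c j "\<lambda>M. real_of_int (h M)" C] that
    unfolding poly_growth_def by (intro exI[of _ "Suc j"]) simp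
  from Suc.IH[of ?D] Suc.prems consider e where "\<forall>\<^sub>F M in sequentially. ?D M = e"
    | j where "poly_growth j ?D" | j where "poly_growth j (\<lambda>M. - ?D M)"
    unfolding evconst_def by auto
  then show ?case
  proof cases
    case 1
    consider "e = 0" | "e > 0" | "e < 0" by linarith
    then show ?thesis
    proof cases
      case a: 1
      obtain N where N: "\<And>M. M \<ge> N \<Longrightarrow> f (Suc M) = f M"
        using 1 a unfolding eventually_sequentially by force
      have "f M = f N" if "M \<ge> N" for M
        using that by (induction M rule: nat_induct_at_least) (auto simp: N)
      then show ?thesis unfolding evconst_def eventually_sequentially by blast
    next
      case 2
      have "\<forall>\<^sub>F M in sequentially. real_of_int e * real M ^ 0 \<le> real_of_int (f (Suc M) - f M) \<and>
          real_of_int (f (Suc M) - f M) \<le> real_of_int e * real M ^ 0"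
        using 1 by eventually_elim simp
      then show ?thesis using step[of "real_of_int e" 0 f "real_of_int e"] 2 by auto
    next
      case 3
      have "\<forall>\<^sub>F M in sequentially. real_of_int (- e) * real M ^ 0 \<le> real_of_int (- f (Suc M) - - f M) \<and>
          real_of_int (- f (Suc M) - - f M) \<le> real_of_int (- e) * real M ^ 0"
        using 1 by eventually_elim simp
      then show ?thesis using step[of "real_of_int (- e)" 0 "\<lambda>M. - f M" "real_of_int (- e)"] 3 by auto
    qed
  next
    case 2
    then obtain c C where c: "c > 0" and ev: "\<forall>\<^sub>F M in sequentially. c * real M ^ j \<le> real_of_int (?D M) \<and>
      real_of_int (?D M) \<le> C * real M ^ j \<and> ?D M < ?D (Suc M)"
      unfolding poly_growth_def by blast
    have "\<forall>\<^sub>F M in sequentially. c * real M ^ j \<le> real_of_int (f (Suc M) - f M) \<and>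
      real_of_int (f (Suc M) - f M) \<le> C * real M ^ j"
      using ev by eventually_elim simp
    then show ?thesis using step[OF c, of j f C] by blast
  next
    case 3
    then obtain c C where c: "c > 0" and ev: "\<forall>\<^sub>F M in sequentially. c * real M ^ j \<le> real_of_int (- ?D M) \<and>
      real_of_int (- ?D M) \<le> C * real M ^ j \<and> - ?D M < - ?D (Suc M)"
      unfolding poly_growth_def by blast
    have "\<forall>\<^sub>F M in sequentially. c * real M ^ j \<le> real_of_int (- f (Suc M) - - f M) \<and>
      real_of_int (- f (Suc M) - - f M) \<le> C * real M ^ j"
      using ev by eventually_elim simp
    then show ?thesis using step[OF c, of j "\<lambda>M. - f M" C] by blast
  qed
qed

lemma evpoly_nonneg_cases:
  assumes "evpoly f" "\<forall>\<^sub>F M in sequentially. f M \<ge> 0"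
  shows "evconst f \<or> (\<exists>j\<ge>1. poly_growth j f)"
proof -
  have "\<not> poly_growth j (\<lambda>M. - f M)" if "j \<ge> 1" for j
  proof
    assume "poly_growth j (\<lambda>M. - f M)"
    then obtain c where "c > 0" "\<forall>\<^sub>F M in sequentially. c * real M ^ j \<le> real_of_int (- f M)"
        by (rule poly_growthE_lower)
    with assms(2) have "\<forall>\<^sub>F M in sequentially. c * real M ^ j \<le> 0"
      by (auto elim: eventually_elim2)
    with eventually_gt_at_top[of 0] have "\<forall>\<^sub>F M::nat in sequentially. False"
    proof eventually_elim
      case (elim M)
      then have "0 < c * real M ^ j" using \<open>c > 0\<close> by simp
      with elim show False by linarith
    qed
    then show False by simp
  qed
  with assms(1) show ?thesis
    unfolding evpoly_def using vanishing_difference_trichotomy by blast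
qed

lemma poly_growth_at_top:
  assumes "poly_growth j f" "j \<ge> 1"
  shows "\<forall>\<^sub>F M in sequentially. f M \<ge> K"
proof -
  obtain c where c: "c > 0" "\<forall>\<^sub>F M in sequentially. c * real M ^ j \<le> real_of_int (f M)"
    using assms(1) by (rule poly_growthE_lower)
  obtain N where N: "real N \<ge> real_of_int K / c" using real_arch_simple by blast
  show ?thesis using c(2) eventually_ge_at_top[of "max 1 N"]
  proof eventually_elim
    case (elim M)
    have "real_of_int K \<le> c * real N" using N c by (simp add: field_simps)
    also have "\<dots> \<le> c * real M" using elim c by simp
    also have "\<dots> \<le> c * real M ^ j" using elim c assms(2) self_le_power[of "real M" j]
      by (intro mult_left_mono) auto
    finally show ?case using elim by linarith
  qed
qed

lemma evpoly_nonneg_at_top: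
  assumes "evpoly f" "\<forall>\<^sub>F M in sequentially. f M \<ge> 0" "\<not> evconst f"
  shows "\<forall>\<^sub>F M in sequentially. f M \<ge> K"
  using evpoly_nonneg_cases[OF assms(1,2)] assms(3) poly_growth_at_top by blast

lemma not_poly_growth_bounded:
  assumes "poly_growth j f" "\<forall>\<^sub>F M in sequentially. real_of_int (f M) \<le> C * real M ^ i"
  shows "j \<le> i"
proof (rule ccontr)
  assume "\<not> j \<le> i"
  then have ij: "j = i + Suc (j - i - 1)" by simp
  obtain c where c: "c > 0" "\<forall>\<^sub>F M in sequentially. c * real M ^ j \<le> real_of_int (f M)"
    using assms(1) by (rule poly_growthE_lower)
  obtain N where N: "real N > C / c" using reals_Archimedean2 by blast
  have "\<forall>\<^sub>F M::nat in sequentially. False"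
    using c(2) assms(2) eventually_ge_at_top[of "max 1 N"]
  proof eventually_elim
    case (elim M)
    have M: "real M \<ge> 1" "real M \<ge> real N" using elim by auto
    have "C < c * real N" using N c by (simp add: field_simps)
    also have "\<dots> \<le> c * real M" using M c by simp
    also have "\<dots> \<le> c * real M ^ Suc (j - i - 1)"
      using self_le_power[of "real M" "Suc (j - i - 1)"] M c by (intro mult_left_mono) auto
    finally have "C * real M ^ i < c * real M ^ Suc (j - i - 1) * real M ^ i"
      using M by (intro mult_strict_right_mono) auto
    also have "\<dots> = c * real M ^ j" by (subst (2) ij) (simp add: power_add algebra_simps)
    finally show False using elim by linarith
  qed
  then show False by simp
qed

text \<open>Growth exponents are integers, so nothing lies strictly between \<open>M^k\<close> and
  \<open>M^(k + 1)\<close>. This separates small letters from large ones.\<close>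

lemma evpoly_nonneg_bound_or_large:
  assumes "evpoly f" "\<forall>\<^sub>F M in sequentially. f M \<ge> 0"
  shows "(\<exists>C. \<forall>\<^sub>F M in sequentially. real_of_int (f M) \<le> C * real M ^ k) \<or>
         (\<exists>c>0. \<forall>\<^sub>F M in sequentially. c * real M ^ Suc k \<le> real_of_int (f M))"
  using evpoly_nonneg_cases[OF assms]
proof
  assume "evconst f"
  then obtain e where e: "\<forall>\<^sub>F M in sequentially. f M = e" unfolding evconst_def by blast
  have "\<forall>\<^sub>F M in sequentially. real_of_int (f M) \<le> \<bar>real_of_int e\<bar> * real M ^ k"
    using e eventually_ge_at_top[of 1]
  proof eventually_elim
    case (elim M)
    have "1 \<le> real M ^ k" using elim by (intro one_le_power) auto
    then have "\<bar>real_of_int e\<bar> * 1 \<le> \<bar>real_of_int e\<bar> * real M ^ k" by (intro mult_left_mono) auto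
    with elim show ?case by simp
  qed
  then show ?thesis by blast
next
  assume "\<exists>j\<ge>1. poly_growth j f"
  then obtain j c C where j: "c > 0" "\<forall>\<^sub>F M in sequentially.
     c * real M ^ j \<le> real_of_int (f M) \<and> real_of_int (f M) \<le> C * real M ^ j \<and> f M < f (Suc M)"
    unfolding poly_growth_def by blast
  show ?thesis
  proof (cases "j \<le> k")
    case True
    have "\<forall>\<^sub>F M in sequentially. real_of_int (f M) \<le> \<bar>C\<bar> * real M ^ k"
      using j(2) eventually_ge_at_top[of 1]
    proof eventually_elim
      case (elim M)
      have "real_of_int (f M) \<le> C * real M ^ j" using elim by simp
      also have "\<dots> \<le> \<bar>C\<bar> * real M ^ k"
        using elim True by (intro mult_mono power_increasing) auto
      finally show ?case .
    qed
    then show ?thesis by blast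
  next
    case False
    have "\<forall>\<^sub>F M in sequentially. c * real M ^ Suc k \<le> real_of_int (f M)"
      using j(2) eventually_ge_at_top[of 1]
    proof eventually_elim
      case (elim M)
      have "c * real M ^ Suc k \<le> c * real M ^ j"
        using elim False j(1) by (intro mult_left_mono power_increasing) auto
      then show ?case using elim by linarith
    qed
    then show ?thesis using j(1) by blast
  qed
qed

section \<open>Breaks of a period\<close>

definition breaks :: "nat \<Rightarrow> 'a list \<Rightarrow> nat set" where
  "breaks Q w = {p. p + Q < length w \<and> w ! p \<noteq> w ! (p + Q)}"

definition lastn :: "nat \<Rightarrow> 'a list \<Rightarrow> 'a list" where
  "lastn Q w = drop (length w - Q) w"

definition consecutive_diff :: "nat set \<Rightarrow> int \<Rightarrow> bool" where
  "consecutive_diff R L \<longleftrightarrow>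
     (\<exists>p\<in>R. \<exists>q\<in>R. p < q \<and> int q - int p = L \<and> (\<forall>i\<in>R. i \<le> p \<or> q \<le> i))"

lemma length_lastn [simp]: "length (lastn Q w) = min Q (length w)"
  by (auto simp: lastn_def)

lemma lastn_rev: "lastn Q (rev w) = rev (take Q w)"
  by (simp add: lastn_def rev_take)

lemma take_rev': "take Q (rev w) = rev (lastn Q w)"
  using lastn_rev[of Q "rev w"] by (metis rev_rev_ident)

lemma take_append_take: "take Q (v @ w) = take Q (take Q v @ take Q w)"
  by (simp add: min_def)

lemma lastn_append_lastn: "lastn Q (v @ w) = lastn Q (lastn Q v @ lastn Q w)"
proof -
  have "rev (lastn Q (v @ w)) = take Q (take Q (rev w) @ take Q (rev v))"
    by (simp only: take_rev'[symmetric] rev_append take_append_take[symmetric])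
  also have "\<dots> = rev (lastn Q (lastn Q v @ lastn Q w))"
    by (simp only: take_rev' rev_append[symmetric])
  finally show ?thesis by simp
qed

lemma lastn_append_long: "Q \<le> length w \<Longrightarrow> lastn Q (v @ w) = lastn Q w"
  by (simp add: lastn_def)

lemma finite_breaks [simp]: "finite (breaks Q w)"
  by (rule finite_subset[of _ "{..length w}"]) (auto simp: breaks_def)

lemma breaks_Nil [simp]: "breaks Q [] = {}"
  by (simp add: breaks_def)

lemma mem_breaks_middle:
  "d \<in> breaks Q m \<longleftrightarrow> d + Q < length m \<and> length x + d \<in> breaks Q (x @ m @ y)"
  by (auto simp: breaks_def nth_append add.assoc)

lemma breaks_append_left:
  "breaks Q (v @ w) = breaks Q v \<union> (+) (length v - Q) ` breaks Q (lastn Q v @ w)"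
proof -
  define x where "x = take (length v - Q) v"
  have v: "v = x @ lastn Q v" and lx: "length x = length v - Q"
    by (simp_all add: x_def lastn_def)
  have "p \<in> breaks Q (v @ w) \<longleftrightarrow> p \<in> breaks Q v \<or> (\<exists>d\<in>breaks Q (lastn Q v @ w). p = length x + d)" for p
  proof (cases "p < length v - Q")
    case True
    then have "p + Q < length v" by simp
    moreover have "\<not> (\<exists>d. p = length x + d)" using True lx by auto
    ultimately show ?thesis using mem_breaks_middle[of p Q v "[]" w] by auto
  next
    case False
    then have p: "p = length x + (p - length x)" using lx by simp
    have "p \<notin> breaks Q v" using False by (auto simp: breaks_def)
    moreover have "p \<in> breaks Q (v @ w) \<longleftrightarrow> p - length x \<in> breaks Q (lastn Q v @ w)"
    proof -
      have "v @ w = x @ (lastn Q v @ w) @ []" using v by (metis append.assoc append_Nil2)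
      then have "p - length x \<in> breaks Q (lastn Q v @ w) \<longleftrightarrow>
         p - length x + Q < length (lastn Q v @ w) \<and> p \<in> breaks Q (v @ w)"
        using mem_breaks_middle[of "p - length x" Q "lastn Q v @ w" x "[]"] p by metis
      moreover have "p - length x + Q < length (lastn Q v @ w)" if "p \<in> breaks Q (v @ w)"
        using that p lx by (auto simp: breaks_def)
      ultimately show ?thesis by blast
    qed
    ultimately show ?thesis using p by auto
  qed
  then show ?thesis unfolding lx by blast
qed

lemma breaks_append_right:
  "breaks Q (v @ w) = breaks Q (v @ take Q w) \<union> (+) (length v) ` breaks Q w"
proof -
  have w: "v @ w = [] @ (v @ take Q w) @ drop Q w" by simp
  have "p \<in> breaks Q (v @ w) \<longleftrightarrow> p \<in> breaks Q (v @ take Q w) \<or> (\<exists>d\<in>breaks Q w. p = length v + d)" for p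
  proof (cases "p < length v")
    case True
    have "p \<in> breaks Q (v @ take Q w) \<longleftrightarrow> p + Q < length (v @ take Q w) \<and> p \<in> breaks Q (v @ w)"
      using mem_breaks_middle[of p Q "v @ take Q w" "[]" "drop Q w"] by simp
    moreover have "p + Q < length (v @ take Q w)" if "p \<in> breaks Q (v @ w)"
      using that True by (auto simp: breaks_def)
    ultimately show ?thesis using True by auto
  next
    case False
    then have "p \<notin> breaks Q (v @ take Q w)" by (auto simp: breaks_def)
    moreover have "p \<in> breaks Q (v @ w) \<longleftrightarrow> p - length v \<in> breaks Q w"
      using mem_breaks_middle[of "p - length v" Q w v "[]"] False by (auto simp: breaks_def)
    ultimately show ?thesis using False by (metis add_diff_inverse_nat add_diff_cancel_left')
  qed
  then show ?thesis by blast
qed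

text \<open>The middle set depends only on \<open>Q\<close> letters on either side of the junction,
  so up to translation it is constant as soon as these letters are. This is why \<open>nice\<close>
  records \<open>take Q\<close> and \<open>lastn Q\<close>. Truncated subtraction is right even for
  short \<open>v\<close>, where \<open>lastn Q v = v\<close>.\<close>

lemma breaks_append:
  "breaks Q (v @ w) = breaks Q v \<union> (+) (length v - Q) ` breaks Q (lastn Q v @ take Q w)
     \<union> (+) (length v) ` breaks Q w"
  using breaks_append_right[of Q v w] breaks_append_left[of Q v "take Q w"] by simp

lemma breaks_junction_less:
  "d \<in> breaks Q (lastn Q v @ take Q w) \<Longrightarrow> length v - Q + d < length v"
  by (auto simp: breaks_def)

lemma breaks_less: "d \<in> breaks Q v \<Longrightarrow> d < length v - Q"
  by (auto simp: breaks_def)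

lemma breaks_sublist:
  assumes "sublist m w"
  obtains x where "\<And>d. d \<in> breaks Q m \<longleftrightarrow> d + Q < length m \<and> x + d \<in> breaks Q w"
proof -
  obtain x y where "w = x @ m @ y" using assms unfolding sublist_def by blast
  then show thesis using that[of "length x"] mem_breaks_middle[of _ Q m x y] by simp
qed

lemma consecutive_diff_sublist:
  assumes "sublist m w" "consecutive_diff (breaks Q m) L"
  shows "consecutive_diff (breaks Q w) L"
proof -
  obtain x where x: "\<And>d. d \<in> breaks Q m \<longleftrightarrow> d + Q < length m \<and> x + d \<in> breaks Q w"
    using breaks_sublist[OF assms(1)] by blast
  obtain p q where pq: "p \<in> breaks Q m" "q \<in> breaks Q m" "p < q" "int q - int p = L"
    "\<And>i. i \<in> breaks Q m \<Longrightarrow> i \<le> p \<or> q \<le> i"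
    using assms(2) unfolding consecutive_diff_def by blast
  have "i \<le> x + p \<or> x + q \<le> i" if "i \<in> breaks Q w" for i
  proof (rule ccontr)
    assume c: "\<not> ?thesis"
    have "q + Q < length m" using pq(2) by (auto simp: breaks_def)
    then have "i - x \<in> breaks Q m" using c that x[of "i - x"] by auto
    then show False using pq(5)[of "i - x"] c by linarith
  qed
  then show ?thesis unfolding consecutive_diff_def
    using x pq by (intro bexI[of _ "x + p"] bexI[of _ "x + q"]) auto
qed

text \<open>Reversal swaps the two compared positions \<open>p\<close> and \<open>p + Q\<close>, so
  breaks are reflected about a point shifted by \<open>Q\<close>. Working in the integers avoids
  truncated subtraction.\<close>

lemma int_image_breaks_rev:
  "int ` breaks Q (rev w) = (\<lambda>p. int (length w) - 1 - int Q - p) ` int ` breaks Q w"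
proof -
  have *: "length w - 1 - Q - p \<in> breaks Q (rev w)" if "p \<in> breaks Q w" for p and w :: "'a list"
  proof -
    have "length w - Suc (length w - 1 - Q - p) = p + Q" "length w - Suc (length w - 1 - p) = p"
      "length w - 1 - Q - p + Q = length w - 1 - p"
      using that by (auto simp: breaks_def)
    with that show ?thesis by (auto simp: breaks_def rev_nth add.commute)
  qed
  show ?thesis
  proof (intro equalityI subsetI)
    fix x assume "x \<in> int ` breaks Q (rev w)"
    then obtain p where p: "p \<in> breaks Q (rev w)" "x = int p" by blast
    have "length w - 1 - Q - p \<in> breaks Q w" using *[OF p(1)] by simp
    moreover have "p + Q < length w" using p(1) by (simp add: breaks_def)
    ultimately show "x \<in> (\<lambda>p. int (length w) - 1 - int Q - p) ` int ` breaks Q w"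
      using p(2) by (intro image_eqI[of _ _ "int (length w - 1 - Q - p)"] imageI) auto
  next
    fix x assume "x \<in> (\<lambda>p. int (length w) - 1 - int Q - p) ` int ` breaks Q w"
    then obtain p where p: "p \<in> breaks Q w" "x = int (length w) - 1 - int Q - int p" by blast
    have "p + Q < length w" using p(1) by (simp add: breaks_def)
    then have "x = int (length w - 1 - Q - p)" using p(2) by linarith
    then show "x \<in> int ` breaks Q (rev w)" using *[OF p(1)] by blast
  qed
qed

lemma consecutive_diff_breaks_rev:
  assumes "consecutive_diff (breaks Q w) L"
  shows "consecutive_diff (breaks Q (rev w)) L"
proof -
  obtain p q where pq: "p \<in> breaks Q w" "q \<in> breaks Q w" "p < q" "int q - int p = L"
    "\<And>i. i \<in> breaks Q w \<Longrightarrow> i \<le> p \<or> q \<le> i"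
    using assms unfolding consecutive_diff_def by blast
  let ?r = "\<lambda>p. int (length w) - 1 - int Q - p"
  have "?r (int p) \<in> int ` breaks Q (rev w)" "?r (int q) \<in> int ` breaks Q (rev w)"
    unfolding int_image_breaks_rev using pq by blast+
  then obtain p' q' where *: "p' \<in> breaks Q (rev w)" "q' \<in> breaks Q (rev w)"
    "int p' = ?r (int q)" "int q' = ?r (int p)" by force
  have "i \<le> p' \<or> q' \<le> i" if "i \<in> breaks Q (rev w)" for i
  proof -
    have "int i \<in> ?r ` int ` breaks Q w" using that int_image_breaks_rev by blast
    then obtain i' where "i' \<in> breaks Q w" "int i = ?r (int i')" by blast
    with pq(5)[of i'] * show ?thesis by auto
  qed
  then show ?thesis unfolding consecutive_diff_def using * pq
    by (intro bexI[of _ p'] bexI[of _ q']) auto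
qed

definition clustered :: "(nat \<Rightarrow> nat set) \<Rightarrow> bool" where
  "clustered R \<longleftrightarrow> (\<exists>p D. evpoly p \<and> finite D \<and>
     (\<forall>\<^sub>F M in sequentially. int ` R M = (+) (p M) ` D))"

lemma clusteredI:
  "evpoly p \<Longrightarrow> finite D \<Longrightarrow> \<forall>\<^sub>F M in sequentially. int ` R M = (+) (p M) ` D \<Longrightarrow> clustered R"
  unfolding clustered_def by blast

lemma clustered_cong:
  assumes "\<forall>\<^sub>F M in sequentially. R M = R' M" "clustered R"
  shows "clustered R'"
proof -
  obtain p D where p: "evpoly p" "finite D" "\<forall>\<^sub>F M in sequentially. int ` R M = (+) (p M) ` D"
    using assms(2) unfolding clustered_def by blast
  have "\<forall>\<^sub>F M in sequentially. int ` R' M = (+) (p M) ` D"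
    using p(3) assms(1) by eventually_elim simp
  with p show ?thesis by (intro clusteredI)
qed

lemma clustered_translate:
  assumes "clustered R" "evpoly (\<lambda>M. int (l M))"
  shows "clustered (\<lambda>M. (+) (l M) ` R M)"
proof -
  obtain p D where p: "evpoly p" "finite D" "\<forall>\<^sub>F M in sequentially. int ` R M = (+) (p M) ` D"
    using assms(1) unfolding clustered_def by blast
  have "\<forall>\<^sub>F M in sequentially. int ` (+) (l M) ` R M = (+) (int (l M) + p M) ` D"
    using p(3)
  proof eventually_elim
    case (elim M)
    have "int ` (+) (l M) ` R M = (+) (int (l M)) ` int ` R M" by (auto simp: image_iff)
    then show ?case unfolding elim by (auto simp: image_iff algebra_simps)
  qed
  with p assms(2) show ?thesis by (intro clusteredI[OF evpoly_add])
qed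

lemma clustered_const: "finite D \<Longrightarrow> \<forall>\<^sub>F M in sequentially. R M = D \<Longrightarrow> clustered R"
  by (rule clusteredI[of "\<lambda>_. 0" "int ` D"]) (auto elim: eventually_mono)

text \<open>The distance from the last element of the left cluster to the first of the right one is
  an \<open>evpoly\<close> sequence of gaps. If all such gaps are constant, the right cluster keeps
  its position relative to the left one and both form a single pattern.\<close>

lemma clustered_Un:
  assumes "clustered R1" "clustered R2"
    and less: "\<forall>\<^sub>F M in sequentially. \<forall>x\<in>R1 M. \<forall>y\<in>R2 M. x < y"
    and safe: "\<And>L. evpoly L \<Longrightarrow> \<forall>\<^sub>F M in sequentially. consecutive_diff (R1 M \<union> R2 M) (L M) \<Longrightarrow> evconst L"
  shows "clustered (\<lambda>M. R1 M \<union> R2 M)"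
proof -
  obtain p1 D1 where p1: "evpoly p1" "finite D1" "\<forall>\<^sub>F M in sequentially. int ` R1 M = (+) (p1 M) ` D1"
    using assms(1) unfolding clustered_def by blast
  obtain p2 D2 where p2: "evpoly p2" "finite D2" "\<forall>\<^sub>F M in sequentially. int ` R2 M = (+) (p2 M) ` D2"
    using assms(2) unfolding clustered_def by blast
  consider "D1 = {}" | "D2 = {}" | "D1 \<noteq> {}" "D2 \<noteq> {}" by blast
  then show ?thesis
  proof cases
    case 1
    then have "\<forall>\<^sub>F M in sequentially. R2 M = R1 M \<union> R2 M" using p1(3) by (auto elim: eventually_mono)
    then show ?thesis using assms(2) by (rule clustered_cong)
  next
    case 2
    then have "\<forall>\<^sub>F M in sequentially. R1 M = R1 M \<union> R2 M" using p2(3) by (auto elim: eventually_mono)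
    then show ?thesis using assms(1) by (rule clustered_cong)
  next
    case 3
    define L where "L = (\<lambda>M. p2 M + Min D2 - (p1 M + Max D1))"
    have "evpoly L" unfolding L_def using p1 p2 by (intro evpoly_diff evpoly_add evpoly_const)
    moreover have "\<forall>\<^sub>F M in sequentially. consecutive_diff (R1 M \<union> R2 M) (L M)"
      using p1(3) p2(3) less
    proof eventually_elim
      case (elim M)
      have "p1 M + Max D1 \<in> int ` R1 M" "p2 M + Min D2 \<in> int ` R2 M"
        using elim 3 p1 p2 by auto
      then obtain p q where pq: "p \<in> R1 M" "q \<in> R2 M" "int p = p1 M + Max D1" "int q = p2 M + Min D2"
        by force
      have "i \<le> p" if "i \<in> R1 M" for i
      proof -
        have "int i \<in> (+) (p1 M) ` D1" using that elim by blast
        then obtain x where "x \<in> D1" "int i = p1 M + x" by blast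
        then show ?thesis using pq Max_ge[OF p1(2), of x] by linarith
      qed
      moreover have "q \<le> i" if "i \<in> R2 M" for i
      proof -
        have "int i \<in> (+) (p2 M) ` D2" using that elim by blast
        then obtain x where "x \<in> D2" "int i = p2 M + x" by blast
        then show ?thesis using pq Min_le[OF p2(2), of x] by linarith
      qed
      ultimately show ?case unfolding consecutive_diff_def
        using pq elim(3) by (intro bexI[of _ p] bexI[of _ q]) (auto simp: L_def)
    qed
    ultimately obtain c where c: "\<forall>\<^sub>F M in sequentially. L M = c"
      using safe unfolding evconst_def by blast
    \<comment> \<open>The relative offset \<open>p2 M - p1 M\<close>, obtained by solving the
      definition of \<open>L\<close> with \<open>L M = c\<close>.\<close>
    let ?c = "c + Max D1 - Min D2"
    have "\<forall>\<^sub>F M in sequentially. int ` (R1 M \<union> R2 M) = (+) (p1 M) ` (D1 \<union> (+) ?c ` D2)"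
      using p1(3) p2(3) c
    proof eventually_elim
      case (elim M)
      have "p2 M = p1 M + ?c" using elim(3) by (simp add: L_def)
      then show ?case using elim(1,2) by (simp add: image_Un image_image add.assoc)
    qed
    then show ?thesis using p1 p2 by (intro clusteredI[OF p1(1)]) auto
  qed
qed

section \<open>Sequences of words with one cluster of breaks\<close>

text \<open>The second conjunct turns bounded length into an eventually fixed word: a tame sequence
  is eventually one word, or its lengths tend to infinity
  (\<open>tame_length_cases\<close>).\<close>

definition tame :: "(nat \<Rightarrow> 'a list) \<Rightarrow> bool" where
  "tame w \<longleftrightarrow> evpoly (\<lambda>M. int (length (w M))) \<and>
     (evconst (\<lambda>M. int (length (w M))) \<longrightarrow> evconst w)"

definition nice :: "nat \<Rightarrow> (nat \<Rightarrow> 'a list) \<Rightarrow> bool" where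
  "nice Q w \<longleftrightarrow> tame w \<and> clustered (\<lambda>M. breaks Q (w M)) \<and>
     evconst (\<lambda>M. take Q (w M)) \<and> evconst (\<lambda>M. lastn Q (w M))"

text \<open>The condition under which concatenation keeps a single cluster. It passes to factors, so
  it has to be checked only for the longest word of a construction.\<close>

definition safe :: "nat \<Rightarrow> (nat \<Rightarrow> 'a list) \<Rightarrow> bool" where
  "safe Q w \<longleftrightarrow> (\<forall>L. evpoly L \<longrightarrow>
     (\<forall>\<^sub>F M in sequentially. consecutive_diff (breaks Q (w M)) (L M)) \<longrightarrow> evconst L)"

lemma evconst_const [simp]: "evconst (\<lambda>M. c)"
  unfolding evconst_def by auto

lemma evconst_compose2: "evconst u \<Longrightarrow> evconst v \<Longrightarrow> evconst (\<lambda>M. F (u M) (v M))"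
  unfolding evconst_def
proof (elim exE)
  fix c d assume "\<forall>\<^sub>F M in sequentially. u M = c" "\<forall>\<^sub>F M in sequentially. v M = d"
  then have "\<forall>\<^sub>F M in sequentially. F (u M) (v M) = F c d" by eventually_elim simp
  then show "\<exists>c. \<forall>\<^sub>F M in sequentially. F (u M) (v M) = c" ..
qed

lemma evconst_compose: "evconst u \<Longrightarrow> evconst (\<lambda>M. F (u M))"
  using evconst_compose2[of u u "\<lambda>x y. F x"] by simp

lemma evconst_shift: "evconst (\<lambda>M. f (Suc M)) \<longleftrightarrow> evconst f"
  unfolding evconst_def eventually_sequentially_Suc[of "\<lambda>M. f M = _"] ..

text \<open>A nonconstant nonnegative \<open>evpoly\<close> sequence tends to infinity, and a
  nonnegative second summand cannot compensate for that.\<close>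

lemma evconst_nonneg_sumD:
  assumes "evpoly f" "evpoly g" "\<And>M. f M \<ge> 0" "\<And>M. g M \<ge> 0" "evconst (\<lambda>M. f M + g M)"
  shows "evconst f"
proof (rule ccontr)
  assume "\<not> evconst f"
  obtain c where c: "\<forall>\<^sub>F M in sequentially. f M + g M = c" using assms(5) unfolding evconst_def by blast
  have "\<forall>\<^sub>F M in sequentially. f M \<ge> c + 1"
    by (rule evpoly_nonneg_at_top[OF assms(1) _ \<open>\<not> evconst f\<close>]) (simp add: assms(3))
  with c have "\<forall>\<^sub>F M::nat in sequentially. False"
  proof eventually_elim
    case (elim M)
    then show False using assms(4)[of M] by linarith
  qed
  then show False by simp
qed

lemma tame_const [simp]: "tame (\<lambda>M. x)"
  by (simp add: tame_def)

lemma tame_append: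
  assumes "tame v" "tame w"
  shows "tame (\<lambda>M. v M @ w M)"
  unfolding tame_def
proof (intro conjI impI)
  show "evpoly (\<lambda>M. int (length (v M @ w M)))"
    using assms evpoly_add[of "\<lambda>M. int (length (v M))" "\<lambda>M. int (length (w M))"] by (simp add: tame_def)
  assume "evconst (\<lambda>M. int (length (v M @ w M)))"
  then have "evconst (\<lambda>M. int (length (v M)) + int (length (w M)))"
    "evconst (\<lambda>M. int (length (w M)) + int (length (v M)))" by (simp_all add: add.commute)
  then have "evconst (\<lambda>M. int (length (v M)))" "evconst (\<lambda>M. int (length (w M)))"
    using assms unfolding tame_def by (auto elim: evconst_nonneg_sumD[rotated -1])
  then show "evconst (\<lambda>M. v M @ w M)" using assms evconst_compose2 unfolding tame_def by blast
qed

lemma tame_shift: "tame (\<lambda>M. w (Suc M)) \<longleftrightarrow> tame w"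
  unfolding tame_def
  using evpoly_shift[of "\<lambda>M. int (length (w M))"] evconst_shift[of "\<lambda>M. int (length (w M))"]
    evconst_shift[of w] by simp

lemma tame_rev: "tame w \<Longrightarrow> tame (\<lambda>M. rev (w M))"
  unfolding tame_def using evconst_compose[of w rev] by simp

lemma tame_length_cases:
  assumes "tame w"
  obtains x where "\<forall>\<^sub>F M in sequentially. w M = x"
  | "\<And>K. \<forall>\<^sub>F M in sequentially. K \<le> length (w M)"
proof (cases "evconst (\<lambda>M. int (length (w M)))")
  case True
  then show ?thesis using assms that(1) unfolding tame_def evconst_def by blast
next
  case False
  have "\<forall>\<^sub>F M in sequentially. K \<le> length (w M)" for K
    using evpoly_nonneg_at_top[of "\<lambda>M. int (length (w M))" "int K"] False assms
    unfolding tame_def by simp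
  then show ?thesis by (rule that(2))
qed

lemma safe_sublist:
  assumes "safe Q w" "\<forall>\<^sub>F M in sequentially. sublist (v M) (w M)"
  shows "safe Q v"
  unfolding safe_def
proof (intro allI impI)
  fix L assume "evpoly L" and ev: "\<forall>\<^sub>F M in sequentially. consecutive_diff (breaks Q (v M)) (L M)"
  from ev assms(2) have "\<forall>\<^sub>F M in sequentially. consecutive_diff (breaks Q (w M)) (L M)"
    by eventually_elim (rule consecutive_diff_sublist)
  then show "evconst L" using assms(1) \<open>evpoly L\<close> unfolding safe_def by blast
qed

lemma nice_tame: "nice Q w \<Longrightarrow> tame w"
  and nice_clustered: "nice Q w \<Longrightarrow> clustered (\<lambda>M. breaks Q (w M))"
  and nice_evpoly_length: "nice Q w \<Longrightarrow> evpoly (\<lambda>M. int (length (w M)))"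
  by (simp_all add: nice_def tame_def)

lemma nice_const: "nice Q (\<lambda>M. x)"
  by (auto simp: nice_def intro: clustered_const[of "breaks Q x"])

lemma nice_append:
  assumes v: "nice Q v" and w: "nice Q w" and safe: "safe Q (\<lambda>M. v M @ w M)"
  shows "nice Q (\<lambda>M. v M @ w M)"
  unfolding nice_def
proof (intro conjI)
  show "tame (\<lambda>M. v M @ w M)" using v w by (intro tame_append nice_tame)
  have "evconst (\<lambda>M. take Q (take Q (v M) @ take Q (w M)))"
    using evconst_compose2[of "\<lambda>M. take Q (v M)" "\<lambda>M. take Q (w M)" "\<lambda>x y. take Q (x @ y)"] v w
    by (simp only: nice_def)
  then show "evconst (\<lambda>M. take Q (v M @ w M))" by (simp only: take_append_take[symmetric])
  have "evconst (\<lambda>M. lastn Q (lastn Q (v M) @ lastn Q (w M)))"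
    using evconst_compose2[of "\<lambda>M. lastn Q (v M)" "\<lambda>M. lastn Q (w M)" "\<lambda>x y. lastn Q (x @ y)"] v w
    by (simp only: nice_def)
  then show "evconst (\<lambda>M. lastn Q (v M @ w M))" by (simp only: lastn_append_lastn[symmetric])
  obtain V where V: "\<forall>\<^sub>F M in sequentially. lastn Q (v M) = V"
    using v unfolding nice_def evconst_def by blast
  obtain P where P: "\<forall>\<^sub>F M in sequentially. take Q (w M) = P"
    using w unfolding nice_def evconst_def by blast
  let ?R1 = "\<lambda>M. breaks Q (v M)"
  let ?R2 = "\<lambda>M. (+) (length (v M) - Q) ` breaks Q (lastn Q (v M) @ take Q (w M))"
  let ?R3 = "\<lambda>M. (+) (length (v M)) ` breaks Q (w M)"
  have ba: "breaks Q (v M @ w M) = ?R1 M \<union> ?R2 M \<union> ?R3 M" for M by (rule breaks_append)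
  have R1: "clustered ?R1" using v by (rule nice_clustered)
  have R3: "clustered ?R3"
    using w v by (intro clustered_translate nice_clustered nice_evpoly_length)
  \<comment> \<open>\<open>length V\<close> is eventually the minimum of \<open>Q\<close> and
    \<open>length (v M)\<close>, so this difference is the truncated one used as offset in
    \<open>?R2\<close>.\<close>
  have "evpoly (\<lambda>M. int (length (v M)) - int (length V))"
    using v by (intro evpoly_diff nice_evpoly_length evpoly_const)
  moreover have "\<forall>\<^sub>F M in sequentially. int (length (v M)) - int (length V) = int (length (v M) - Q)"
    using V by eventually_elim auto
  ultimately have "evpoly (\<lambda>M. int (length (v M) - Q))"
    by (rule evpoly_cong[rotated])
  moreover have "clustered (\<lambda>M. breaks Q (lastn Q (v M) @ take Q (w M)))"
  proof (rule clustered_const)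
    show "\<forall>\<^sub>F M in sequentially. breaks Q (lastn Q (v M) @ take Q (w M)) = breaks Q (V @ P)"
      using V P by eventually_elim simp
  qed simp
  ultimately have R2: "clustered ?R2" by (intro clustered_translate)
  have less12: "x < y" if "x \<in> ?R1 M" "y \<in> ?R2 M" for x y M
    using that breaks_less by fastforce
  have less23: "x < y" if "x \<in> ?R1 M \<union> ?R2 M" "y \<in> ?R3 M" for x y M
    using that breaks_less breaks_junction_less by fastforce
  \<comment> \<open>The three sets lie one after the other and are merged two at a time. A gap
    within the first two is a gap of the whole word because the third lies further right.\<close>
  have R12: "clustered (\<lambda>M. ?R1 M \<union> ?R2 M)"
  proof (rule clustered_Un[OF R1 R2])
    show "\<forall>\<^sub>F M in sequentially. \<forall>x\<in>?R1 M. \<forall>y\<in>?R2 M. x < y" using less12 by (intro always_eventually allI ballI)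
    fix L assume "evpoly L" and ev: "\<forall>\<^sub>F M in sequentially. consecutive_diff (?R1 M \<union> ?R2 M) (L M)"
    from ev have "\<forall>\<^sub>F M in sequentially. consecutive_diff (breaks Q (v M @ w M)) (L M)"
    proof eventually_elim
      case (elim M)
      then obtain p q where pq: "p \<in> ?R1 M \<union> ?R2 M" "q \<in> ?R1 M \<union> ?R2 M" "p < q"
        "int q - int p = L M" "\<And>i. i \<in> ?R1 M \<union> ?R2 M \<Longrightarrow> i \<le> p \<or> q \<le> i"
        unfolding consecutive_diff_def by blast
      have *: "i \<le> p \<or> q \<le> i" if "i \<in> breaks Q (v M @ w M)" for i
      proof (cases "i \<in> ?R1 M \<union> ?R2 M")
        case True
        then show ?thesis by (rule pq(5))
      next
        case False
        then have "i \<in> ?R3 M" using that unfolding ba by blast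
        then show ?thesis using less23[OF pq(2), of i] by simp
      qed
      have "p \<in> breaks Q (v M @ w M)" "q \<in> breaks Q (v M @ w M)"
        using pq(1,2) unfolding ba by blast+
      then show ?case
        unfolding consecutive_diff_def using pq(3,4) *
        by (intro bexI[of _ p] bexI[of _ q] conjI ballI)
    qed
    then show "evconst L" using safe \<open>evpoly L\<close> unfolding safe_def by blast
  qed
  show "clustered (\<lambda>M. breaks Q (v M @ w M))"
    unfolding ba
  proof (rule clustered_Un[OF R12 R3])
    show "\<forall>\<^sub>F M in sequentially. \<forall>x\<in>?R1 M \<union> ?R2 M. \<forall>y\<in>?R3 M. x < y" using less23 by (intro always_eventually allI ballI)
    fix L assume "evpoly L" and "\<forall>\<^sub>F M in sequentially. consecutive_diff (?R1 M \<union> ?R2 M \<union> ?R3 M) (L M)"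
    then show "evconst L" using safe unfolding safe_def ba by blast
  qed
qed

lemma nice_rev:
  assumes "nice Q w"
  shows "nice Q (\<lambda>M. rev (w M))"
  unfolding nice_def
proof (intro conjI)
  show "tame (\<lambda>M. rev (w M))" using assms by (intro tame_rev nice_tame)
  show "evconst (\<lambda>M. take Q (rev (w M)))" "evconst (\<lambda>M. lastn Q (rev (w M)))"
    unfolding take_rev' lastn_rev using assms unfolding nice_def
    by (auto intro: evconst_compose[where F = rev])
  obtain p D where p: "evpoly p" "finite D"
    and ev: "\<forall>\<^sub>F M in sequentially. int ` breaks Q (w M) = (+) (p M) ` D"
    using nice_clustered[OF assms] unfolding clustered_def by blast
  show "clustered (\<lambda>M. breaks Q (rev (w M)))"
  proof (rule clusteredI)
    show "evpoly (\<lambda>M. int (length (w M)) - (1 + int Q + p M))"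
      using p nice_evpoly_length[OF assms] by (intro evpoly_diff evpoly_add evpoly_const)
    show "finite (uminus ` D)" using p by simp
    show "\<forall>\<^sub>F M in sequentially. int ` breaks Q (rev (w M))
        = (+) (int (length (w M)) - (1 + int Q + p M)) ` uminus ` D"
      using ev
    proof eventually_elim
      case (elim M)
      show ?case unfolding int_image_breaks_rev elim by (simp add: image_image algebra_simps)
    qed
  qed
qed

lemma nice_shift: "nice Q (\<lambda>M. w (Suc M)) \<longleftrightarrow> nice Q w"
proof -
  have "clustered (\<lambda>M. R (Suc M)) \<longleftrightarrow> clustered R" for R
  proof
    assume "clustered R"
    then obtain p D where p: "evpoly p" "finite D" "\<forall>\<^sub>F M in sequentially. int ` R M = (+) (p M) ` D"
      unfolding clustered_def by blast
    show "clustered (\<lambda>M. R (Suc M))"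
      using p(1) eventually_Suc[OF p(3)] by (intro clusteredI[OF _ p(2)]) (simp_all add: evpoly_shift)
  next
    assume "clustered (\<lambda>M. R (Suc M))"
    then obtain p D where p: "evpoly p" "finite D" "\<forall>\<^sub>F M in sequentially. int ` R (Suc M) = (+) (p M) ` D"
      unfolding clustered_def by blast
    show "clustered R"
    proof (rule clusteredI[OF _ p(2)])
      show "evpoly (\<lambda>M. p (M - 1))" using p(1) by (subst evpoly_shift[symmetric]) simp
      show "\<forall>\<^sub>F M in sequentially. int ` R M = (+) (p (M - 1)) ` D"
        using p(3) by (subst eventually_sequentially_Suc[symmetric]) simp
    qed
  qed
  from this[of "\<lambda>M. breaks Q (w M)"] show ?thesis
    unfolding nice_def using tame_shift[of w] evconst_shift[of "\<lambda>M. take Q (w M)"]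
      evconst_shift[of "\<lambda>M. lastn Q (w M)"] by simp
qed

lemma nice_shift_add: "nice Q w \<Longrightarrow> nice Q (\<lambda>M. w (M + j))"
proof (induction j)
  case (Suc j)
  then show ?case using nice_shift[of Q "\<lambda>M. w (M + j)"] by simp
qed simp

section \<open>Repeated concatenation to the right and to the left\<close>

primrec iconcat :: "(nat \<Rightarrow> 'a list) \<Rightarrow> nat \<Rightarrow> 'a list" where
  "iconcat w 0 = []"
| "iconcat w (Suc M) = iconcat w M @ w M"

primrec rconcat :: "(nat \<Rightarrow> 'a list) \<Rightarrow> nat \<Rightarrow> 'a list" where
  "rconcat w 0 = []"
| "rconcat w (Suc M) = w M @ rconcat w M"

lemma rev_iconcat: "rev (iconcat w M) = rconcat (\<lambda>i. rev (w i)) M"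
  by (induction M) auto

lemma rev_rconcat: "rev (rconcat w M) = iconcat (\<lambda>i. rev (w i)) M"
  by (induction M) auto

lemma length_iconcat: "length (iconcat w M) = (\<Sum>i<M. length (w i))"
  by (induction M) auto

lemma length_rconcat: "length (rconcat w M) = (\<Sum>i<M. length (w i))"
  by (induction M) auto

lemma iconcat_prefix: "N \<le> M \<Longrightarrow> \<exists>y. iconcat w M = iconcat w N @ y"
  by (induction M rule: nat_induct_at_least) auto

lemma evconst_step:
  assumes "\<forall>\<^sub>F M in sequentially. f (Suc M) = f M"
  shows "evconst f"
proof -
  obtain N where N: "\<And>M. M \<ge> N \<Longrightarrow> f (Suc M) = f M"
    using assms unfolding eventually_sequentially by blast
  have "f M = f N" if "M \<ge> N" for M
    using that by (induction M rule: nat_induct_at_least) (auto simp: N)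
  then show ?thesis unfolding evconst_def eventually_sequentially by blast
qed

lemma tame_iconcat:
  assumes "tame w"
  shows "tame (iconcat w)"
  unfolding tame_def
proof (intro conjI impI)
  show "evpoly (\<lambda>M. int (length (iconcat w M)))"
    using assms by - (rule evpoly_summation, simp add: tame_def)
  assume "evconst (\<lambda>M. int (length (iconcat w M)))"
  then obtain c where c: "\<forall>\<^sub>F M in sequentially. int (length (iconcat w M)) = c"
    unfolding evconst_def by blast
  have "\<forall>\<^sub>F M in sequentially. iconcat w (Suc M) = iconcat w M"
    using c eventually_Suc[OF c] by eventually_elim auto
  then show "evconst (iconcat w)" by (rule evconst_step)
qed

lemma nth_concat_replicate:
  "p < m * length x \<Longrightarrow> concat (replicate m x) ! p = x ! (p mod length x)"
proof (induction m arbitrary: p)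
  case (Suc m)
  show ?case
  proof (cases "p < length x")
    case False
    then have "p - length x < m * length x" using Suc.prems by auto
    then show ?thesis using Suc.IH False by (simp add: nth_append le_mod_geq)
  qed (simp add: nth_append)
qed simp

lemma length_concat_replicate: "length (concat (replicate m x)) = m * length x"
  by (induction m) auto

lemma breaks_concat_replicate:
  assumes "length x dvd Q"
  shows "breaks Q (concat (replicate m x)) = {}"
proof -
  have "(p + Q) mod length x = p mod length x" for p using assms by (auto simp: dvd_def)
  then show ?thesis
    by (auto simp: breaks_def length_concat_replicate nth_concat_replicate)
qed

lemma breaks_sublist_empty: "sublist m w \<Longrightarrow> breaks Q w = {} \<Longrightarrow> breaks Q m = {}"
  by (metis breaks_sublist empty_iff subsetI subset_empty)

lemma suffix_lastn: "suffix (lastn Q w) w"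
  unfolding lastn_def by (rule suffix_drop)

lemma evconst_take_iconcat:
  assumes "tame w"
  shows "evconst (\<lambda>M. take Q (iconcat w M))"
  using tame_iconcat[OF assms]
proof (cases rule: tame_length_cases)
  case (1 x)
  then show ?thesis using evconst_compose[of "iconcat w" "take Q"] by (auto simp: evconst_def)
next
  case 2
  have "\<forall>\<^sub>F M in sequentially. take Q (iconcat w (Suc M)) = take Q (iconcat w M)"
    using 2[of Q] by eventually_elim simp
  then show ?thesis by (rule evconst_step)
qed

text \<open>If the lengths are unbounded, then a break in every pair of neighbours would put two breaks
  into five consecutive words whose distance is at least the length of the middle word.\<close>

lemma nice_iconcat:
  assumes w: "nice Q w"
    and per: "\<And>x. \<forall>\<^sub>F M in sequentially. w M = x \<Longrightarrow> x \<noteq> [] \<Longrightarrow> length x dvd Q"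
    and pair: "clustered (\<lambda>M. breaks Q (w M @ w (Suc M)))"
    and five: "clustered (\<lambda>M. breaks Q
      (w M @ w (Suc M) @ w (Suc (Suc M)) @ w (Suc (Suc (Suc M))) @ w (Suc (Suc (Suc (Suc M))))))"
  shows "evconst (\<lambda>M. breaks Q (iconcat w M))" and "nice Q (iconcat w)"
proof -
  have tw: "tame w" using w by (rule nice_tame)
  have *: "evconst (\<lambda>M. breaks Q (iconcat w M)) \<and> evconst (\<lambda>M. lastn Q (iconcat w M))"
    using tw
  proof (cases rule: tame_length_cases)
    case (1 x)
    then obtain N where N: "\<And>M. M \<ge> N \<Longrightarrow> w M = x" unfolding eventually_sequentially by blast
    have rep: "iconcat w (N + m) = iconcat w N @ concat (replicate m x)" for m
    proof (induction m)
      case (Suc m)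
      have "concat (replicate m x) @ x = x @ concat (replicate m x)" by (induction m) auto
      then show ?case using Suc N by simp
    qed simp
    show ?thesis
    proof (cases "x = []")
      case True
      have "\<forall>\<^sub>F M in sequentially. iconcat w (Suc M) = iconcat w M"
        using 1 by eventually_elim (simp add: True)
      then have "evconst (iconcat w)" by (rule evconst_step)
      then show ?thesis
        using evconst_compose[of "iconcat w" "breaks Q"] evconst_compose[of "iconcat w" "lastn Q"] by simp
    next
      case False
      have dvd: "length x dvd Q" using per[OF 1 False] .
      \<comment> \<open>\<open>Q\<close> copies of the nonempty \<open>x\<close> have at least
        \<open>Q\<close> letters. So the last \<open>Q\<close> letters no longer depend on
        \<open>M\<close>, and the junction with the next \<open>x\<close> lies inside a power of
        \<open>x\<close>, where period \<open>Q\<close> never fails.\<close>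
      have dec: "\<exists>y. iconcat w M = y @ concat (replicate Q x)" if "M \<ge> N + Q" for M
      proof -
        have m: "M = N + ((M - N - Q) + Q)" using that by simp
        show ?thesis by (subst m, subst rep) (simp add: replicate_add)
      qed
      have long: "Q \<le> length (concat (replicate Q x))"
        using False by (cases x) (auto simp: length_concat_replicate)
      have L: "lastn Q (iconcat w M) = lastn Q (concat (replicate Q x))" if "M \<ge> N + Q" for M
        using dec[OF that] lastn_append_long[OF long] by auto
      have "breaks Q (iconcat w (Suc M)) = breaks Q (iconcat w M)" if "M \<ge> N + Q" for M
      proof -
        have "suffix (lastn Q (concat (replicate Q x)) @ x) (concat (replicate Q x) @ x)"
          using suffix_lastn by (auto simp: suffix_def)
        moreover have "concat (replicate Q x) @ x = concat (replicate (Q + 1) x)"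
          unfolding replicate_add by simp
        ultimately have "breaks Q (lastn Q (concat (replicate Q x)) @ x) = {}"
          using breaks_concat_replicate[OF dvd] by (metis breaks_sublist_empty suffix_imp_sublist)
        then show ?thesis using that N[of M] L[OF that]
          by (simp add: breaks_append_left[of Q "iconcat w M"])
      qed
      then have "evconst (\<lambda>M. breaks Q (iconcat w M))"
        by (intro evconst_step eventually_sequentiallyI)
      moreover have "evconst (\<lambda>M. lastn Q (iconcat w M))"
        unfolding evconst_def using L by (blast intro: eventually_sequentiallyI)
      ultimately show ?thesis ..
    qed
  next
    case 2
    obtain p D where D: "\<forall>\<^sub>F M in sequentially. int ` breaks Q (w M @ w (Suc M)) = (+) (p M) ` D"
      using pair unfolding clustered_def by blast
    have "D = {}"
    proof (rule ccontr)
      assume "D \<noteq> {}"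
      let ?five = "\<lambda>M. w M @ w (Suc M) @ w (Suc (Suc M)) @ w (Suc (Suc (Suc M)))
        @ w (Suc (Suc (Suc (Suc M))))"
      obtain p' D' where D': "finite D'"
        "\<forall>\<^sub>F M in sequentially. int ` breaks Q (?five M) = (+) (p' M) ` D'"
        using five unfolding clustered_def by blast
      have ne: "\<forall>\<^sub>F M in sequentially. breaks Q (w M @ w (Suc M)) \<noteq> {}"
        using D by eventually_elim (use \<open>D \<noteq> {}\<close> in auto)
      have ne3: "\<forall>\<^sub>F M in sequentially.
          breaks Q (w (Suc (Suc (Suc M))) @ w (Suc (Suc (Suc (Suc M))))) \<noteq> {}"
        by (rule eventually_Suc[of "\<lambda>M. breaks Q (w (Suc (Suc M)) @ w (Suc (Suc (Suc M)))) \<noteq> {}"],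
            rule eventually_Suc[of "\<lambda>M. breaks Q (w (Suc M) @ w (Suc (Suc M))) \<noteq> {}"],
            rule eventually_Suc[OF ne])
      \<comment> \<open>One more than the diameter of the pattern \<open>D'\<close>, so that a
        middle word of this length is a contradiction.\<close>
      define K where "K = nat (Max D' - Min D') + 1"
      have lK: "\<forall>\<^sub>F M in sequentially. K \<le> length (w (Suc (Suc M)))"
        by (rule eventually_Suc[of "\<lambda>M. K \<le> length (w (Suc M))"], rule eventually_Suc[OF 2])
      from ne ne3 lK D'(2) have "\<forall>\<^sub>F M::nat in sequentially. False"
      proof eventually_elim
        case (elim M)
        obtain q where q: "q \<in> breaks Q (w M @ w (Suc M))" using elim by blast
        obtain q' where q': "q' \<in> breaks Q (w (Suc (Suc (Suc M))) @ w (Suc (Suc (Suc (Suc M)))))"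
          using elim by blast
        let ?l = "length (w M @ w (Suc M) @ w (Suc (Suc M)))"
        have a: "q \<in> breaks Q (?five M)"
          using q mem_breaks_middle[of q Q "w M @ w (Suc M)" "[]"
            "w (Suc (Suc M)) @ w (Suc (Suc (Suc M))) @ w (Suc (Suc (Suc (Suc M))))"] by simp
        have b: "?l + q' \<in> breaks Q (?five M)"
          using q' mem_breaks_middle[of q' Q "w (Suc (Suc (Suc M))) @ w (Suc (Suc (Suc (Suc M))))"
            "w M @ w (Suc M) @ w (Suc (Suc M))" "[]"] by simp
        have "int q \<in> (+) (p' M) ` D'" "int (?l + q') \<in> (+) (p' M) ` D'"
          using a b elim(4) by blast+
        then obtain d d' where d: "d \<in> D'" "d' \<in> D'" "int q = p' M + d" "int (?l + q') = p' M + d'"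
          by blast
        have "d' - d \<le> Max D' - Min D'"
          using Max_ge[OF D'(1) d(2)] Min_le[OF D'(1) d(1)] by linarith
        moreover have "q < length (w M @ w (Suc M))" using q by (auto simp: breaks_def)
        ultimately have "length (w (Suc (Suc M))) < K" using d unfolding K_def by simp
        then show False using elim(3) by simp
      qed
      then show False by simp
    qed
    \<comment> \<open>Once \<open>w M\<close> has \<open>Q\<close> letters, the junction with
      \<open>w (Suc M)\<close> lies inside the pair \<open>w M @ w (Suc M)\<close>, which has no
      breaks.\<close>
    have "\<forall>\<^sub>F M in sequentially. breaks Q (iconcat w (Suc (Suc M))) = breaks Q (iconcat w (Suc M))"
      using D 2[of Q]
    proof eventually_elim
      case (elim M)
      have "suffix (lastn Q (w M) @ w (Suc M)) (w M @ w (Suc M))"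
        using suffix_lastn by (auto simp: suffix_def)
      then have "breaks Q (lastn Q (w M) @ w (Suc M)) = {}"
        by (rule breaks_sublist_empty[OF suffix_imp_sublist]) (use elim(1) \<open>D = {}\<close> in simp)
      then show ?case
        using breaks_append_left[of Q "iconcat w (Suc M)" "w (Suc M)"] lastn_append_long[OF elim(2)]
        by simp
    qed
    then have "evconst (\<lambda>M. breaks Q (iconcat w (Suc M)))" by (rule evconst_step)
    then have "evconst (\<lambda>M. breaks Q (iconcat w M))"
      by (rule evconst_shift[of "\<lambda>M. breaks Q (iconcat w M)", THEN iffD1])
    moreover have "evconst (\<lambda>M. lastn Q (iconcat w M))"
    proof -
      obtain S where S: "\<forall>\<^sub>F M in sequentially. lastn Q (w M) = S"
        using w unfolding nice_def evconst_def by blast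
      have "\<forall>\<^sub>F M in sequentially. lastn Q (iconcat w (Suc M)) = S"
        using S 2[of Q] by eventually_elim (simp add: lastn_append_long)
      then have "evconst (\<lambda>M. lastn Q (iconcat w (Suc M)))" unfolding evconst_def by blast
      then show ?thesis by (rule evconst_shift[of "\<lambda>M. lastn Q (iconcat w M)", THEN iffD1])
    qed
    ultimately show ?thesis ..
  qed
  then show "evconst (\<lambda>M. breaks Q (iconcat w M))" ..
  then obtain D where D: "\<forall>\<^sub>F M in sequentially. breaks Q (iconcat w M) = D"
    unfolding evconst_def by blast
  have "finite D"
  proof -
    obtain M where "breaks Q (iconcat w M) = D" using D unfolding eventually_sequentially by auto
    then show ?thesis using finite_breaks[of Q "iconcat w M"] by simp
  qed
  then have "clustered (\<lambda>M. breaks Q (iconcat w M))" using D by (rule clustered_const)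
  then show "nice Q (iconcat w)"
    using * tame_iconcat[OF tw] evconst_take_iconcat[OF tw] by (simp add: nice_def)
qed

section \<open>Iterated morphisms\<close>

definition ext :: "('a \<Rightarrow> 'b list) \<Rightarrow> 'a list \<Rightarrow> 'b list" where
  "ext f u = concat (map f u)"

definition img :: "('a \<Rightarrow> 'a list) \<Rightarrow> ('a \<Rightarrow> 'b list) \<Rightarrow> nat \<Rightarrow> 'a list \<Rightarrow> 'b list" where
  "img f g M u = ext g ((ext f ^^ M) u)"

lemma ext_simps [simp]:
  "ext f [] = []" "ext f (b # u) = f b @ ext f u" "ext f (u @ v) = ext f u @ ext f v"
  by (simp_all add: ext_def)

lemma ext_funpow_append [simp]: 
  fixes f :: "'a \<Rightarrow> 'a list"
  shows "(ext f ^^ M) (u @ v) = (ext f ^^ M) u @ (ext f ^^ M) v"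
  by (induction M) auto

lemma ext_funpow_Nil [simp]: 
  fixes f :: "'a \<Rightarrow> 'a list"
  shows "(ext f ^^ M) [] = []"
  by (induction M) auto

lemma img_0 [simp]: "img f g 0 u = ext g u"
  by (simp add: img_def)

lemma img_Nil [simp]: "img f g M [] = []"
  by (simp add: img_def)

lemma img_append [simp]: "img f g M (u @ v) = img f g M u @ img f g M v"
  by (simp add: img_def)

lemma img_Cons: "img f g M (b # u) = img f g M [b] @ img f g M u"
  using img_append[of f g M "[b]" u] by simp

lemma img_add: "img f g (M + j) u = img f g M ((ext f ^^ j) u)"
  by (simp add: img_def funpow_add)

lemma img_Suc: "img f g (Suc M) u = img f g M (ext f u)"
  using img_add[of f g M 1 u] by simp

lemma img_Suc_single: "img f g (Suc M) [b] = img f g M (f b)"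
  by (simp add: img_Suc)

lemma set_ext [simp]: "set (ext f u) = (\<Union>b\<in>set u. set (f b))"
  by (auto simp: ext_def)

lemma rev_ext: "rev (ext f u) = ext (\<lambda>b. rev (f b)) (rev u)"
  by (induction u) auto

lemma rev_ext_funpow: 
  fixes f :: "'a \<Rightarrow> 'a list"
  shows "rev ((ext f ^^ M) u) = (ext (\<lambda>b. rev (f b)) ^^ M) (rev u)"
  by (induction M) (auto simp: rev_ext)

lemma rev_img: "rev (img f g M u) = img (\<lambda>b. rev (f b)) (\<lambda>b. rev (g b)) M (rev u)"
  by (simp add: img_def rev_ext rev_ext_funpow)

text \<open>Each application of \<open>f\<close> puts a new \<open>z\<close> and a new
  \<open>t\<close> next to the surviving \<open>d\<close>; older copies have been mapped more often
  and lie further out. Hence indices increase outwards, in \<open>rconcat\<close> to the left and in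
  \<open>iconcat\<close> to the right.\<close>

lemma img_fixed_letter:
  assumes "f d = z @ [d] @ t"
  shows "img f g M [d] = rconcat (\<lambda>i. img f g i z) M @ g d @ iconcat (\<lambda>i. img f g i t) M"
proof (induction M)
  case (Suc M)
  then show ?case unfolding img_Suc_single assms by (simp add: img_Cons[of f g M d t])
qed simp

lemma ext_funpow_fixed_letter:
  assumes "f d = z @ [d] @ t"
  shows "(ext f ^^ M) [d] = rconcat (\<lambda>i. (ext f ^^ i) z) M @ [d] @ iconcat (\<lambda>i. (ext f ^^ i) t) M"
proof -
  have e: "ext (\<lambda>b. [b]) u = u" for u :: "'a list" by (induction u) auto
  show ?thesis using img_fixed_letter[of f d z t "\<lambda>b. [b]" M] assms by (simp add: img_def e)
qed

lemma length_ext_ge: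
  assumes "\<And>b. f b \<noteq> []"
  shows "length u \<le> length (ext f u)"
proof (induction u)
  case (Cons b u)
  have "0 < length (f b)" using assms by simp
  then show ?case using Cons by (simp only: ext_simps length_append length_Cons)
qed simp

lemma img_sublist: "sublist u v \<Longrightarrow> sublist (img f g M u) (img f g M v)"
  unfolding sublist_def by (metis img_append)

lemma count_list_ext: "count_list (ext f u) c \<ge> count_list (f b) c * count_list u b"
  by (induction u) (auto simp: count_list_append)

lemma tame_rconcat:
  assumes "tame w"
  shows "tame (rconcat w)"
proof -
  have "rconcat w = (\<lambda>M. rev (iconcat (\<lambda>i. rev (w i)) M))"
    by (simp add: rev_iconcat)
  then show ?thesis using tame_rev[OF tame_iconcat[OF tame_rev[OF assms]]] by simp
qed

lemma sublist_append_before: "sublist x y \<Longrightarrow> sublist x (p @ y)"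
  by (meson sublist_append_leftI sublist_order.order.trans)

lemma tame_word:
  "(\<And>c. c \<in> set u \<Longrightarrow> tame (\<lambda>M. img f g M [c])) \<Longrightarrow> tame (\<lambda>M. img f g M u)"
proof (induction u)
  case (Cons c u)
  then show ?case unfolding img_Cons[of f g _ c u] by (intro tame_append) auto
qed simp

lemma last_remdups: "last (remdups xs) = last xs"
  by (induction xs) auto

text \<open>The last three assumptions hold for a suitable power of any nonerasing map. As \<open>remdups\<close> keeps
  last occurrences, \<open>last_stable\<close> and \<open>first_stable\<close> determine the last and the first letter outside
  any closed set of letters; see \<open>leftmost_fixed\<close>.\<close>

locale letter_morphism =
  fixes f g :: "'a::finite \<Rightarrow> 'a list"
  assumes f_ne: "f b \<noteq> []" and g_ne: "g b \<noteq> []"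
    and double: "2 \<le> count_list ((ext f ^^ L) [b]) b \<Longrightarrow> 2 \<le> count_list (f b) b"
    and last_stable: "remdups (ext f (f b)) = remdups (f b)"
    and first_stable: "remdups (rev (ext f (f b))) = remdups (rev (f b))"
begin

abbreviation W where "W \<equiv> img f g"

lemma letter_morphism_rev: "letter_morphism (\<lambda>b. rev (f b)) (\<lambda>b. rev (g b))"
proof
  fix L b
  assume "2 \<le> count_list ((ext (\<lambda>b. rev (f b)) ^^ L) [b]) b"
  then have "2 \<le> count_list (rev ((ext f ^^ L) [b])) b" by (simp add: rev_ext_funpow)
  then show "2 \<le> count_list (rev (f b)) b" using double[of L b] by simp
qed (use f_ne g_ne in \<open>auto simp: rev_ext[symmetric] last_stable first_stable\<close>)

lemma set_stable: "(\<Union>c\<in>set (f b). set (f c)) = set (f b)"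
  using arg_cong[OF last_stable[of b], of set] by simp

lemma set_f_trans: "c \<in> set (f b) \<Longrightarrow> set (f c) \<subseteq> set (f b)"
  using set_stable[of b] by blast

text \<open>By \<open>set_stable\<close>, all letters reachable from \<open>b\<close> are in
  \<open>insert b (set (f b))\<close>. That none of them doubles itself characterizes polynomial
  growth: see \<open>polynomial_tame\<close> and \<open>not_polynomial_exponential\<close>.\<close>

definition polynomial :: "'a \<Rightarrow> bool" where
  "polynomial b \<longleftrightarrow> (\<forall>c\<in>insert b (set (f b)). count_list (f c) c < 2)"

lemma polynomial_descend: "polynomial b \<Longrightarrow> c \<in> set (f b) \<Longrightarrow> polynomial c"
  using set_f_trans unfolding polynomial_def by blast

lemma count_list_ext_ge: "y \<in> set u \<Longrightarrow> count_list (f y) x \<le> count_list (ext f u) x"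
  by (induction u) (auto simp: count_list_append)

text \<open>A return to \<open>b\<close> would put \<open>b\<close> into \<open>f b\<close> by
  transitivity, and then twice into \<open>f (f b)\<close>: through \<open>c\<close> and through
  \<open>b\<close> itself. By \<open>double\<close> it would occur twice in \<open>f b\<close>. So
  loops are the only cycles among polynomial letters, which permits induction along
  reachability.\<close>

lemma polynomial_no_return:
  assumes "polynomial b" "c \<in> set (f b)" "c \<noteq> b"
  shows "b \<notin> set (f c)"
proof
  assume bc: "b \<in> set (f c)"
  then have bb: "b \<in> set (f b)" using assms(2) set_f_trans by blast
  obtain p q where pq: "f b = p @ b # q" using split_list[OF bb] by blast
  have one: "1 \<le> count_list u b" if "b \<in> set u" for u
    using that by (metis count_notin count_list_0_iff less_one linorder_not_le)
  have "c \<in> set (p @ q)" using assms(2,3) pq by auto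
  then have "count_list (f c) b \<le> count_list (ext f (p @ q)) b" by (rule count_list_ext_ge)
  then have "2 \<le> count_list (ext f (f b)) b"
    using one[OF bc] one[OF bb] by (subst pq) (simp add: count_list_append)
  then have "2 \<le> count_list (f b) b" using double[of 2 b] by (simp add: numeral_2_eq_2)
  then show False using assms(1) unfolding polynomial_def by auto
qed

lemma polynomial_induct [consumes 1, case_names step]:
  assumes "polynomial b"
    and "\<And>b. polynomial b \<Longrightarrow> (\<And>c. c \<in> set (f b) \<Longrightarrow> c \<noteq> b \<Longrightarrow> P c) \<Longrightarrow> P b"
  shows "P b"
  using assms(1)
proof (induction "card (insert b (set (f b)))" arbitrary: b rule: less_induct)
  case less
  show ?case
  proof (rule assms(2)[OF less.prems])
    fix c assume c: "c \<in> set (f b)" "c \<noteq> b"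
    \<comment> \<open>The measure drops because \<open>b\<close> itself cannot be reached from
      \<open>c\<close>.\<close>
    have "insert c (set (f c)) \<subset> insert b (set (f b))"
      using c set_f_trans[OF c(1)] polynomial_no_return[OF less.prems c] by auto
    then have "card (insert c (set (f c))) < card (insert b (set (f b)))"
      by (intro psubset_card_mono) auto
    then show "P c" using less.hyps polynomial_descend[OF less.prems c(1)] by blast
  qed
qed

lemma polynomial_cyclicE:
  assumes "polynomial b" "b \<in> set (f b)"
  obtains z t where "f b = z @ [b] @ t" "b \<notin> set z" "b \<notin> set t"
proof -
  obtain z t where zt: "f b = z @ b # t" using split_list[OF assms(2)] by blast
  have "count_list z b + count_list t b < 1"
    using assms(1) zt unfolding polynomial_def by (auto simp: count_list_append)
  then have "b \<notin> set z" "b \<notin> set t" by (auto simp: count_list_0_iff)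
  with zt that show ?thesis by simp
qed

text \<open>A letter that recurs is resolved by \<open>img_fixed_letter\<close> into concatenations
  over earlier letters of the induction; for any other letter, \<open>W (Suc M) [b]\<close> is the
  image of a word of earlier letters.\<close>

lemma polynomial_tame: "polynomial b \<Longrightarrow> tame (\<lambda>M. W M [b])"
proof (induction rule: polynomial_induct)
  case (step b)
  show ?case
  proof (cases "b \<in> set (f b)")
    case True
    then obtain z t where zt: "f b = z @ [b] @ t" "b \<notin> set z" "b \<notin> set t"
      using polynomial_cyclicE step.hyps by blast
    have "tame (\<lambda>M. W M z)" "tame (\<lambda>M. W M t)"
      by (rule tame_word, use step.IH zt in auto)+
    then show ?thesis unfolding img_fixed_letter[of f, OF zt(1)]
      by (intro tame_append tame_rconcat tame_iconcat tame_const)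
  next
    case False
    have "tame (\<lambda>M. W M (f b))" using step.IH False by - (rule tame_word, metis)
    then show ?thesis using tame_shift[of "\<lambda>M. W M [b]"] by (simp add: img_Suc_single)
  qed
qed

lemma length_le_length_W: "length ((ext f ^^ M) u) \<le> length (W M u)"
  unfolding img_def by (rule length_ext_ge) (rule g_ne)

text \<open>Some reachable letter doubles at every level. The factor \<open>2\<close> pays for the
  one level needed to get from \<open>b\<close> to that letter.\<close>

lemma not_polynomial_exponential:
  assumes "\<not> polynomial b"
  shows "2 ^ M \<le> 2 * length (W M [b])"
proof -
  obtain c where c: "c \<in> insert b (set (f b))" "2 \<le> count_list (f c) c"
    using assms unfolding polynomial_def by force
  have cnt: "2 ^ M \<le> count_list ((ext f ^^ M) [c]) c" for M
  proof (induction M)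
    case (Suc M)
    have "2 * 2 ^ M \<le> count_list (f c) c * count_list ((ext f ^^ M) [c]) c"
      using c(2) Suc by (rule mult_le_mono)
    also have "\<dots> \<le> count_list ((ext f ^^ Suc M) [c]) c" using count_list_ext by simp
    finally show ?case by simp
  qed simp
  have lc: "2 ^ M \<le> length (W M [c])" for M
    using cnt[of M] count_le_length[of "(ext f ^^ M) [c]" c] length_le_length_W[of M "[c]"]
    by linarith
  show ?thesis
  proof (cases M)
    case 0
    have "0 < length (W 0 [b])" using g_ne by simp
    then show ?thesis unfolding 0 power_0 by linarith
  next
    case (Suc N)
    show ?thesis
    proof (cases "c = b")
      case False
      then have "sublist [c] (f b)" using c(1) by (auto simp: sublist_def dest: split_list)
      then have "length (W N [c]) \<le> length (W N (f b))" by (intro sublist_length_le img_sublist)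
      then show ?thesis using lc[of N] Suc by (simp add: img_Suc_single)
    qed (use lc[of M] in simp)
  qed
qed

text \<open>Letters of \<open>S\<close> stay in \<open>S\<close>, so the first letter outside
  \<open>S\<close> in \<open>f (f y)\<close> is the first such letter in \<open>f d\<close>. By
  \<open>first_stable\<close> it equals the one in \<open>f y\<close>, which is \<open>d\<close>.
  Hence \<open>d\<close> is the first letter outside \<open>S\<close> of its own image.\<close>

lemma leftmost_fixed:
  assumes closed: "\<And>b. b \<in> S \<Longrightarrow> set (f b) \<subseteq> S"
    and fy: "f y = s @ [d] @ r" "set s \<subseteq> S" "d \<notin> S" and "\<not> set (f d) \<subseteq> S"
  obtains z t where "f d = z @ [d] @ t" "set z \<subseteq> S"
proof -
  have "\<exists>x\<in>set (f d). x \<notin> S" using assms(5) by blast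
  then obtain z e t where zet: "f d = z @ e # t" "e \<notin> S" "\<forall>x\<in>set z. \<not> x \<notin> S"
    by (rule split_list_first_propE)
  let ?P = "\<lambda>x. x \<notin> S"
  have key: "last (filter ?P (rev (p @ x # q))) = x" if "set p \<subseteq> S" "x \<notin> S" for p x q
  proof -
    have "filter ?P p = []" using that(1) by (auto simp: filter_empty_conv)
    then show ?thesis using that(2) by (simp add: rev_filter[symmetric])
  qed
  \<comment> \<open>\<open>remdups\<close> keeps last occurrences, so it preserves the last letter
    outside \<open>S\<close>; applied to a reversed word, this is the first one.\<close>
  have l: "last (filter ?P (remdups u)) = last (filter ?P u)" for u
    by (metis last_remdups remdups_filter)
  have e2: "ext f (f y) = (ext f s @ z) @ e # (t @ ext f r)" by (simp add: fy zet)
  have "set (ext f s @ z) \<subseteq> S" using fy(2) zet(3) closed by auto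
  then have "last (filter ?P (rev (ext f (f y)))) = e" unfolding e2 using key zet(2) by blast
  moreover have "last (filter ?P (rev (f y))) = d" using key[of s d r] fy by simp
  ultimately have "d = e" using l[of "rev (ext f (f y))"] l[of "rev (f y)"] first_stable[of y] by simp
  then show ?thesis using that[of z t] zet by auto
qed

end

section \<open>Comparison of growth rates\<close>

definition poly_bounded :: "nat \<Rightarrow> (nat \<Rightarrow> nat) \<Rightarrow> bool" where
  "poly_bounded \<kappa> s \<longleftrightarrow> (\<exists>C. \<forall>\<^sub>F M in sequentially. real (s M) \<le> C * real M ^ \<kappa>)"

definition large :: "(nat \<Rightarrow> real) \<Rightarrow> (nat \<Rightarrow> nat) \<Rightarrow> bool" where
  "large \<tau> s \<longleftrightarrow> (\<exists>c>0. \<forall>\<^sub>F M in sequentially. c * \<tau> M \<le> real (s M))"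

lemma poly_boundedE:
  assumes "poly_bounded \<kappa> s"
  obtains C where "C \<ge> 0" "\<forall>\<^sub>F M in sequentially. real (s M) \<le> C * real M ^ \<kappa>"
proof -
  obtain C where C: "\<forall>\<^sub>F M in sequentially. real (s M) \<le> C * real M ^ \<kappa>"
    using assms unfolding poly_bounded_def by blast
  then have "\<forall>\<^sub>F M in sequentially. real (s M) \<le> \<bar>C\<bar> * real M ^ \<kappa>"
  proof eventually_elim
    case (elim M)
    have "C * real M ^ \<kappa> \<le> \<bar>C\<bar> * real M ^ \<kappa>" by (intro mult_right_mono) auto
    then show ?case using elim by linarith
  qed
  then show ?thesis using that[of "\<bar>C\<bar>"] by simp
qed

lemma poly_bounded_mono:
  assumes "poly_bounded \<kappa> s" "\<forall>\<^sub>F M in sequentially. r M \<le> s M"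
  shows "poly_bounded \<kappa> r"
proof -
  obtain C where C: "\<forall>\<^sub>F M in sequentially. real (s M) \<le> C * real M ^ \<kappa>"
    using assms unfolding poly_bounded_def by blast
  from C assms(2) have "\<forall>\<^sub>F M in sequentially. real (r M) \<le> C * real M ^ \<kappa>"
    by eventually_elim (simp add: order_trans)
  then show ?thesis unfolding poly_bounded_def by blast
qed

lemma poly_bounded_add:
  assumes "poly_bounded \<kappa> s" "poly_bounded \<kappa> r"
  shows "poly_bounded \<kappa> (\<lambda>M. s M + r M)"
proof -
  obtain C D where "\<forall>\<^sub>F M in sequentially. real (s M) \<le> C * real M ^ \<kappa>"
    "\<forall>\<^sub>F M in sequentially. real (r M) \<le> D * real M ^ \<kappa>"
    using assms unfolding poly_bounded_def by blast
  then have "\<forall>\<^sub>F M in sequentially. real (s M + r M) \<le> (C + D) * real M ^ \<kappa>"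
    by eventually_elim (simp add: algebra_simps)
  then show ?thesis unfolding poly_bounded_def by blast
qed

lemma poly_bounded_const: "poly_bounded \<kappa> (\<lambda>M. c)"
proof -
  have "\<forall>\<^sub>F M in sequentially. real c \<le> real c * real M ^ \<kappa>"
    using eventually_ge_at_top[of 1]
  proof eventually_elim
    case (elim M)
    have "1 \<le> real M ^ \<kappa>" using elim by (intro one_le_power) simp
    then have "real c * 1 \<le> real c * real M ^ \<kappa>" by (intro mult_left_mono) auto
    then show ?case by simp
  qed
  then show ?thesis unfolding poly_bounded_def by blast
qed

lemma poly_bounded_Suc:
  assumes "poly_bounded \<kappa> s"
  shows "poly_bounded \<kappa> (\<lambda>M. s (Suc M))"
proof -
  obtain C where C: "C \<ge> 0" "\<forall>\<^sub>F M in sequentially. real (s M) \<le> C * real M ^ \<kappa>"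
    using poly_boundedE[OF assms] by blast
  have "\<forall>\<^sub>F M in sequentially. real (s (Suc M)) \<le> (C * 2 ^ \<kappa>) * real M ^ \<kappa>"
    using eventually_Suc[OF C(2)] eventually_ge_at_top[of 1]
  proof eventually_elim
    case (elim M)
    have "C * real (Suc M) ^ \<kappa> \<le> C * (2 * real M) ^ \<kappa>"
      using elim C(1) by (intro mult_left_mono power_mono) auto
    then show ?case using elim(1) by (simp add: power_mult_distrib)
  qed
  then show ?thesis unfolding poly_bounded_def by blast
qed

lemma poly_bounded_shift: "poly_bounded \<kappa> s \<Longrightarrow> poly_bounded \<kappa> (\<lambda>M. s (M + j))"
proof (induction j)
  case (Suc j)
  then show ?case using poly_bounded_Suc[of \<kappa> "\<lambda>M. s (M + j)"] by simp
qed simp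

lemma power_le_exponential: "\<forall>\<^sub>F M in sequentially. C * real M ^ \<kappa> \<le> 2 ^ M"
proof -
  have "((\<lambda>x::real. x ^ \<kappa> / exp x) \<longlongrightarrow> 0) at_top" by (rule tendsto_power_div_exp_0)
  moreover have "filterlim (\<lambda>M. ln 2 * real M) at_top sequentially"
    by (rule filterlim_tendsto_pos_mult_at_top[OF tendsto_const]) (auto intro: filterlim_real_sequentially)
  ultimately have lim: "(\<lambda>M. (ln 2 * real M) ^ \<kappa> / exp (ln 2 * real M)) \<longlonglongrightarrow> 0"
    by (rule filterlim_compose)
  \<comment> \<open>With this bound on the quotient the powers of \<open>ln 2\<close> cancel and
    \<open>M^\<kappa> (\<bar>C\<bar> + 1) < 2^M\<close> remains.\<close>
  define e where "e = ln 2 ^ \<kappa> / (\<bar>C\<bar> + 1 :: real)"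
  have "e > 0" by (simp add: e_def)
  from order_tendstoD(2)[OF lim this] show ?thesis
  proof eventually_elim
    case (elim M)
    have ex: "exp (ln 2 * real M) = 2 ^ M" by (simp add: exp_of_nat2_mult)
    have "(ln 2 * real M) ^ \<kappa> < e * 2 ^ M" using elim unfolding ex by (simp add: field_simps)
    then have "ln 2 ^ \<kappa> * real M ^ \<kappa> * (\<bar>C\<bar> + 1) < ln 2 ^ \<kappa> * 2 ^ M"
      by (simp add: e_def field_simps power_mult_distrib)
    then have "ln 2 ^ \<kappa> * (real M ^ \<kappa> * (\<bar>C\<bar> + 1)) < ln 2 ^ \<kappa> * 2 ^ M" by (simp only: mult.assoc)
    then have "real M ^ \<kappa> * (\<bar>C\<bar> + 1) < 2 ^ M" by (simp add: mult_less_cancel_left_pos)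
    moreover have "C * real M ^ \<kappa> \<le> real M ^ \<kappa> * (\<bar>C\<bar> + 1)"
      by (subst mult.commute) (intro mult_left_mono, auto)
    ultimately show ?case by linarith
  qed
qed

lemma (in letter_morphism) poly_bounded_polynomial:
  assumes "poly_bounded \<kappa> (\<lambda>M. length (W M [b]))"
  shows "polynomial b"
proof (rule ccontr)
  assume np: "\<not> polynomial b"
  obtain C where C: "C \<ge> 0" "\<forall>\<^sub>F M in sequentially. real (length (W M [b])) \<le> C * real M ^ \<kappa>"
    using assms poly_boundedE by blast
  have "\<forall>\<^sub>F M in sequentially. (2 * C + 1) * real M ^ \<kappa> \<le> 2 ^ M" by (rule power_le_exponential)
  with C(2) eventually_gt_at_top[of 0] have "\<forall>\<^sub>F M::nat in sequentially. False"
  proof eventually_elim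
    case (elim M)
    have "real (2 ^ M) \<le> real (2 * length (W M [b]))"
      using not_polynomial_exponential[OF np, of M] by (rule of_nat_mono)
    then have "2 ^ M \<le> 2 * (C * real M ^ \<kappa>)" using elim(1) by simp
    moreover have "0 < real M ^ \<kappa>" using elim by simp
    moreover have "(2 * C + 1) * real M ^ \<kappa> = 2 * (C * real M ^ \<kappa>) + real M ^ \<kappa>"
      by (simp add: algebra_simps)
    ultimately show False using elim(3) by linarith
  qed
  then show False by simp
qed

text \<open>Letters of growth \<open>O(M^\<kappa>)\<close> are small, and \<open>\<tau>\<close> is a lower bound for the growth of the others:
  \<open>\<tau> M\<close> is \<open>M^(\<kappa> + 1)\<close> if \<open>\<kappa> + 1\<close> is the least exponent of a family of gaps, and \<open>2^M\<close> if there is none.\<close>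

locale scaled_morphism = letter_morphism f g for f g :: "'a::finite \<Rightarrow> 'a list" +
  fixes Q \<kappa> :: nat and \<tau> :: "nat \<Rightarrow> real"
  assumes Q_pos: "0 < Q"
    and period: "sublist t (f b) \<Longrightarrow> \<forall>\<^sub>F i in sequentially. img f g i t = x \<Longrightarrow> x \<noteq> [] \<Longrightarrow> length x dvd Q"
    and dominates: "\<forall>\<^sub>F M in sequentially. C * real M ^ \<kappa> \<le> \<tau> M"
    and no_gap: "evpoly L \<Longrightarrow>
      \<forall>\<^sub>F M in sequentially. consecutive_diff (breaks Q (img f g (M + j) [a])) (L M) \<Longrightarrow>
      poly_bounded \<kappa> (\<lambda>M. nat (L M)) \<Longrightarrow> evconst L"
    and small_or_large: "\<not> poly_bounded \<kappa> (\<lambda>M. length (img f g M [b])) \<Longrightarrow>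
      large \<tau> (\<lambda>M. length (img f g M [b]))"
    and sum_small_or_large: "\<forall>b\<in>set t. poly_bounded \<kappa> (\<lambda>M. length (img f g M [b])) \<Longrightarrow>
      poly_bounded \<kappa> (\<lambda>M. \<Sum>i<M. length (img f g i t)) \<or> large \<tau> (\<lambda>M. \<Sum>i<M. length (img f g i t))"
begin

definition small :: "'a \<Rightarrow> bool" where
  "small b \<longleftrightarrow> poly_bounded \<kappa> (\<lambda>M. length (W M [b]))"

text \<open>Every assumption is symmetric, so a statement about left ends is obtained by
  interpreting the locale for the reversed words.\<close>

lemma scaled_morphism_rev: "scaled_morphism (\<lambda>b. rev (f b)) (\<lambda>b. rev (g b)) Q \<kappa> \<tau>"
proof (intro scaled_morphism.intro letter_morphism_rev scaled_morphism_axioms.intro)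
  let ?V = "img (\<lambda>b. rev (f b)) (\<lambda>b. rev (g b))"
  show "0 < Q" by (rule Q_pos)
  have V: "?V M u = rev (W M (rev u))" for M u by (simp add: rev_img)
  show "length x dvd Q" if "sublist t (rev (f b))" "\<forall>\<^sub>F i in sequentially. ?V i t = x" "x \<noteq> []" for t b x
  proof -
    have "\<forall>\<^sub>F i in sequentially. W i (rev t) = rev x"
      using that(2) unfolding V by eventually_elim (metis rev_rev_ident)
    moreover have "sublist (rev t) (f b)" using that(1) by (metis sublist_rev rev_rev_ident)
    ultimately show ?thesis using period that(3) by fastforce
  qed
  show "\<forall>\<^sub>F M in sequentially. C * real M ^ \<kappa> \<le> \<tau> M" for C by (rule dominates)
  show "evconst L" if "evpoly L"
    "\<forall>\<^sub>F M in sequentially. consecutive_diff (breaks Q (?V (M + j) [x])) (L M)"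
    "poly_bounded \<kappa> (\<lambda>M. nat (L M))" for L j x
  proof -
    have "\<forall>\<^sub>F M in sequentially. consecutive_diff (breaks Q (W (M + j) [x])) (L M)"
      using that(2) unfolding V
      by eventually_elim (use consecutive_diff_breaks_rev in \<open>fastforce\<close>)
    then show ?thesis using no_gap that by blast
  qed
  show "large \<tau> (\<lambda>M. length (?V M [b]))" if "\<not> poly_bounded \<kappa> (\<lambda>M. length (?V M [b]))" for b
    using small_or_large[of b] that by (simp add: V)
  show "poly_bounded \<kappa> (\<lambda>M. \<Sum>i<M. length (?V i t)) \<or> large \<tau> (\<lambda>M. \<Sum>i<M. length (?V i t))"
    if "\<forall>b\<in>set t. poly_bounded \<kappa> (\<lambda>M. length (?V M [b]))" for t
    using sum_small_or_large[of "rev t"] that by (simp add: V)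
qed

text \<open>A gap between breaks of \<open>w M\<close> is shorter than \<open>w M\<close>, so its
  growth is \<open>O(M^\<kappa>)\<close> and \<open>no_gap\<close> applies.\<close>

lemma safeI:
  assumes "poly_bounded \<kappa> (\<lambda>M. length (w M))"
    and "\<forall>\<^sub>F M in sequentially. sublist (w M) (W (M + j) [x])"
  shows "safe Q w"
  unfolding safe_def
proof (intro allI impI)
  fix L assume L: "evpoly L" and ev: "\<forall>\<^sub>F M in sequentially. consecutive_diff (breaks Q (w M)) (L M)"
  have "\<forall>\<^sub>F M in sequentially. nat (L M) \<le> length (w M)"
    using ev by eventually_elim (auto simp: consecutive_diff_def breaks_def)
  then have "poly_bounded \<kappa> (\<lambda>M. nat (L M))" by (rule poly_bounded_mono[OF assms(1)])
  moreover have "\<forall>\<^sub>F M in sequentially. consecutive_diff (breaks Q (W (M + j) [x])) (L M)"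
    using ev assms(2) by eventually_elim (rule consecutive_diff_sublist)
  ultimately show "evconst L" using no_gap L by blast
qed

lemma small_descend:
  assumes "small b" "c \<in> set (f b)"
  shows "small c"
proof -
  have "sublist [c] (f b)" using assms(2) by (auto simp: sublist_def dest: split_list)
  then have "length (W M [c]) \<le> length (W (Suc M) [b])" for M
    unfolding img_Suc_single by (intro sublist_length_le img_sublist)
  then show ?thesis using poly_bounded_mono[OF poly_bounded_Suc] assms(1) unfolding small_def by simp
qed

lemma small_word: "\<forall>c\<in>set u. small c \<Longrightarrow> poly_bounded \<kappa> (\<lambda>M. length (W M u))"
proof (induction u)
  case (Cons c u)
  then have "poly_bounded \<kappa> (\<lambda>M. length (W M [c]) + length (W M u))"
    by (intro poly_bounded_add) (auto simp: small_def)
  then show ?case by (simp add: img_Cons[of f g _ c u])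
qed (simp add: poly_bounded_const)

lemma not_small_descend: "\<not> small b \<Longrightarrow> \<exists>c\<in>set (f b). \<not> small c"
proof (rule ccontr)
  assume "\<not> small b" "\<not> (\<exists>c\<in>set (f b). \<not> small c)"
  then have "poly_bounded \<kappa> (\<lambda>M. length (W (Suc M) [b]))"
    using small_word[of "f b"] by (simp add: img_Suc_single)
  then obtain C where C: "C \<ge> 0" "\<forall>\<^sub>F M in sequentially. real (length (W (Suc M) [b])) \<le> C * real M ^ \<kappa>"
    by (rule poly_boundedE)
  from C(2) have "\<forall>\<^sub>F M in sequentially. real (length (W (Suc M) [b])) \<le> C * real (Suc M) ^ \<kappa>"
  proof eventually_elim
    case (elim M)
    have "C * real M ^ \<kappa> \<le> C * real (Suc M) ^ \<kappa>" using C(1) by (intro mult_left_mono power_mono) auto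
    then show ?case using elim by linarith
  qed
  then have "\<forall>\<^sub>F M in sequentially. real (length (W M [b])) \<le> C * real M ^ \<kappa>"
    by (rule eventually_sequentially_Suc[THEN iffD1])
  then show False using \<open>\<not> small b\<close> unfolding small_def poly_bounded_def by blast
qed

lemma small_polynomial: "small b \<Longrightarrow> polynomial b"
  unfolding small_def by (rule poly_bounded_polynomial)

lemma nice_word:
  "(\<And>c. c \<in> set u \<Longrightarrow> nice Q (\<lambda>M. W M [c])) \<Longrightarrow> safe Q (\<lambda>M. W M u) \<Longrightarrow> nice Q (\<lambda>M. W M u)"
proof (induction u)
  case Nil
  show ?case using nice_const[of Q "[]"] by simp
next
  case (Cons c u)
  have "safe Q (\<lambda>M. W M u)"
  proof (rule safe_sublist[OF Cons.prems(2)])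
    show "\<forall>\<^sub>F M in sequentially. sublist (W M u) (W M (c # u))"
      by (simp add: img_Cons[of f g _ c u])
  qed
  then show ?case using Cons.IH Cons.prems unfolding img_Cons[of f g _ c u]
    by (intro nice_append) auto
qed

text \<open>The five neighbours required by \<open>nice_iconcat\<close> form the image under
  \<open>W M\<close> of a factor of \<open>(ext f ^^ 5) [d]\<close>. Thus they lie inside
  \<open>W (M + 5) [d]\<close>, and \<open>no_gap\<close> controls their gaps.\<close>

lemma nice_iconcat_letter:
  assumes d: "f d = z @ [d] @ t" and small: "\<forall>c\<in>set t. small c"
    and nice: "\<And>c. c \<in> set t \<Longrightarrow> nice Q (\<lambda>M. W M [c])"
  shows "evconst (\<lambda>M. breaks Q (iconcat (\<lambda>i. W i t) M))" and "nice Q (iconcat (\<lambda>i. W i t))"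
proof -
  let ?w = "\<lambda>i. W i t"
  let ?five = "\<lambda>M. ?w M @ ?w (Suc M) @ ?w (Suc (Suc M)) @ ?w (Suc (Suc (Suc M)))
        @ ?w (Suc (Suc (Suc (Suc M))))"
  have "?five M = W M (iconcat (\<lambda>i. (ext f ^^ i) t) 5)" for M
    by (simp add: eval_nat_numeral img_Suc)
  moreover have "sublist (iconcat (\<lambda>i. (ext f ^^ i) t) 5) ((ext f ^^ 5) [d])"
    unfolding ext_funpow_fixed_letter[of f, OF d] append.assoc[symmetric]
    by (rule sublist_append_leftI)
  ultimately have sub: "sublist (?five M) (W (M + 5) [d])" for M
    unfolding img_add using img_sublist[of _ _ f g M] by simp
  have b: "poly_bounded \<kappa> (\<lambda>M. length (?w M))" using small by (rule small_word)
  have "poly_bounded \<kappa> (\<lambda>M. length (?five M))"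
    unfolding length_append
    using poly_bounded_shift[OF b, of 1] poly_bounded_shift[OF b, of 2]
      poly_bounded_shift[OF b, of 3] poly_bounded_shift[OF b, of 4] b
    by (intro poly_bounded_add) (simp_all add: eval_nat_numeral)
  then have safe5: "safe Q ?five" using sub by (intro safeI[of _ 5 d]) auto
  have safe': "safe Q v" if "\<And>M. sublist (v M) (?five M)" for v
    using safe_sublist[OF safe5] that by simp
  have w: "nice Q ?w" by (rule nice_word[OF nice safe']) simp_all
  have ws: "nice Q (\<lambda>M. ?w (Suc M))" "nice Q (\<lambda>M. ?w (Suc (Suc M)))"
    "nice Q (\<lambda>M. ?w (Suc (Suc (Suc M))))" "nice Q (\<lambda>M. ?w (Suc (Suc (Suc (Suc M)))))"
    using nice_shift_add[OF w, of 1] nice_shift_add[OF w, of 2]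
      nice_shift_add[OF w, of 3] nice_shift_add[OF w, of 4] by (simp_all add: eval_nat_numeral)
  have "nice Q (\<lambda>M. ?w (Suc (Suc (Suc M))) @ ?w (Suc (Suc (Suc (Suc M)))))"
    by (rule nice_append[OF ws(3,4)], rule safe') (simp add: sublist_append_before)
  then have "nice Q (\<lambda>M. ?w (Suc (Suc M)) @ ?w (Suc (Suc (Suc M))) @ ?w (Suc (Suc (Suc (Suc M)))))"
    by (rule nice_append[OF ws(2)], intro safe') (simp add: sublist_append_before)
  then have "nice Q (\<lambda>M. ?w (Suc M) @ ?w (Suc (Suc M)) @ ?w (Suc (Suc (Suc M)))
      @ ?w (Suc (Suc (Suc (Suc M)))))"
    by (rule nice_append[OF ws(1)], intro safe') (simp add: sublist_append_before)
  then have five: "nice Q ?five"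
    by (rule nice_append[OF w]) (rule safe5)
  have pair: "nice Q (\<lambda>M. ?w M @ ?w (Suc M))"
  proof (rule nice_append[OF w ws(1)], rule safe')
    fix M
    show "sublist (?w M @ ?w (Suc M)) (?five M)"
      using sublist_append_rightI[of "?w M @ ?w (Suc M)" "?w (Suc (Suc M)) @ ?w (Suc (Suc (Suc M)))
        @ ?w (Suc (Suc (Suc (Suc M))))"] by simp
  qed
  have per: "length x dvd Q" if "\<forall>\<^sub>F M in sequentially. ?w M = x" "x \<noteq> []" for x
    using period[OF _ that, of d] d sublist_append_before[of t t "z @ [d]"] by simp
  show "evconst (\<lambda>M. breaks Q (iconcat ?w M))" "nice Q (iconcat ?w)"
    using nice_iconcat[OF w per nice_clustered[OF pair] nice_clustered[OF five]] by blast+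
qed

text \<open>This concatenation grows at its left end, so its breaks become constant only when
  counted from the right; hence \<open>rev\<close> in the first claim.\<close>

lemma nice_rconcat_letter:
  assumes d: "f d = z @ [d] @ t" and small: "\<forall>c\<in>set z. small c"
    and nice: "\<And>c. c \<in> set z \<Longrightarrow> nice Q (\<lambda>M. W M [c])"
  shows "evconst (\<lambda>M. breaks Q (rev (rconcat (\<lambda>i. W i z) M)))" and "nice Q (rconcat (\<lambda>i. W i z))"
proof -
  interpret R: scaled_morphism "\<lambda>b. rev (f b)" "\<lambda>b. rev (g b)" Q \<kappa> \<tau> by (rule scaled_morphism_rev)
  have V: "R.W M u = rev (W M (rev u))" for M u by (simp add: rev_img)
  have d': "rev (f d) = rev t @ [d] @ rev z" by (simp add: d)
  have s': "\<forall>c\<in>set (rev z). R.small c" using small by (simp add: small_def R.small_def V)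
  have n': "nice Q (\<lambda>M. R.W M [c])" if "c \<in> set (rev z)" for c
    using nice_rev[OF nice[of c]] that by (simp add: V)
  have e: "iconcat (\<lambda>i. R.W i (rev z)) M = rev (rconcat (\<lambda>i. W i z) M)" for M
    by (simp add: V rev_rconcat)
  show "evconst (\<lambda>M. breaks Q (rev (rconcat (\<lambda>i. W i z) M)))"
    using R.nice_iconcat_letter(1)[OF d' s' n'] by (simp add: e)
  have "nice Q (\<lambda>M. rev (rconcat (\<lambda>i. W i z) M))"
    using R.nice_iconcat_letter(2)[OF d' s' n'] by (simp add: e[abs_def])
  from nice_rev[OF this] show "nice Q (rconcat (\<lambda>i. W i z))" by simp
qed

text \<open>The induction follows \<open>polynomial_tame\<close>. Each concatenation that arises is
  a factor of an image of \<open>b\<close> and therefore safe.\<close>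

lemma small_nice:
  assumes "small b"
  shows "nice Q (\<lambda>M. W M [b])"
  using small_polynomial[OF assms] assms
proof (induction rule: polynomial_induct)
  case (step b)
  show ?case
  proof (cases "b \<in> set (f b)")
    case True
    then obtain z t where zt: "f b = z @ [b] @ t" "b \<notin> set z" "b \<notin> set t"
      using polynomial_cyclicE step.hyps by blast
    have zs: "\<forall>c\<in>set z. small c" and ts: "\<forall>c\<in>set t. small c"
      using small_descend[OF step.prems] zt by auto
    have nz: "nice Q (\<lambda>M. W M [c])" if "c \<in> set z" for c
      using step.IH[of c] zt zs that by auto
    have nt: "nice Q (\<lambda>M. W M [c])" if "c \<in> set t" for c
      using step.IH[of c] zt ts that by auto
    have H: "nice Q (rconcat (\<lambda>i. W i z))" using nice_rconcat_letter(2)[OF zt(1) zs nz] .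
    have T: "nice Q (iconcat (\<lambda>i. W i t))" using nice_iconcat_letter(2)[OF zt(1) ts nt] .
    have safe: "safe Q (\<lambda>M. W M [b])"
      using step.prems unfolding small_def by (intro safeI[of _ 0 b]) simp_all
    have "nice Q (\<lambda>M. g b @ iconcat (\<lambda>i. W i t) M)"
    proof (rule nice_append[OF nice_const T], rule safe_sublist[OF safe])
      show "\<forall>\<^sub>F M in sequentially. sublist (g b @ iconcat (\<lambda>i. W i t) M) (W M [b])"
        unfolding img_fixed_letter[of f, OF zt(1)] by simp
    qed
    then have "nice Q (\<lambda>M. rconcat (\<lambda>i. W i z) M @ g b @ iconcat (\<lambda>i. W i t) M)"
      by (rule nice_append[OF H]) (use safe in \<open>simp only: img_fixed_letter[of f, OF zt(1)]\<close>)
    then show ?thesis by (simp only: img_fixed_letter[of f, OF zt(1)])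
  next
    case False
    have "safe Q (\<lambda>M. W M (f b))"
    proof (rule safeI)
      show "poly_bounded \<kappa> (\<lambda>M. length (W M (f b)))"
        using small_descend[OF step.prems] by - (rule small_word, blast)
      show "\<forall>\<^sub>F M in sequentially. sublist (W M (f b)) (W (M + 1) [b])"
        by (simp add: img_Suc_single)
    qed
    moreover have "nice Q (\<lambda>M. W M [c])" if "c \<in> set (f b)" for c
      using step.IH[OF that] False that small_descend[OF step.prems that] by metis
    ultimately have "nice Q (\<lambda>M. W M (f b))" by - (rule nice_word)
    then show ?thesis using nice_shift[of Q "\<lambda>M. W M [b]"] by (simp add: img_Suc_single)
  qed
qed

lemma small_word_nice:
  assumes "\<forall>c\<in>set u. small c" "\<forall>\<^sub>F M in sequentially. sublist (W M u) (W (M + j) [x])"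
  shows "nice Q (\<lambda>M. W M u)"
  by (rule nice_word, use assms(1) small_nice in blast)
     (rule safeI[OF small_word[OF assms(1)] assms(2)])

end

section \<open>Ends of images\<close>

text \<open>The \<open>r i\<close> are prefixes of one finite or infinite word, and each is
  determined by its length, so a window can be counted by the length of its part in
  \<open>r\<close>. The index need not be the length: the chain may be constantly empty.\<close>

definition right_chain :: "(nat \<Rightarrow> 'a list) \<Rightarrow> bool" where
  "right_chain r \<longleftrightarrow> (\<forall>J x. Sublist.prefix x (r J) \<longrightarrow> x = r (length x))"

definition left_chain :: "(nat \<Rightarrow> 'a list) \<Rightarrow> bool" where
  "left_chain l \<longleftrightarrow> (\<forall>J x. suffix x (l J) \<longrightarrow> x = l (length x))"

lemma left_chain_rev: "left_chain (\<lambda>i. rev (r i)) \<longleftrightarrow> right_chain r"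
proof -
  have "suffix x (rev y) \<longleftrightarrow> Sublist.prefix (rev x) y" for x y :: "'a list"
    by (metis rev_rev_ident suffix_to_prefix)
  then show ?thesis unfolding left_chain_def right_chain_def by (metis length_rev rev_rev_ident)
qed

lemma right_chain_rev: "right_chain (\<lambda>i. rev (l i)) \<longleftrightarrow> left_chain l"
  using left_chain_rev[of "\<lambda>i. rev (l i)"] by simp

lemma nth_of_no_breaks:
  assumes "breaks Q h = {}" "0 < Q" "i < length h"
  shows "h ! i = take Q h ! (i mod Q)"
  using assms(3)
proof (induction i rule: less_induct)
  case (less i)
  show ?case
  proof (cases "i < Q")
    case True
    then show ?thesis using less.prems by simp
  next
    case False
    then have "i - Q \<notin> breaks Q h" "i - Q + Q = i" using assms(1) by auto
    then have "h ! i = h ! (i - Q)" using less.prems by (simp add: breaks_def)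
    also have "\<dots> = take Q h ! ((i - Q) mod Q)" using less False assms(2) by simp
    finally show ?thesis using False by (simp add: le_mod_geq)
  qed
qed

lemma prefix_append_cases:
  assumes "Sublist.prefix w (u @ v)"
  obtains "Sublist.prefix w u" | y where "w = u @ y" "Sublist.prefix y v"
  using assms by (auto simp: prefix_append)

lemma prefix_take_eq: "Sublist.prefix y v \<Longrightarrow> y = take (length y) v"
  by (auto simp: prefix_def)

context scaled_morphism
begin

lemma large_at_top:
  assumes "large \<tau> s"
  shows "\<forall>\<^sub>F M in sequentially. K \<le> s M"
proof -
  obtain c where c: "c > 0" "\<forall>\<^sub>F M in sequentially. c * \<tau> M \<le> real (s M)"
    using assms unfolding large_def by blast
  show ?thesis
    using c(2) dominates[of "real K / c"] eventually_ge_at_top[of 1]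
  proof eventually_elim
    case (elim M)
    have "1 \<le> real M ^ \<kappa>" using elim(3) by (intro one_le_power) simp
    then have "real K / c * 1 \<le> real K / c * real M ^ \<kappa>"
      using c(1) by (intro mult_left_mono) auto
    then have "real K / c \<le> \<tau> M" using elim(2) by linarith
    then have "real K \<le> c * \<tau> M" using c(1) by (simp add: field_simps)
    then show ?case using elim(1) by linarith
  qed
qed

lemma large_minus_poly_bounded:
  assumes "large \<tau> s" "poly_bounded \<kappa> r"
  shows "\<exists>c>0. \<forall>\<^sub>F M in sequentially. c * \<tau> M \<le> real (s M) - real (r M)"
proof -
  obtain c where c: "c > 0" "\<forall>\<^sub>F M in sequentially. c * \<tau> M \<le> real (s M)"
    using assms(1) unfolding large_def by blast
  obtain C where C: "\<forall>\<^sub>F M in sequentially. real (r M) \<le> C * real M ^ \<kappa>"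
    using assms(2) unfolding poly_bounded_def by blast
  have "\<forall>\<^sub>F M in sequentially. (c / 2) * \<tau> M \<le> real (s M) - real (r M)"
    using c(2) C dominates[of "2 * C / c"]
  proof eventually_elim
    case (elim M)
    have "C * real M ^ \<kappa> = (c / 2) * (2 * C / c * real M ^ \<kappa>)" using c(1) by simp
    also have "\<dots> \<le> (c / 2) * \<tau> M" using c(1) elim(3) by (intro mult_left_mono) auto
    finally have "real (r M) \<le> (c / 2) * \<tau> M" using elim(2) by linarith
    then show ?case using elim(1) by simp
  qed
  then show ?thesis using c(1) by (intro exI[of _ "c / 2"]) simp
qed

text \<open>Up to length \<open>c \<tau> M\<close>, the image \<open>W M V\<close> looks like the nice word \<open>S M\<close> followed by an infinite
  word independent of \<open>M\<close>, given by its prefixes \<open>r i\<close>. If \<open>V\<close> consists of small letters only, all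
  \<open>r i\<close> are empty.\<close>

definition right_end :: "'a list \<Rightarrow> (nat \<Rightarrow> 'a list) \<Rightarrow> (nat \<Rightarrow> 'a list) \<Rightarrow> bool" where
  "right_end V r S \<longleftrightarrow> right_chain r \<and> nice Q S \<and> poly_bounded \<kappa> (\<lambda>M. length (S M)) \<and>
     (\<forall>J. \<forall>\<^sub>F M in sequentially. Sublist.prefix (S M @ r J) (W M V)) \<and>
     (\<exists>c>0. \<forall>\<^sub>F M in sequentially. \<forall>w. Sublist.prefix w (W M V) \<and> real (length w) \<le> c * \<tau> M \<longrightarrow>
        Sublist.prefix w (S M) \<or> (\<exists>i. w = S M @ r i))"

text \<open>For a large \<open>H\<close> that grows at its left end. Its breaks keep a bounded
  distance from the right end, so apart from a bounded final part \<open>H M\<close> continues its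
  fixed first \<open>Q\<close> letters with period \<open>Q\<close>; this continuation is the limit
  word.\<close>

lemma right_end_periodic:
  assumes nH: "nice Q H" and bH: "evconst (\<lambda>M. breaks Q (rev (H M)))"
    and lH: "large \<tau> (\<lambda>M. length (H M))"
    and ns: "nice Q s" and bs: "poly_bounded \<kappa> (\<lambda>M. length (s M))"
    and W: "\<And>M. W M V = s M @ H M @ E M"
  shows "\<exists>r. right_end V r s"
proof -
  obtain P where P: "\<forall>\<^sub>F M in sequentially. take Q (H M) = P"
    using nH unfolding nice_def evconst_def by blast
  obtain D where D: "\<forall>\<^sub>F M in sequentially. breaks Q (rev (H M)) = D"
    using bH unfolding evconst_def by blast
  have "finite D"
  proof -
    obtain M where "breaks Q (rev (H M)) = D" using D unfolding eventually_sequentially by auto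
    then show ?thesis using finite_breaks[of Q "rev (H M)"] by simp
  qed
  then obtain B where B: "\<And>d. d \<in> D \<Longrightarrow> d < B"
    by (metis finite_nat_set_iff_bounded)
  \<comment> \<open>All breaks of \<open>rev (H M)\<close> are below \<open>B\<close>, so removing
    the last \<open>B\<close> letters removes them all.\<close>
  define H' where "H' = (\<lambda>M. take (length (H M) - B) (H M))"
  define r where "r = (\<lambda>J. map (\<lambda>i. P ! (i mod Q)) [0..<J])"
  have "right_chain r"
    unfolding right_chain_def
  proof (intro allI impI)
    fix J x assume "Sublist.prefix x (r J)"
    then have "x = take (length x) (r J)" "length x \<le> J"
      using prefix_take_eq prefix_length_le by (blast, fastforce simp: r_def)
    then show "x = r (length x)" by (simp add: r_def take_map)
  qed
  have H': "\<forall>\<^sub>F M in sequentially. H' M = r (length (H' M))"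
    using P D large_at_top[OF lH, of "B + Q"]
  proof eventually_elim
    case (elim M)
    have len: "length (H' M) = length (H M) - B" by (simp add: H'_def)
    have split: "H M = [] @ H' M @ drop (length (H M) - B) (H M)" by (simp add: H'_def)
    have "breaks Q (H' M) = {}"
    proof (rule ccontr)
      assume "breaks Q (H' M) \<noteq> {}"
      then obtain p where p: "p \<in> breaks Q (H' M)" by blast
      then have pH: "p \<in> breaks Q (H M)" and pl: "p + Q < length (H M) - B"
        using mem_breaks_middle[of p Q "H' M" "[]" "drop (length (H M) - B) (H M)"] split len by auto
      have "int (length (H M)) - 1 - int Q - int p \<in> int ` breaks Q (rev (H M))"
        unfolding int_image_breaks_rev using pH by blast
      then obtain e where "e \<in> D" "int e = int (length (H M)) - 1 - int Q - int p"
        using elim(2) by auto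
      then show False using B[of e] pl by linarith
    qed
    then have nth: "H' M ! i = take Q (H' M) ! (i mod Q)" if "i < length (H' M)" for i
      using nth_of_no_breaks Q_pos that by blast
    have "Q \<le> length (H M) - B" using elim(3) by simp
    then have "take Q (H' M) = P" using elim(1) by (simp add: H'_def min_def)
    then show ?case using nth by (intro nth_equalityI) (simp_all add: r_def)
  qed
  have c1: "\<forall>\<^sub>F M in sequentially. Sublist.prefix (s M @ r J) (W M V)" for J
    using H' large_at_top[OF lH, of "B + J"]
  proof eventually_elim
    case (elim M)
    have "J \<le> length (H' M)" using elim(2) by (simp add: H'_def)
    then have "r J = take J (H' M)" by (subst elim(1)) (simp add: r_def take_map)
    then have "Sublist.prefix (r J) (H M)" using take_is_prefix prefix_order.trans
      unfolding H'_def by metis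
    then show ?case unfolding W by (simp add: prefix_prefix)
  qed
  obtain c where c: "c > 0" "\<forall>\<^sub>F M in sequentially. c * \<tau> M \<le> real (length (H M)) - real B"
    using large_minus_poly_bounded[OF lH poly_bounded_const[of \<kappa> B]] by blast
  have "\<forall>\<^sub>F M in sequentially. \<forall>w. Sublist.prefix w (W M V) \<and> real (length w) \<le> c * \<tau> M \<longrightarrow>
        Sublist.prefix w (s M) \<or> (\<exists>i. w = s M @ r i)"
    using H' c(2)
  proof eventually_elim
    case (elim M)
    show ?case
    proof (intro allI impI, elim conjE)
      fix w assume w: "Sublist.prefix w (W M V)" "real (length w) \<le> c * \<tau> M"
      have "real (length w) \<le> real (length (H' M))" using elim(2) w(2) unfolding H'_def by simp
      then have lw: "length w \<le> length (H' M)" by simp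
      from w(1) have "Sublist.prefix w (s M @ H M @ E M)" unfolding W .
      then show "Sublist.prefix w (s M) \<or> (\<exists>i. w = s M @ r i)"
      proof (cases rule: prefix_append_cases)
        case (2 y)
        have ly: "length y \<le> length (H' M)" using lw 2(1) by simp
        then have ly2: "length y \<le> length (H M) - B" by (simp add: H'_def)
        then have "y = take (length y) (H M)" using prefix_take_eq[OF 2(2)] by simp
        then have "y = take (length y) (H' M)" using ly2 by (simp add: H'_def min_def)
        also have "\<dots> = r (length y)" using ly by (subst elim(1)) (simp add: r_def take_map)
        finally show ?thesis using 2(1) by blast
      qed blast
    qed
  qed
  then have "right_end V r s"
    unfolding right_end_def using \<open>right_chain r\<close> ns bs c1 c(1) by blast
  then show ?thesis by blast
qed

text \<open>Here the words \<open>G @ iconcat w M\<close> grow at their right end and are prefixes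
  of one another, so they converge. As all \<open>w i\<close> are nonempty, the limit is
  infinite.\<close>

lemma right_end_limit:
  assumes nS: "nice Q S" and bS: "poly_bounded \<kappa> (\<lambda>M. length (S M))"
    and lh: "\<exists>c>0. \<forall>\<^sub>F M in sequentially. c * \<tau> M \<le> real (length (G @ iconcat w M))"
    and w: "\<And>i. w i \<noteq> []"
    and W: "\<And>M. W M V = S M @ (G @ iconcat w M) @ E M"
  shows "\<exists>r. right_end V r S"
proof -
  define h where "h = (\<lambda>M. G @ iconcat w M)"
  define r where "r = (\<lambda>J. take J (h J))"
  have lh': "J \<le> length (h J)" for J
  proof -
    have "J \<le> length (iconcat w J)"
    proof (induction J)
      case (Suc J)
      have "0 < length (w J)" using w by simp
      with Suc show ?case unfolding iconcat.simps length_append by linarith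
    qed simp
    then show ?thesis by (simp add: h_def)
  qed
  have mono: "take J (h M) = take J (h N)" if "M \<le> N" "J \<le> length (h M)" for J M N
  proof -
    obtain y where "iconcat w N = iconcat w M @ y" using iconcat_prefix[OF \<open>M \<le> N\<close>] by blast
    then have "h N = h M @ y" by (simp add: h_def)
    then show ?thesis using that(2) by simp
  qed
  have r: "take J (h M) = r J" if "J \<le> length (h M)" for J M
    using mono[of J M J] mono[of M J J] lh'[of J] that mono[of J M] unfolding r_def
    by (cases "M \<le> J") (metis mono nat_le_linear)+
  have "right_chain r"
    unfolding right_chain_def
  proof (intro allI impI)
    fix J x assume x: "Sublist.prefix x (r J)"
    then have "length x \<le> length (r J)" by (rule prefix_length_le)
    then have lx: "length x \<le> J" "length x \<le> length (h J)" using lh'[of J] by (auto simp: r_def)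
    have "x = take (length x) (r J)" using x by (rule prefix_take_eq)
    also have "\<dots> = take (length x) (h J)" using lx by (simp add: r_def min_def)
    finally show "x = r (length x)" using r[OF lx(2)] by simp
  qed
  have c1: "\<forall>\<^sub>F M in sequentially. Sublist.prefix (S M @ r J) (W M V)" for J
    using eventually_ge_at_top[of J]
  proof eventually_elim
    case (elim M)
    have "r J = take J (h M)" using r[of J M] lh'[of M] elim by simp
    then have "Sublist.prefix (r J) (h M)" by (simp add: take_is_prefix)
    then have "Sublist.prefix (r J) (h M @ E M)" by (rule prefix_prefix)
    then show ?case unfolding W h_def by simp
  qed
  obtain c where c: "c > 0" "\<forall>\<^sub>F M in sequentially. c * \<tau> M \<le> real (length (h M))"
    using lh unfolding h_def by blast
  have "\<forall>\<^sub>F M in sequentially. \<forall>w. Sublist.prefix w (W M V) \<and> real (length w) \<le> c * \<tau> M \<longrightarrow>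
        Sublist.prefix w (S M) \<or> (\<exists>i. w = S M @ r i)"
    using c(2)
  proof eventually_elim
    case (elim M)
    show ?case
    proof (intro allI impI, elim conjE)
      fix w assume w: "Sublist.prefix w (W M V)" "real (length w) \<le> c * \<tau> M"
      have lw: "length w \<le> length (h M)" using elim w(2) by linarith
      from w(1) have "Sublist.prefix w (S M @ h M @ E M)" unfolding W h_def .
      then show "Sublist.prefix w (S M) \<or> (\<exists>i. w = S M @ r i)"
      proof (cases rule: prefix_append_cases)
        case (2 y)
        have ly: "length y \<le> length (h M)" using lw 2(1) by simp
        have "y = take (length y) (h M)" using prefix_take_eq[OF 2(2)] ly by simp
        also have "\<dots> = r (length y)" using ly by (rule r)
        finally show ?thesis using 2(1) by blast
      qed blast
    qed
  qed
  then have "right_end V r S"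
    unfolding right_end_def using \<open>right_chain r\<close> nS bS c1 c(1) by blast
  then show ?thesis by blast
qed

text \<open>The passage from \<open>v\<close> to \<open>ext f v\<close> matters: the first letter of
  \<open>ext f v\<close> that is not small is also the first such letter of some \<open>f y\<close>,
  and this is what \<open>leftmost_fixed\<close> needs.\<close>

lemma first_not_small:
  assumes "\<not> (\<forall>c\<in>set (ext f v). small c)"
  obtains s d V' z t where "ext f v = s @ [d] @ V'" "\<forall>c\<in>set s. small c" "\<not> small d"
    "f d = z @ [d] @ t" "\<forall>c\<in>set z. small c"
proof -
  have "\<exists>y\<in>set v. \<not> small y" using assms small_descend by fastforce
  then obtain v1 y v2 where v: "v = v1 @ y # v2" "\<not> small y" "\<forall>x\<in>set v1. \<not> \<not> small x"
    by (rule split_list_first_propE)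
  obtain s1 d r1 where fy: "f y = s1 @ d # r1" "\<not> small d" "\<forall>x\<in>set s1. \<not> \<not> small x"
    using split_list_first_propE[OF not_small_descend[OF v(2)]] by blast
  obtain z t where zt: "f d = z @ [d] @ t" "set z \<subseteq> Collect small"
  proof (rule leftmost_fixed[of "Collect small" y s1 d r1])
    show "\<And>b. b \<in> Collect small \<Longrightarrow> set (f b) \<subseteq> Collect small" using small_descend by blast
    show "\<not> set (f d) \<subseteq> Collect small" using not_small_descend[OF fy(2)] by blast
  qed (use fy in auto)
  show ?thesis
  proof (rule that[of "ext f v1 @ s1" d "r1 @ ext f v2" z t])
    show "\<forall>c\<in>set (ext f v1 @ s1). small c" using v(3) fy(3) small_descend by auto
  qed (use v fy zt in auto)
qed

text \<open>If all letters are small, the image is its own nice word and the chain is empty.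
  Otherwise let \<open>d\<close> be the first letter that is not small. Its left tail
  \<open>?H\<close> either is large, and the end is periodic, or is small and joins the nice word;
  then \<open>g d\<close> and the right tail form the limit.\<close>

lemma right_end_exists:
  assumes sub: "\<forall>\<^sub>F M in sequentially. sublist (W M (ext f v)) (W (M + j) [x])"
  shows "\<exists>r S. right_end (ext f v) r S"
proof (cases "\<forall>c\<in>set (ext f v). small c")
  case True
  have "right_end (ext f v) (\<lambda>_. []) (\<lambda>M. W M (ext f v))"
    unfolding right_end_def right_chain_def
    using small_word_nice[OF True sub] small_word[OF True] exI[of "\<lambda>c::real. 0 < c" 1] by auto
  then show ?thesis by blast
next
  case False
  then obtain s d V' z t where V: "ext f v = s @ [d] @ V'" "\<forall>c\<in>set s. small c" "\<not> small d"
    and zt: "f d = z @ [d] @ t" "\<forall>c\<in>set z. small c"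
    by (rule first_not_small)
  let ?H = "rconcat (\<lambda>i. W i z)" and ?T = "iconcat (\<lambda>i. W i t)"
  have W: "W M (ext f v) = W M s @ ?H M @ (g d @ ?T M) @ W M V'" for M
    unfolding V(1) img_append img_fixed_letter[of f, OF zt(1)] by simp
  have sub_trans: "\<forall>\<^sub>F M in sequentially. sublist (u M) (W (M + j) [x])"
    if "\<And>M. sublist (u M) (W M (ext f v))" for u
    using sub by eventually_elim (use that in \<open>blast intro: sublist_order.order.trans\<close>)
  have ns: "nice Q (\<lambda>M. W M s)"
  proof (rule small_word_nice[OF V(2) sub_trans])
    show "sublist (W M s) (W M (ext f v))" for M unfolding W by simp
  qed
  have bs: "poly_bounded \<kappa> (\<lambda>M. length (W M s))" using small_word[OF V(2)] .
  have H: "evconst (\<lambda>M. breaks Q (rev (?H M)))" "nice Q ?H"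
    using nice_rconcat_letter[OF zt] zt(2) small_nice by blast+
  have "poly_bounded \<kappa> (\<lambda>M. length (?H M)) \<or> large \<tau> (\<lambda>M. length (?H M))"
    using sum_small_or_large[of z] zt(2) unfolding length_rconcat small_def .
  then show ?thesis
  proof
    assume "large \<tau> (\<lambda>M. length (?H M))"
    then show ?thesis using right_end_periodic[OF H(2,1) _ ns bs W] by blast
  next
    assume bH: "poly_bounded \<kappa> (\<lambda>M. length (?H M))"
    have bS: "poly_bounded \<kappa> (\<lambda>M. length (W M s @ ?H M))"
      using poly_bounded_add[OF bs bH] by simp
    have nS: "nice Q (\<lambda>M. W M s @ ?H M)"
    proof (rule nice_append[OF ns H(2)], rule safeI[OF bS sub_trans])
      show "sublist (W M s @ ?H M) (W M (ext f v))" for M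
        unfolding W using sublist_append_rightI[of "W M s @ ?H M"] by simp
    qed
    have "large \<tau> (\<lambda>M. length (W M [d]))" using small_or_large V(3) unfolding small_def by blast
    from large_minus_poly_bounded[OF this bH]
    obtain c where c: "c > 0" "\<forall>\<^sub>F M in sequentially. c * \<tau> M \<le> real (length (g d @ ?T M))"
      unfolding img_fixed_letter[of f, OF zt(1)] by auto
    \<comment> \<open>Without \<open>t\<close>, only \<open>?H\<close> and \<open>g d\<close> would
      be left, and the image of \<open>d\<close> could not be large.\<close>
    have "t \<noteq> []"
    proof
      assume t: "t = []"
      have T: "?T M = []" for M unfolding t by (induction M) auto
      have "large \<tau> (\<lambda>M. length (g d))" using c unfolding large_def T by auto
      from large_at_top[OF this, of "Suc (length (g d))"] show False by simp
    qed
    have "W i t \<noteq> []" for i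
    proof -
      have "length t \<le> length ((ext f ^^ i) t)" 
      proof (induction i)
        case (Suc i)
        then show ?case using length_ext_ge[of f "(ext f ^^ i) t", OF f_ne] by simp
      qed simp
      then have "length t \<le> length (W i t)" using length_le_length_W[of i t] by linarith
      then show ?thesis using \<open>t \<noteq> []\<close> by auto
    qed
    then have "\<exists>r. right_end (ext f v) r (\<lambda>M. W M s @ ?H M)"
      using c W by (intro right_end_limit[OF nS bS, where G = "g d" and w = "\<lambda>i. W i t" and E = "\<lambda>M. W M V'"]) auto
    then show ?thesis by blast
  qed
qed

lemma left_end_exists:
  assumes sub: "\<forall>\<^sub>F M in sequentially. sublist (W M (ext f u)) (W (M + j) [x])"
  obtains l S c where "left_chain l" "nice Q S" "poly_bounded \<kappa> (\<lambda>M. length (S M))"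
    "\<And>J. \<forall>\<^sub>F M in sequentially. suffix (l J @ S M) (W M (ext f u))" "c > 0"
    "\<forall>\<^sub>F M in sequentially. \<forall>w. suffix w (W M (ext f u)) \<and> real (length w) \<le> c * \<tau> M \<longrightarrow>
        suffix w (S M) \<or> (\<exists>i. w = l i @ S M)"
proof -
  interpret R: scaled_morphism "\<lambda>b. rev (f b)" "\<lambda>b. rev (g b)" Q \<kappa> \<tau> by (rule scaled_morphism_rev)
  let ?f = "\<lambda>b. rev (f b)"
  have V: "R.W M v = rev (W M (rev v))" for M v by (simp add: rev_img)
  have e: "ext ?f (rev u) = rev (ext f u)" by (simp add: rev_ext)
  have "\<forall>\<^sub>F M in sequentially. sublist (R.W M (ext ?f (rev u))) (R.W (M + j) [x])"
    using sub by eventually_elim (simp add: V e)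
  then obtain r S where rS: "R.right_end (ext ?f (rev u)) r S" using R.right_end_exists by blast
  then obtain c where c: "c > 0"
    and ev: "\<forall>\<^sub>F M in sequentially. \<forall>w. Sublist.prefix w (R.W M (ext ?f (rev u))) \<and>
        real (length w) \<le> c * \<tau> M \<longrightarrow> Sublist.prefix w (S M) \<or> (\<exists>i. w = S M @ r i)"
    unfolding R.right_end_def by blast
  show ?thesis
  proof (rule that[of "\<lambda>i. rev (r i)" "\<lambda>M. rev (S M)" c])
    show "left_chain (\<lambda>i. rev (r i))" using rS unfolding R.right_end_def left_chain_rev by blast
    show "nice Q (\<lambda>M. rev (S M))" using rS nice_rev unfolding R.right_end_def by blast
    show "poly_bounded \<kappa> (\<lambda>M. length (rev (S M)))" using rS unfolding R.right_end_def by simp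
    show "\<forall>\<^sub>F M in sequentially. suffix (rev (r J) @ rev (S M)) (W M (ext f u))" for J
    proof -
      have "\<forall>\<^sub>F M in sequentially. Sublist.prefix (S M @ r J) (R.W M (ext ?f (rev u)))"
        using rS unfolding R.right_end_def by blast
      then show ?thesis by eventually_elim (simp add: V e suffix_to_prefix)
    qed
    show "\<forall>\<^sub>F M in sequentially. \<forall>w. suffix w (W M (ext f u)) \<and> real (length w) \<le> c * \<tau> M \<longrightarrow>
        suffix w (rev (S M)) \<or> (\<exists>i. w = rev (r i) @ rev (S M))"
      using ev
    proof eventually_elim
      case (elim M)
      show ?case
      proof (intro allI impI, elim conjE)
        fix w assume w: "suffix w (W M (ext f u))" "real (length w) \<le> c * \<tau> M"
        then have "Sublist.prefix (rev w) (S M) \<or> (\<exists>i. rev w = S M @ r i)"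
          using elim[rule_format, of "rev w"] by (simp add: V e suffix_to_prefix)
        then show "suffix w (rev (S M)) \<or> (\<exists>i. w = rev (r i) @ rev (S M))"
          by (metis rev_append rev_rev_ident suffix_to_prefix)
      qed
    qed
  qed (rule c)
qed

end

section \<open>Counting windows around a nice word\<close>

text \<open>The words of length \<open>n\<close> inside \<open>l i @ S M @ r j\<close>, collected
  over all levels \<open>M \<ge> M0\<close>. The implications make \<open>m\<close> reach the end of
  \<open>S M\<close> at which a nonempty part of a chain is attached.\<close>

definition windows ::
  "(nat \<Rightarrow> 'a list) \<Rightarrow> (nat \<Rightarrow> 'a list) \<Rightarrow> (nat \<Rightarrow> 'a list) \<Rightarrow> nat \<Rightarrow> nat \<Rightarrow> 'a list set" where
  "windows l S r M0 n = {w. length w = n \<and> (\<exists>M\<ge>M0. \<exists>i j m. w = l i @ m @ r j \<and> sublist m (S M) \<and>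
     (l i \<noteq> [] \<longrightarrow> Sublist.prefix m (S M)) \<and> (r j \<noteq> [] \<longrightarrow> suffix m (S M)) \<and>
     (l i \<noteq> [] \<and> r j \<noteq> [] \<longrightarrow> m = S M))}"

lemma windows_rev:
  assumes "w \<in> windows l S r M0 n"
  shows "rev w \<in> windows (\<lambda>i. rev (r i)) (\<lambda>M. rev (S M)) (\<lambda>i. rev (l i)) M0 n"
proof -
  obtain M i j m where M: "length w = n" "M0 \<le> M" "w = l i @ m @ r j" "sublist m (S M)"
    "l i \<noteq> [] \<longrightarrow> Sublist.prefix m (S M)" "r j \<noteq> [] \<longrightarrow> suffix m (S M)"
    "l i \<noteq> [] \<and> r j \<noteq> [] \<longrightarrow> m = S M"
    using assms unfolding windows_def by blast
  show ?thesis unfolding windows_def mem_Collect_eq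
    by (intro conjI exI[of _ M] exI[of _ j] exI[of _ i] exI[of _ "rev m"])
       (use M in \<open>auto simp: suffix_to_prefix\<close>)
qed

lemma finite_lists_le: "finite {xs::'a::finite list. length xs \<le> n}"
  using finite_lists_length_le[of "UNIV :: 'a set" n] by simp

lemma finite_lists_eq: "finite {xs::'a::finite list. length xs = n \<and> P xs}"
  by (rule finite_subset[OF _ finite_lists_le[of n]]) auto

lemma finite_windows: "finite (windows l S r M0 n :: 'a::finite list set)"
  unfolding windows_def by (rule finite_lists_eq)

definition num_lists_le :: "'a::finite itself \<Rightarrow> nat \<Rightarrow> nat" where
  "num_lists_le _ n = card {xs::'a list. length xs \<le> n}"

text \<open>Outside the interval every letter repeats the one \<open>Q\<close> places earlier. The
  word is thus determined by its first \<open>Q\<close> letters and by the at most \<open>B\<close>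
  letters in which a break may end, whatever \<open>n\<close> and \<open>q\<close> are.\<close>

lemma card_breaks_within:
  assumes "0 < Q"
  shows "card {w::'a::finite list. length w = n \<and> breaks Q w \<subseteq> {q..<q + B}}
     \<le> num_lists_le TYPE('a) Q * num_lists_le TYPE('a) B"
proof -
  let ?A = "{w::'a list. length w = n \<and> breaks Q w \<subseteq> {q..<q + B}}"
  let ?F = "\<lambda>w::'a list. (take Q w, take B (drop (q + Q) w))"
  have "inj_on ?F ?A"
  proof (rule inj_onI)
    fix w w' :: "'a list"
    assume w: "w \<in> ?A" "w' \<in> ?A" and eq: "?F w = ?F w'"
    have nth: "w ! i = w' ! i" if "i < n" for i
      using that
    proof (induction i rule: less_induct)
      case (less i)
      show ?case
      proof (cases "i < Q")
        case True
        then show ?thesis using eq w less.prems by (metis (no_types, lifting) nth_take prod.inject)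
      next
        case False
        show ?thesis
        proof (cases "i - Q \<in> {q..<q + B}")
          case True
          define e where "e = i - Q - q"
          have e: "e < B" "i = q + Q + e" using True False by (auto simp: e_def)
          have "take B (drop (q + Q) w) ! e = take B (drop (q + Q) w') ! e" using eq by simp
          then show ?thesis using e w less.prems by simp
        next
          case no: False
          have "i - Q \<notin> breaks Q w" "i - Q \<notin> breaks Q w'" using w no by auto
          moreover have "i - Q + Q = i" using False by simp
          ultimately have "w ! (i - Q) = w ! i" "w' ! (i - Q) = w' ! i"
            using w less.prems by (auto simp: breaks_def)
          moreover have "w ! (i - Q) = w' ! (i - Q)" using less False assms by simp
          ultimately show ?thesis by simp
        qed
      qed
    qed
    show "w = w'" using w nth by (intro nth_equalityI) auto
  qed
  moreover have "?F ` ?A \<subseteq> {xs. length xs \<le> Q} \<times> {xs. length xs \<le> B}" by auto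
  ultimately have "card ?A \<le> card ({xs::'a list. length xs \<le> Q} \<times> {xs::'a list. length xs \<le> B})"
    by (intro card_inj_on_le finite_cartesian_product finite_lists_le)
  then show ?thesis by (simp add: num_lists_le_def card_cartesian_product)
qed

lemma card_UN_le_mult:
  assumes "finite I" "\<And>i. i \<in> I \<Longrightarrow> card (A i) \<le> K"
  shows "card (\<Union>i\<in>I. A i) \<le> K * card I"
proof -
  have "card (\<Union>i\<in>I. A i) \<le> (\<Sum>i\<in>I. card (A i))" using assms(1) by (rule card_UN_le)
  also have "\<dots> \<le> (\<Sum>i\<in>I. K)" using assms(2) by (rule sum_mono)
  finally show ?thesis by (simp add: mult.commute)
qed

lemma left_chain_0: "left_chain l \<Longrightarrow> l 0 = []"
  unfolding left_chain_def by (metis list.size(3) Nil_suffix)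

lemma right_chain_0: "right_chain r \<Longrightarrow> r 0 = []"
  unfolding right_chain_def by (metis list.size(3) Nil_prefix)

lemma left_chain_length: "left_chain l \<Longrightarrow> l (length (l i)) = l i"
  unfolding left_chain_def by (metis suffix_order.eq_refl)

lemma right_chain_length: "right_chain r \<Longrightarrow> r (length (r i)) = r i"
  unfolding right_chain_def by (metis prefix_order.eq_refl)

text \<open>A break of \<open>l J @ P\<close> has a fixed position, and since there is only one
  cluster, all other breaks stay near it. So \<open>S M @ r j\<close> has no breaks from a fixed
  \<open>B\<close> on; a window is determined by the length of its part in \<open>l\<close> up to
  boundedly many choices.\<close>

lemma few_windows_left_break:
  fixes S :: "nat \<Rightarrow> 'a::finite list"
  assumes Q: "0 < Q" and l: "left_chain l" and r: "right_chain r" and S: "nice Q S"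
    and unb: "\<And>K. \<forall>\<^sub>F M in sequentially. K \<le> length (S M)"
    and cl: "\<And>J J'. clustered (\<lambda>M. breaks Q (l J @ S M @ r J'))"
    and P: "\<forall>\<^sub>F M in sequentially. take Q (S M) = P" and brk: "breaks Q (l J @ P) \<noteq> {}"
  shows "\<exists>K M0. \<forall>n. card (windows l S r M0 n) \<le> K * (n + 1)"
proof -
  obtain q0 where q0: "q0 \<in> breaks Q (l J @ P)" using brk by blast
  have bnd: "\<exists>E. \<forall>\<^sub>F M in sequentially. breaks Q (l J @ S M @ r J') \<subseteq> {..<E}" for J'
  proof -
    obtain p D where D: "finite D"
      "\<forall>\<^sub>F M in sequentially. int ` breaks Q (l J @ S M @ r J') = (+) (p M) ` D"
      using cl[of J J'] unfolding clustered_def by blast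
    have "\<forall>\<^sub>F M in sequentially. breaks Q (l J @ S M @ r J') \<subseteq> {..<q0 + nat (Max D - Min D) + 1}"
      using D(2) P
    proof eventually_elim
      case (elim M)
      have "S M = P @ drop Q (S M)" using elim(2) by (metis append_take_drop_id)
      then have "l J @ S M @ r J' = [] @ (l J @ P) @ drop Q (S M) @ r J'"
        by (metis append.assoc append_Nil)
      moreover have "length ([] :: 'a list) + q0 \<in> breaks Q ([] @ (l J @ P) @ drop Q (S M) @ r J')"
        using q0 mem_breaks_middle by blast
      ultimately have "q0 \<in> breaks Q (l J @ S M @ r J')" by (metis add_0 list.size(3))
      then have "int q0 \<in> (+) (p M) ` D" using elim(1) by blast
      then obtain d where d: "d \<in> D" "int q0 = p M + d" by blast
      show ?case
      proof
        fix x assume "x \<in> breaks Q (l J @ S M @ r J')"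
        then have "int x \<in> (+) (p M) ` D" using elim(1) by blast
        then obtain e where e: "e \<in> D" "int x = p M + e" by blast
        have "e - d \<le> Max D - Min D" using Max_ge[OF D(1) e(1)] Min_le[OF D(1) d(1)] by linarith
        then show "x \<in> {..<q0 + nat (Max D - Min D) + 1}" using d e by auto
      qed
    qed
    then show ?thesis by blast
  qed
  obtain B where B: "\<forall>\<^sub>F M in sequentially. breaks Q (l J @ S M @ r 0) \<subseteq> {..<B}" using bnd by blast
  obtain R where R: "\<forall>\<^sub>F M in sequentially. lastn Q (S M) = R"
    using S unfolding nice_def evconst_def by blast
  \<comment> \<open>A break at the right end would be separated from the one at the left by nearly
    all of \<open>S M\<close>, whose length is unbounded.\<close>
  have noR: "breaks Q (R @ r J') = {}" for J'
  proof (rule ccontr)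
    assume "breaks Q (R @ r J') \<noteq> {}"
    then obtain e where e: "e \<in> breaks Q (R @ r J')" by blast
    obtain E where E: "\<forall>\<^sub>F M in sequentially. breaks Q (l J @ S M @ r J') \<subseteq> {..<E}" using bnd by blast
    from E R unb[of "E + Q"] have "\<forall>\<^sub>F M::nat in sequentially. False"
    proof eventually_elim
      case (elim M)
      have "length (S M) - Q + e \<in> breaks Q (S M @ r J')"
        using e elim(2) breaks_append_left[of Q "S M" "r J'"] by blast
      then have "length (l J) + (length (S M) - Q + e) \<in> breaks Q (l J @ (S M @ r J') @ [])"
        using mem_breaks_middle by blast
      then have "length (l J) + (length (S M) - Q + e) < E" using elim(1) by auto
      then show False using elim(3) by simp
    qed
    then show False by simp
  qed
  from B R have "\<forall>\<^sub>F M in sequentially. \<forall>j. breaks Q (S M @ r j) \<subseteq> {..<B}"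
  proof eventually_elim
    case (elim M)
    have "breaks Q (S M) \<subseteq> {..<B}"
    proof
      fix d assume "d \<in> breaks Q (S M)"
      then have "length (l J) + d \<in> breaks Q (l J @ S M @ r 0)" using mem_breaks_middle by blast
      then show "d \<in> {..<B}" using elim(1) by auto
    qed
    then show ?case using breaks_append_left[of Q "S M"] elim(2) noR by simp
  qed
  then obtain M0 where M0: "\<And>M j. M \<ge> M0 \<Longrightarrow> breaks Q (S M @ r j) \<subseteq> {..<B}"
    unfolding eventually_sequentially by blast
  let ?K = "num_lists_le TYPE('a) Q * num_lists_le TYPE('a) B"
  let ?A = "\<lambda>n i. (@) (l i) ` {v::'a list. length v = n - i \<and> breaks Q v \<subseteq> {0..<0 + B}}"
  have "card (windows l S r M0 n) \<le> ?K * (n + 1)" for n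
  proof -
    have "windows l S r M0 n \<subseteq> (\<Union>i\<in>{..n}. ?A n i)"
    proof
      fix w assume "w \<in> windows l S r M0 n"
      then obtain M i j m where M: "length w = n" "M0 \<le> M" "w = l i @ m @ r j" "sublist m (S M)"
        "r j \<noteq> [] \<longrightarrow> suffix m (S M)"
        unfolding windows_def by blast
      have "sublist (m @ r j) (S M @ r j)"
      proof (cases "r j = []")
        case False
        then have "suffix (m @ r j) (S M @ r j)" using M(5) by (auto simp: suffix_def)
        then show ?thesis by (rule suffix_imp_sublist)
      qed (use M(4) in simp)
      then obtain y where "\<And>d. d \<in> breaks Q (m @ r j) \<longleftrightarrow>
          d + Q < length (m @ r j) \<and> y + d \<in> breaks Q (S M @ r j)"
        using breaks_sublist[of "m @ r j" "S M @ r j" Q] by blast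
      then have "breaks Q (m @ r j) \<subseteq> {0..<0 + B}" using M0[OF M(2), of j] by force
      moreover have "w = l (length (l i)) @ (m @ r j)" using left_chain_length[OF l] M(3) by simp
      moreover have "length (l i) \<le> n" "length (m @ r j) = n - length (l i)" using M(1,3) by auto
      ultimately show "w \<in> (\<Union>i\<in>{..n}. ?A n i)" by blast
    qed
    then have "card (windows l S r M0 n) \<le> card (\<Union>i\<in>{..n}. ?A n i)"
      by (intro card_mono finite_UN_I finite_imageI finite_lists_eq) auto
    also have "\<dots> \<le> ?K * card {..n}"
    proof (rule card_UN_le_mult)
      show "card (?A n i) \<le> ?K" for i
        by (rule order_trans[OF card_image_le[OF finite_lists_eq] card_breaks_within[OF Q]])
    qed simp
    finally show ?thesis by simp
  qed
  then show ?thesis by blast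
qed

text \<open>If \<open>S\<close> is eventually constant, the length of the left part and a bounded
  word determine a window. Otherwise the cluster sits at the left end, at the right end, or wholly
  inside \<open>S M\<close>. Each time one position is free and the rest has boundedly many
  choices.\<close>

lemma few_windows:
  fixes S :: "nat \<Rightarrow> 'a::finite list"
  assumes Q: "0 < Q" and l: "left_chain l" and r: "right_chain r" and S: "nice Q S"
    and cl: "\<And>J J'. clustered (\<lambda>M. breaks Q (l J @ S M @ r J'))"
  shows "\<exists>K M0. \<forall>n. card (windows l S r M0 n) \<le> K * (n + 1)"
  using nice_tame[OF S]
proof (cases rule: tame_length_cases)
  case (1 s)
  then obtain M0 where M0: "\<And>M. M \<ge> M0 \<Longrightarrow> S M = s" unfolding eventually_sequentially by blast
  let ?N = "{m::'a list. length m \<le> length s}"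
  let ?A = "\<lambda>n i. (\<lambda>m. l i @ m @ r (n - i - length m)) ` ?N"
  have "card (windows l S r M0 n) \<le> card ?N * (n + 1)" for n
  proof -
    have "windows l S r M0 n \<subseteq> (\<Union>i\<in>{..n}. ?A n i)"
    proof
      fix w assume "w \<in> windows l S r M0 n"
      then obtain M i j m where M: "length w = n" "M0 \<le> M" "w = l i @ m @ r j" "sublist m (S M)"
        unfolding windows_def by blast
      have "m \<in> ?N" using sublist_length_le[OF M(4)] M0[OF M(2)] by simp
      moreover have "w = l (length (l i)) @ m @ r (n - length (l i) - length m)"
      proof -
        have "n - length (l i) - length m = length (r j)" using M(1,3) by auto
        then show ?thesis
          using left_chain_length[OF l, of i] right_chain_length[OF r, of j] M(3) by simp
      qed
      moreover have "length (l i) \<le> n" using M(1,3) by simp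
      ultimately show "w \<in> (\<Union>i\<in>{..n}. ?A n i)" by blast
    qed
    then have "card (windows l S r M0 n) \<le> card (\<Union>i\<in>{..n}. ?A n i)"
      by (intro card_mono finite_UN_I finite_imageI finite_lists_le) auto
    also have "\<dots> \<le> card ?N * card {..n}"
      by (rule card_UN_le_mult) (auto intro: card_image_le finite_lists_le)
    finally show ?thesis by simp
  qed
  then show ?thesis by blast
next
  case unb: 2
  obtain P where P: "\<forall>\<^sub>F M in sequentially. take Q (S M) = P"
    using S unfolding nice_def evconst_def by blast
  obtain R where R: "\<forall>\<^sub>F M in sequentially. lastn Q (S M) = R"
    using S unfolding nice_def evconst_def by blast
  consider J where "breaks Q (l J @ P) \<noteq> {}" | J where "breaks Q (R @ r J) \<noteq> {}"
    | "\<And>J. breaks Q (l J @ P) = {}" "\<And>J. breaks Q (R @ r J) = {}" by blast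
  then show ?thesis
  proof cases
    case 1
    then show ?thesis using few_windows_left_break[OF Q l r S unb cl P] by blast
  next
    case 2
    have clr: "clustered (\<lambda>M. breaks Q (rev (r J) @ rev (S M) @ rev (l J')))" for J J'
    proof -
      obtain p D where p: "evpoly p" "finite D"
        "\<forall>\<^sub>F M in sequentially. int ` breaks Q (l J' @ S M @ r J) = (+) (p M) ` D"
        using cl[of J' J] unfolding clustered_def by blast
      show ?thesis
      proof (rule clusteredI)
        let ?n = "\<lambda>M. int (length (l J') + length (r J)) + int (length (S M))"
        show "evpoly (\<lambda>M. ?n M - (1 + int Q + p M))"
          using p nice_evpoly_length[OF S] by (intro evpoly_diff evpoly_add evpoly_const)
        show "finite (uminus ` D)" using p by simp
        show "\<forall>\<^sub>F M in sequentially. int ` breaks Q (rev (r J) @ rev (S M) @ rev (l J'))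
            = (+) (?n M - (1 + int Q + p M)) ` uminus ` D"
          using p(3)
        proof eventually_elim
          case (elim M)
          have "rev (r J) @ rev (S M) @ rev (l J') = rev (l J' @ S M @ r J)" by simp
          then show ?case using int_image_breaks_rev[of Q "l J' @ S M @ r J"] unfolding elim
            by (simp add: image_image algebra_simps)
        qed
      qed
    qed
    have "breaks Q (rev (r J) @ rev R) \<noteq> {}"
      using 2 int_image_breaks_rev[of Q "R @ r J"] by auto
    moreover have "\<forall>\<^sub>F M in sequentially. take Q (rev (S M)) = rev R"
      using R by eventually_elim (simp add: take_rev')
    moreover have "\<forall>\<^sub>F M in sequentially. K \<le> length (rev (S M))" for K using unb by simp
    ultimately obtain K M0 where K:
      "\<And>n. card (windows (\<lambda>i. rev (r i)) (\<lambda>M. rev (S M)) (\<lambda>i. rev (l i)) M0 n) \<le> K * (n + 1)"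
      using few_windows_left_break[of Q "\<lambda>i. rev (r i)" "\<lambda>i. rev (l i)" "\<lambda>M. rev (S M)" "rev R" J]
        Q l r nice_rev[OF S] clr unfolding left_chain_rev right_chain_rev by blast
    have "card (windows l S r M0 n) \<le> K * (n + 1)" for n
    proof -
      have "card (windows l S r M0 n) = card (rev ` windows l S r M0 n)"
        by (simp add: card_image)
      also have "\<dots> \<le> card (windows (\<lambda>i. rev (r i)) (\<lambda>M. rev (S M)) (\<lambda>i. rev (l i)) M0 n)"
        using windows_rev by (intro card_mono finite_windows) blast
      finally show ?thesis using K[of n] by linarith
    qed
    then show ?thesis by blast
  next
    case 3
    obtain p D where D: "finite D" "\<forall>\<^sub>F M in sequentially. int ` breaks Q (S M) = (+) (p M) ` D"
      using nice_clustered[OF S] unfolding clustered_def by blast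
    define B where "B = nat (Max D - Min D) + 1"
    from D(2) P R unb[of Q] have "\<forall>\<^sub>F M in sequentially. \<forall>i j.
        \<forall>x\<in>breaks Q (l i @ S M @ r j). \<forall>y\<in>breaks Q (l i @ S M @ r j). x < y + B"
    proof eventually_elim
      case (elim M)
      have b1: "breaks Q (S M @ r j) = breaks Q (S M)" for j
        using breaks_append_left[of Q "S M" "r j"] 3(2) elim(3) by simp
      have b2: "breaks Q (l i @ S M @ r j) = (+) (length (l i)) ` breaks Q (S M)" for i j
        using breaks_append_right[of Q "l i" "S M @ r j"] 3(1) elim(2,4) b1 by simp
      have b3: "x < y + B" if "x \<in> breaks Q (S M)" "y \<in> breaks Q (S M)" for x y
      proof -
        have "int x \<in> (+) (p M) ` D" "int y \<in> (+) (p M) ` D" using that elim(1) by blast+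
        then obtain d e where de: "d \<in> D" "e \<in> D" "int x = p M + d" "int y = p M + e" by blast
        have "d - e \<le> Max D - Min D" using Max_ge[OF D(1) de(1)] Min_le[OF D(1) de(2)] by linarith
        then show ?thesis using de unfolding B_def by linarith
      qed
      show ?case unfolding b2 using b3 by auto
    qed
    then obtain M0 where M0: "\<And>M i j x y. M \<ge> M0 \<Longrightarrow> x \<in> breaks Q (l i @ S M @ r j) \<Longrightarrow>
        y \<in> breaks Q (l i @ S M @ r j) \<Longrightarrow> x < y + B"
      unfolding eventually_sequentially by blast
    let ?K = "num_lists_le TYPE('a) Q * num_lists_le TYPE('a) B"
    let ?A = "\<lambda>n q. {w::'a list. length w = n \<and> breaks Q w \<subseteq> {q..<q + B}}"
    have "card (windows l S r M0 n) \<le> ?K * (n + 1)" for n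
    proof -
      have "windows l S r M0 n \<subseteq> (\<Union>q\<in>{..n}. ?A n q)"
      proof
        fix w assume "w \<in> windows l S r M0 n"
        then obtain M i j m where M: "length w = n" "M0 \<le> M" "w = l i @ m @ r j" "sublist m (S M)"
          "l i \<noteq> [] \<longrightarrow> Sublist.prefix m (S M)" "r j \<noteq> [] \<longrightarrow> suffix m (S M)"
          "l i \<noteq> [] \<and> r j \<noteq> [] \<longrightarrow> m = S M"
          unfolding windows_def by blast
        have "sublist w (l i @ S M @ r j)"
        proof (cases "l i = []"; cases "r j = []")
          assume a: "l i \<noteq> []" "r j = []"
          then have "Sublist.prefix (l i @ m) (l i @ S M)" using M(5) by simp
          then show ?thesis using a M(3) prefix_imp_sublist by auto
        next
          assume a: "l i = []" "r j \<noteq> []"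
          then have "suffix (m @ r j) (S M @ r j)" using M(6) by (auto simp: suffix_def)
          then show ?thesis using a M(3) suffix_imp_sublist by auto
        qed (use M in auto)
        then obtain y where y: "\<And>d. d \<in> breaks Q w \<longleftrightarrow>
            d + Q < length w \<and> y + d \<in> breaks Q (l i @ S M @ r j)"
          using breaks_sublist[of w "l i @ S M @ r j" Q] by blast
        have close: "d < e + B" if "d \<in> breaks Q w" "e \<in> breaks Q w" for d e
          using M0[OF M(2), of "y + d" i j "y + e"] y[of d] y[of e] that by auto
        show "w \<in> (\<Union>q\<in>{..n}. ?A n q)"
        proof (cases "breaks Q w = {}")
          case True
          then show ?thesis using M(1) by auto
        next
          case False
          \<comment> \<open>The free position in this case: the first break of the window.\<close>
          let ?q = "Min (breaks Q w)"
          have q: "?q \<in> breaks Q w" using False by (intro Min_in) simp_all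
          then have "?q \<le> n" using M(1) by (auto simp: breaks_def)
          moreover have "breaks Q w \<subseteq> {?q..<?q + B}" using close[OF _ q] by auto
          ultimately show ?thesis using M(1) by blast
        qed
      qed
      then have "card (windows l S r M0 n) \<le> card (\<Union>q\<in>{..n}. ?A n q)"
        by (intro card_mono finite_UN_I finite_lists_eq) auto
      also have "\<dots> \<le> ?K * card {..n}"
        by (rule card_UN_le_mult) (simp_all only: card_breaks_within[OF Q] finite_atMost)
      finally show ?thesis by simp
    qed
    then show ?thesis by blast
  qed
qed

context scaled_morphism
begin

text \<open>All levels with \<open>n \<le> c \<tau> M\<close> together give \<open>O(n)\<close>
  words across one cut. The level is \<open>Suc M\<close> because the end lemmas describe images of
  \<open>ext f u\<close> and \<open>ext f v\<close>. The nice words on both sides merge into one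
  nice word, as they meet inside \<open>W (M + 2) [x]\<close>.\<close>

lemma few_high_level_words:
  assumes x: "f x = u @ v"
  shows "\<exists>K M0 c. 0 < c \<and> (\<forall>n. card {w. length w = n \<and> (\<exists>M\<ge>M0. real n \<le> c * \<tau> M \<and>
      (\<exists>w1 w2. w = w1 @ w2 \<and> suffix w1 (W (Suc M) u) \<and> Sublist.prefix w2 (W (Suc M) v)))}
    \<le> K * (n + 1))"
proof -
  have Wx: "W (M + 2) [x] = W M (ext f u) @ W M (ext f v)" for M
    by (simp add: img_Suc x)
  have "sublist (W M (ext f u)) (W (M + 2) [x])" "sublist (W M (ext f v)) (W (M + 2) [x])" for M
    unfolding Wx by simp_all
  then have sub: "\<forall>\<^sub>F M in sequentially. sublist (W M (ext f u)) (W (M + 2) [x])"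
    "\<forall>\<^sub>F M in sequentially. sublist (W M (ext f v)) (W (M + 2) [x])" by auto
  obtain l S1 c1 where l: "left_chain l" "nice Q S1" "poly_bounded \<kappa> (\<lambda>M. length (S1 M))"
    "\<And>J. \<forall>\<^sub>F M in sequentially. suffix (l J @ S1 M) (W M (ext f u))" and "c1 > 0"
    and ev1: "\<forall>\<^sub>F M in sequentially. \<forall>w. suffix w (W M (ext f u)) \<and> real (length w) \<le> c1 * \<tau> M \<longrightarrow>
        suffix w (S1 M) \<or> (\<exists>i. w = l i @ S1 M)"
    using left_end_exists[OF sub(1)] by blast
  obtain r S2 where "right_end (ext f v) r S2" using right_end_exists[OF sub(2)] by blast
  then obtain c2 where r: "right_chain r" "nice Q S2" "poly_bounded \<kappa> (\<lambda>M. length (S2 M))"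
    "\<And>J. \<forall>\<^sub>F M in sequentially. Sublist.prefix (S2 M @ r J) (W M (ext f v))" and "c2 > 0"
    and ev2: "\<forall>\<^sub>F M in sequentially. \<forall>w. Sublist.prefix w (W M (ext f v)) \<and>
        real (length w) \<le> c2 * \<tau> M \<longrightarrow> Sublist.prefix w (S2 M) \<or> (\<exists>i. w = S2 M @ r i)"
    unfolding right_end_def by blast
  have safe: "safe Q (\<lambda>M. l J @ (S1 M @ S2 M) @ r J')" for J J'
  proof (rule safeI)
    show "poly_bounded \<kappa> (\<lambda>M. length (l J @ (S1 M @ S2 M) @ r J'))"
      unfolding length_append using l(3) r(3) by (intro poly_bounded_add poly_bounded_const)
    show "\<forall>\<^sub>F M in sequentially. sublist (l J @ (S1 M @ S2 M) @ r J') (W (M + 2) [x])"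
      using l(4)[of J] r(4)[of J']
    proof eventually_elim
      case (elim M)
      then obtain p q where "W M (ext f u) = p @ l J @ S1 M" "W M (ext f v) = (S2 M @ r J') @ q"
        by (auto simp: suffix_def prefix_def)
      then have "W (M + 2) [x] = p @ (l J @ (S1 M @ S2 M) @ r J') @ q" unfolding Wx by simp
      then show ?case unfolding sublist_def by blast
    qed
  qed
  have nS: "nice Q (\<lambda>M. S1 M @ S2 M)"
    by (rule nice_append[OF l(2) r(2)], rule safe_sublist[OF safe[of 0 0]])
       (simp add: left_chain_0[OF l(1)] right_chain_0[OF r(1)])
  have cl: "clustered (\<lambda>M. breaks Q (l J @ (S1 M @ S2 M) @ r J'))" for J J'
  proof -
    have "nice Q (\<lambda>M. (S1 M @ S2 M) @ r J')"
      by (rule nice_append[OF nS nice_const], rule safe_sublist[OF safe[of 0 J']])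
         (simp add: left_chain_0[OF l(1)])
    then have "nice Q (\<lambda>M. l J @ (S1 M @ S2 M) @ r J')"
      by (rule nice_append[OF nice_const]) (rule safe)
    then show ?thesis by (rule nice_clustered)
  qed
  obtain K M1 where K: "\<And>n. card (windows l (\<lambda>M. S1 M @ S2 M) r M1 n) \<le> K * (n + 1)"
    using few_windows[OF Q_pos l(1) r(1) nS cl] by blast
  define c where "c = min c1 c2"
  have "\<forall>\<^sub>F M in sequentially. 0 * real M ^ \<kappa> \<le> \<tau> M" by (rule dominates)
  with ev1 ev2 have "\<forall>\<^sub>F M in sequentially.
      (\<forall>w. suffix w (W M (ext f u)) \<and> real (length w) \<le> c * \<tau> M \<longrightarrow>
        suffix w (S1 M) \<or> (\<exists>i. w = l i @ S1 M)) \<and>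
      (\<forall>w. Sublist.prefix w (W M (ext f v)) \<and> real (length w) \<le> c * \<tau> M \<longrightarrow>
        Sublist.prefix w (S2 M) \<or> (\<exists>i. w = S2 M @ r i))"
  proof eventually_elim
    case (elim M)
    have "c * \<tau> M \<le> c1 * \<tau> M" "c * \<tau> M \<le> c2 * \<tau> M"
      using elim(3) by (auto simp: c_def intro!: mult_right_mono)
    then show ?case using elim(1,2) by (meson order_trans)
  qed
  then obtain M2 where M2: "\<And>M w. M \<ge> M2 \<Longrightarrow> suffix w (W M (ext f u)) \<Longrightarrow>
        real (length w) \<le> c * \<tau> M \<Longrightarrow> suffix w (S1 M) \<or> (\<exists>i. w = l i @ S1 M)"
      "\<And>M w. M \<ge> M2 \<Longrightarrow> Sublist.prefix w (W M (ext f v)) \<Longrightarrow>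
        real (length w) \<le> c * \<tau> M \<Longrightarrow> Sublist.prefix w (S2 M) \<or> (\<exists>i. w = S2 M @ r i)"
    unfolding eventually_sequentially by blast
  let ?A = "\<lambda>n. {w. length w = n \<and> (\<exists>M\<ge>max M1 M2. real n \<le> c * \<tau> M \<and>
      (\<exists>w1 w2. w = w1 @ w2 \<and> suffix w1 (W (Suc M) u) \<and> Sublist.prefix w2 (W (Suc M) v)))}"
  have "card (?A n) \<le> K * (n + 1)" for n
  proof -
    have "?A n \<subseteq> windows l (\<lambda>M. S1 M @ S2 M) r M1 n"
    proof
      fix w assume "w \<in> ?A n"
      then obtain M w1 w2 where M: "length w = n" "M \<ge> M1" "M \<ge> M2" "real n \<le> c * \<tau> M"
        "w = w1 @ w2" "suffix w1 (W M (ext f u))" "Sublist.prefix w2 (W M (ext f v))"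
        by (auto simp: img_Suc)
      have len: "real (length w1) \<le> c * \<tau> M" "real (length w2) \<le> c * \<tau> M"
        using M(1,4,5) by auto
      note l0 = left_chain_0[OF l(1)] and r0 = right_chain_0[OF r(1)]
      have "\<exists>i j m. w = l i @ m @ r j \<and> sublist m (S1 M @ S2 M) \<and>
         (l i \<noteq> [] \<longrightarrow> Sublist.prefix m (S1 M @ S2 M)) \<and> (r j \<noteq> [] \<longrightarrow> suffix m (S1 M @ S2 M)) \<and>
         (l i \<noteq> [] \<and> r j \<noteq> [] \<longrightarrow> m = S1 M @ S2 M)"
        using M2(1)[OF M(3,6) len(1)] M2(2)[OF M(3,7) len(2)]
      proof (elim disjE exE)
        assume "suffix w1 (S1 M)" "Sublist.prefix w2 (S2 M)"
        then obtain p q where "S1 M = p @ w1" "S2 M = w2 @ q" by (auto simp: suffix_def prefix_def)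
        then have "sublist (w1 @ w2) (S1 M @ S2 M)" unfolding sublist_def by (metis append.assoc)
        then show ?thesis by (intro exI[of _ 0] exI[of _ "w1 @ w2"]) (simp add: l0 r0 M(5))
      next
        fix i assume i: "w1 = l i @ S1 M" "Sublist.prefix w2 (S2 M)"
        then have "Sublist.prefix (S1 M @ w2) (S1 M @ S2 M)" by simp
        then show ?thesis using i(1) prefix_imp_sublist
          by (intro exI[of _ i] exI[of _ 0] exI[of _ "S1 M @ w2"]) (simp add: l0 r0 M(5))
      next
        fix j assume j: "suffix w1 (S1 M)" "w2 = S2 M @ r j"
        then have "suffix (w1 @ S2 M) (S1 M @ S2 M)" by (auto simp: suffix_def)
        then show ?thesis using j(2) suffix_imp_sublist
          by (intro exI[of _ 0] exI[of _ j] exI[of _ "w1 @ S2 M"]) (simp add: l0 r0 M(5))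
      next
        fix i j assume "w1 = l i @ S1 M" "w2 = S2 M @ r j"
        then show ?thesis
          by (intro exI[of _ i] exI[of _ j] exI[of _ "S1 M @ S2 M"]) (simp add: M(5))
      qed
      then show "w \<in> windows l (\<lambda>M. S1 M @ S2 M) r M1 n"
        using M(1,2) unfolding windows_def by blast
    qed
    then have "card (?A n) \<le> card (windows l (\<lambda>M. S1 M @ S2 M) r M1 n)"
      by (intro card_mono finite_windows)
    then show ?thesis using K[of n] by linarith
  qed
  moreover have "0 < c" using \<open>c1 > 0\<close> \<open>c2 > 0\<close> by (simp add: c_def)
  ultimately show ?thesis by blast
qed

end

section \<open>Upper bound\<close>

definition crossing_words :: "'a list \<Rightarrow> 'a list \<Rightarrow> nat \<Rightarrow> 'a list set" where
  "crossing_words x y n = {w. length w = n \<and> (\<exists>w1 w2. w = w1 @ w2 \<and> suffix w1 x \<and> Sublist.prefix w2 y)}"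

lemma crossing_words_subset:
  "crossing_words x y n \<subseteq> (\<lambda>i. lastn i x @ take (n - i) y) ` {..n}"
proof
  fix w assume "w \<in> crossing_words x y n"
  then obtain w1 w2 where w: "length w = n" "w = w1 @ w2" "suffix w1 x" "Sublist.prefix w2 y"
    unfolding crossing_words_def by blast
  have "w1 = lastn (length w1) x" using w(3) by (auto simp: suffix_def lastn_def)
  moreover have "w2 = take (n - length w1) y" using w prefix_take_eq[OF w(4)] by auto
  ultimately show "w \<in> (\<lambda>i. lastn i x @ take (n - i) y) ` {..n}"
    using w by (intro image_eqI[of _ _ "length w1"]) auto
qed

lemma card_crossing_words: "card (crossing_words x y n) \<le> n + 1"
proof -
  have "card (crossing_words x y n) \<le> card ((\<lambda>i. lastn i x @ take (n - i) y) ` {..n})"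
    by (intro card_mono crossing_words_subset) simp
  also have "\<dots> \<le> card {..n}" by (rule card_image_le) simp
  finally show ?thesis by simp
qed

lemma finite_crossing_words: "finite (crossing_words x y n)"
  by (rule finite_subset[OF crossing_words_subset]) simp

lemma sublist_img_cases:
  assumes "sublist w (img f g M U)" "w \<noteq> []"
  shows "(\<exists>c\<in>set U. sublist w (img f g M [c])) \<or>
    (\<exists>u v. U = u @ v \<and> w \<in> crossing_words (img f g M u) (img f g M v) (length w))"
  using assms(1)
proof (induction U)
  case Nil
  then show ?case using assms(2) by simp
next
  case (Cons c U)
  have "sublist w (img f g M [c] @ img f g M U)" using Cons.prems by (simp add: img_Cons[of f g M c U])
  then consider "sublist w (img f g M [c])" | "sublist w (img f g M U)"
    | w1 w2 where "w = w1 @ w2" "suffix w1 (img f g M [c])" "Sublist.prefix w2 (img f g M U)"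
    unfolding sublist_append by blast
  then show ?case
  proof cases
    case 2
    from Cons.IH[OF this] show ?thesis
    proof (elim disjE exE conjE)
      fix u v assume uv: "U = u @ v" "w \<in> crossing_words (img f g M u) (img f g M v) (length w)"
      then obtain w1 w2 where w: "w = w1 @ w2" "suffix w1 (img f g M u)" "Sublist.prefix w2 (img f g M v)"
        unfolding crossing_words_def by blast
      have "suffix w1 (img f g M (c # u))"
        using w(2) by (simp add: img_Cons[of f g M c u] suffix_appendI)
      then have "w \<in> crossing_words (img f g M (c # u)) (img f g M v) (length w)"
        using w unfolding crossing_words_def by blast
      then show ?thesis using uv(1) by (metis append_Cons)
    qed auto
  next
    case 3
    then have "w \<in> crossing_words (img f g M [c]) (img f g M U) (length w)"
      unfolding crossing_words_def by blast
    then show ?thesis by (metis append_Cons append_Nil)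
  qed auto
qed

text \<open>Going down the levels, a word stays inside the image of one letter until it meets a cut.
  It meets one, because it is too long to fit into any \<open>g b\<close>.\<close>

lemma sublist_img_crossing:
  assumes "\<And>b. length (g b) \<le> G" "sublist w (img f g M [x])" "G < length w"
  shows "\<exists>M' x' u v. f x' = u @ v \<and> w \<in> crossing_words (img f g M' u) (img f g M' v) (length w)"
  using assms(2)
proof (induction M arbitrary: x)
  case 0
  then show ?case using assms(1)[of x] assms(3) sublist_length_le[of w "g x"] by simp
next
  case (Suc M)
  have "sublist w (img f g M (f x))" using Suc.prems by (simp add: img_Suc_single)
  moreover have "w \<noteq> []" using assms(3) by auto
  ultimately show ?case using sublist_img_cases[of w f g M "f x"] Suc.IH by blast
qed

context scaled_morphism
begin

text \<open>The threshold \<open>m\<close> stays free: each level up to \<open>m\<close> gives at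
  most \<open>n + 1\<close> words per cut, and all higher levels together give \<open>O(n)\<close>.
  It is later taken of order \<open>n^(1/k)\<close> or \<open>log n\<close>.\<close>

lemma complexity_upper_bound:
  fixes \<beta> :: "'a word"
  assumes pre: "\<And>M i. i < length (W M [a]) \<Longrightarrow> W M [a] ! i = \<beta> i"
    and len: "\<And>N. \<exists>M. N \<le> length (W M [a])"
  shows "\<exists>C M0 c n0. 0 < c \<and> (\<forall>n\<ge>n0. \<forall>m\<ge>M0. (\<forall>M\<ge>m. real n \<le> c * \<tau> M) \<longrightarrow>
    subword_complexity \<beta> n \<le> C * (n + 1) * (m + 1))"
proof -
  define G where "G = Max (range (\<lambda>b. length (g b)))"
  have G: "length (g b) \<le> G" for b unfolding G_def by (rule Max_ge) auto
  define I where "I = {(u, v). \<exists>x. f x = u @ v}"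
  have "I \<subseteq> (\<Union>x. (\<lambda>i. (take i (f x), drop i (f x))) ` {..length (f x)})"
  proof
    fix p assume "p \<in> I"
    then obtain x u v where "p = (u, v)" "f x = u @ v" unfolding I_def by blast
    then show "p \<in> (\<Union>x. (\<lambda>i. (take i (f x), drop i (f x))) ` {..length (f x)})"
      by (intro UN_I[of x] image_eqI[of _ _ "length u"]) auto
  qed
  then have finI: "finite I" by (rule finite_subset) simp
  define high where "high = (\<lambda>(u, v) M0 c n. {w. length w = n \<and> (\<exists>M\<ge>M0. real n \<le> c * \<tau> M \<and>
      (\<exists>w1 w2. w = w1 @ w2 \<and> suffix w1 (W (Suc M) u) \<and> Sublist.prefix w2 (W (Suc M) v)))})"
  have "\<forall>p\<in>I. \<exists>K M0 c. 0 < c \<and> (\<forall>n. card (high p M0 c n) \<le> K * (n + 1))"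
    using few_high_level_words unfolding I_def high_def by auto
  then obtain K M1 c1 where hi: "\<And>p. p \<in> I \<Longrightarrow> 0 < (c1 p :: real)"
    "\<And>p n. p \<in> I \<Longrightarrow> card (high p (M1 p) (c1 p) n) \<le> K p * (n + 1)"
    by metis
  have "([], f a) \<in> I" by (auto simp: I_def)
  then have Ine: "I \<noteq> {}" by blast
  define c where "c = Min (c1 ` I)"
  have c: "0 < c" "\<And>p. p \<in> I \<Longrightarrow> c \<le> c1 p" using finI Ine hi(1) by (auto simp: c_def)
  \<comment> \<open>The common \<open>c\<close> can stand in for the larger \<open>c1 p\<close> only
    where \<tau> is nonnegative.\<close>
  obtain T0 where T0: "\<And>M. M \<ge> T0 \<Longrightarrow> 0 \<le> \<tau> M"
    using dominates[of 0] unfolding eventually_sequentially by auto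
  define M0 where "M0 = T0 + (\<Sum>p\<in>I. M1 p)"
  have M0: "M1 p \<le> M0" "T0 \<le> M0" if "p \<in> I" for p
    using that finI member_le_sum[of p I M1] by (auto simp: M0_def)
  \<comment> \<open>For each cut, \<open>K p\<close> accounts for the high levels and
    \<open>1\<close> for the low ones.\<close>
  define C where "C = (\<Sum>p\<in>I. K p + 1)"
  have "subword_complexity \<beta> n \<le> C * (n + 1) * (m + 1)"
    if n: "n \<ge> Suc G" and m: "m \<ge> M0" and big: "\<forall>M\<ge>m. real n \<le> c * \<tau> M" for n m
  proof -
    let ?F = "{\<beta> [i \<rightarrow> i + n] | i. True}"
    let ?low = "\<lambda>(u, v). \<Union>M\<in>{..m}. crossing_words (W M u) (W M v) n"
    have "?F \<subseteq> (\<Union>p\<in>I. ?low p \<union> high p (M1 p) (c1 p) n)"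
    proof
      fix w assume "w \<in> ?F"
      then obtain i where i: "w = \<beta> [i \<rightarrow> i + n]" by blast
      then have lw: "length w = n" by simp
      obtain M where M: "i + n \<le> length (W M [a])" using len by blast
      have "w = take n (drop i (W M [a]))"
      proof (rule nth_equalityI)
        show "length w = length (take n (drop i (W M [a])))" using lw M by simp
        fix j assume "j < length w"
        then show "w ! j = take n (drop i (W M [a])) ! j"
          using M lw pre[of "i + j" M] unfolding i by simp
      qed
      then have "sublist w (W M [a])" by (metis sublist_take sublist_drop sublist_order.order.trans)
      then obtain M' x u v where cr: "f x = u @ v" "w \<in> crossing_words (W M' u) (W M' v) n"
        using sublist_img_crossing[of g G w f M a] G n lw by auto
      have p: "(u, v) \<in> I" using cr(1) unfolding I_def by blast
      have "w \<in> ?low (u, v) \<union> high (u, v) (M1 (u, v)) (c1 (u, v)) n"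
      proof (cases "M' \<le> m")
        case True
        then show ?thesis using cr(2) by auto
      next
        case False
        then obtain M2 where M2: "M' = Suc M2" "M2 \<ge> m" by (cases M') auto
        have "real n \<le> c * \<tau> M2" using big M2 by blast
        also have "\<dots> \<le> c1 (u, v) * \<tau> M2"
          using c(2)[OF p] T0[of M2] M0(2)[OF p] m M2 by (intro mult_right_mono) auto
        finally have "real n \<le> c1 (u, v) * \<tau> M2" .
        moreover have "M1 (u, v) \<le> M2" using M0(1)[OF p] m M2 by linarith
        ultimately have "w \<in> high (u, v) (M1 (u, v)) (c1 (u, v)) n"
          using cr(2) unfolding high_def crossing_words_def M2(1) by auto
        then show ?thesis by blast
      qed
      then show "w \<in> (\<Union>p\<in>I. ?low p \<union> high p (M1 p) (c1 p) n)" using p by blast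
    qed
    moreover have fin: "finite (?low p \<union> high p (M1 p) (c1 p) n)" for p
      unfolding high_def by (auto simp: case_prod_beta intro: finite_lists_eq finite_crossing_words)
    ultimately have "card ?F \<le> card (\<Union>p\<in>I. ?low p \<union> high p (M1 p) (c1 p) n)"
      using finI by (intro card_mono finite_UN_I) auto
    also have "\<dots> \<le> (\<Sum>p\<in>I. card (?low p \<union> high p (M1 p) (c1 p) n))"
      using finI by (rule card_UN_le)
    also have "\<dots> \<le> (\<Sum>p\<in>I. (K p + 1) * ((n + 1) * (m + 1)))"
    proof (rule sum_mono)
      fix p assume p: "p \<in> I"
      obtain u v where uv: "p = (u, v)" by (cases p)
      have "card (?low p) \<le> (n + 1) * card {..m}"
        unfolding uv prod.case by (rule card_UN_le_mult) (simp_all only: card_crossing_words finite_atMost)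
      then have "card (?low p) \<le> (n + 1) * (m + 1)" by simp
      moreover have "card (high p (M1 p) (c1 p) n) \<le> K p * ((n + 1) * (m + 1))"
        using hi(2)[OF p, of n] by (rule order_trans) simp
      moreover have "card (?low p \<union> high p (M1 p) (c1 p) n) \<le> card (?low p) + card (high p (M1 p) (c1 p) n)"
        by (rule card_Un_le)
      ultimately show "card (?low p \<union> high p (M1 p) (c1 p) n) \<le> (K p + 1) * ((n + 1) * (m + 1))"
        by (simp add: algebra_simps)
    qed
    also have "\<dots> = C * ((n + 1) * (m + 1))" unfolding C_def sum_distrib_right ..
    finally show ?thesis unfolding subword_complexity_def by (simp only: mult.assoc)
  qed
  then show ?thesis using c(1) by blast
qed

end

section \<open>Lower bound\<close>

definition word_breaks :: "nat \<Rightarrow> 'a word \<Rightarrow> nat set" where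
  "word_breaks Q \<beta> = {p. \<beta> p \<noteq> \<beta> (p + Q)}"

definition bad_gaps :: "nat \<Rightarrow> 'a word \<Rightarrow> nat \<Rightarrow> bool" where
  "bad_gaps Q \<beta> k \<longleftrightarrow> 1 \<le> k \<and> (\<exists>L. poly_growth k L \<and>
     (\<forall>\<^sub>F M in sequentially. consecutive_diff (word_breaks Q \<beta>) (L M)))"

lemma card_spaced_le:
  assumes "finite I" "0 < e" "inj_on p I"
    and "\<And>M M'. M \<in> I \<Longrightarrow> M' \<in> I \<Longrightarrow> p M < p M' \<Longrightarrow> p M + e \<le> p M'"
    and "\<And>M. M \<in> I \<Longrightarrow> p M < (h::nat)"
  shows "card I \<le> h div e + 1"
proof -
  have "inj_on (\<lambda>M. p M div e) I"
  proof (rule inj_onI, rule ccontr)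
    fix M M' assume M: "M \<in> I" "M' \<in> I" "p M div e = p M' div e" "M \<noteq> M'"
    have *: "False" if "M \<in> I" "M' \<in> I" "p M div e = p M' div e" "p M < p M'" for M M'
    proof -
      have "p M div e + 1 \<le> p M' div e"
        using assms(4)[OF that(1,2,4)] assms(2) by (metis Suc_eq_plus1 div_add_self2 div_le_mono less_irrefl)
      then show False using that(3) by simp
    qed
    have "p M \<noteq> p M'" using M assms(3) by (auto dest: inj_onD)
    then show False using *[of M M'] *[of M' M] M by linarith
  qed
  moreover have "(\<lambda>M. p M div e) ` I \<subseteq> {..h div e}"
    using assms(5) by (auto simp: div_le_mono less_imp_le)
  ultimately have "card I \<le> card {..h div e}" by (intro card_inj_on_le) auto
  then show ?thesis by simp
qed

text \<open>Send \<open>(M, i)\<close> to the window that has the break \<open>p M\<close> at position \<open>i\<close>, together with \<open>i div e\<close>.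
  This is injective because breaks followed by a gap of length at least \<open>e\<close> are at least \<open>e\<close> apart.\<close>

lemma windows_around_gaps:
  fixes \<beta> :: "'a::finite word" and L p :: "nat \<Rightarrow> nat"
  assumes finJ: "finite J" and e: "0 < e" and inj: "inj_on L J"
    and h: "h + K + Q < n"
    and J: "\<And>M. M \<in> J \<Longrightarrow> e \<le> L M \<and> L M \<le> K \<and> h \<le> p M \<and>
      p M \<in> word_breaks Q \<beta> \<and> p M + L M \<in> word_breaks Q \<beta> \<and>
      (\<forall>i\<in>word_breaks Q \<beta>. i \<le> p M \<or> p M + L M \<le> i)"
  shows "card J * h \<le> subword_complexity \<beta> n * (h div e + 1)"
proof -
  let ?F = "{\<beta> [i \<rightarrow> i + n] | i. True}"
  let ?g = "\<lambda>(M, i). (\<beta> [p M - i \<rightarrow> p M - i + n], i div e)"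
  have finF: "finite ?F" by (rule finite_subset[OF _ finite_lists_le[of n]]) auto
  have next_break: "\<beta> [p M - i \<rightarrow> p M - i + n] ! j \<noteq> \<beta> [p M - i \<rightarrow> p M - i + n] ! (j + Q) \<longleftrightarrow> j = i \<or> j = i + L M"
    if "M \<in> J" "i < h" "i \<le> j" "j \<le> i + L M" for M i j
  proof -
    have i: "i \<le> p M" using J[OF that(1)] that(2) by linarith
    have "j + Q < n" using that J[OF that(1)] h by linarith
    then have "\<beta> [p M - i \<rightarrow> p M - i + n] ! j \<noteq> \<beta> [p M - i \<rightarrow> p M - i + n] ! (j + Q)
        \<longleftrightarrow> p M - i + j \<in> word_breaks Q \<beta>"
      by (simp add: word_breaks_def add.assoc)
    also have "p M - i + j = p M + (j - i)" using i that(3) by simp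
    also have "p M + (j - i) \<in> word_breaks Q \<beta> \<longleftrightarrow> j = i \<or> j = i + L M"
      using J[OF that(1)] that(3,4) by fastforce
    finally show ?thesis .
  qed
  have spaced: "i + e \<le> i'" if "M \<in> J" "M' \<in> J" "i < h" "i' < h" "i < i'"
    "\<beta> [p M - i \<rightarrow> p M - i + n] = \<beta> [p M' - i' \<rightarrow> p M' - i' + n]" for M M' i i'
  proof (rule ccontr)
    assume "\<not> i + e \<le> i'"
    then have lt: "i' < i + L M" using J[OF that(1)] by linarith
    have "\<beta> [p M' - i' \<rightarrow> p M' - i' + n] ! i' \<noteq> \<beta> [p M' - i' \<rightarrow> p M' - i' + n] ! (i' + Q)"
      using next_break[OF that(2,4), of i'] by simp
    then have "i' = i \<or> i' = i + L M" using next_break[OF that(1,3), of i'] that(5,6) lt by simp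
    then show False using that(5) lt by simp
  qed
  have "inj_on ?g (J \<times> {..<h})"
  proof (rule inj_onI, clarify)
    fix M M' i i' assume M: "M \<in> J" "M' \<in> J" "i < h" "i' < h" "i div e = i' div e"
      and eq: "\<beta> [p M - i \<rightarrow> p M - i + n] = \<beta> [p M' - i' \<rightarrow> p M' - i' + n]"
    have dv: "i div e + 1 \<le> i' div e" if "i + e \<le> i'" for i i'
      using that e by (metis Suc_eq_plus1 div_add_self2 div_le_mono less_irrefl)
    have ii: "i = i'"
    proof (rule ccontr)
      assume "i \<noteq> i'"
      then consider "i < i'" | "i' < i" by linarith
      then show False
      proof cases
        case 1
        then show False using spaced[OF M(1,2,3,4) 1 eq] dv[of i i'] M(5) by simp
      next
        case 2
        then show False using spaced[OF M(2,1,4,3) 2 eq[symmetric]] dv[of i' i] M(5) by simp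
      qed
    qed
    have *: "L M' \<le> L M" if "M \<in> J" "M' \<in> J"
      "\<beta> [p M - i \<rightarrow> p M - i + n] = \<beta> [p M' - i \<rightarrow> p M' - i + n]" for M M'
    proof (rule ccontr)
      assume "\<not> L M' \<le> L M"
      then have "i + L M \<le> i + L M'" by simp
      moreover have "0 < L M" using J[OF that(1)] e by linarith
      moreover have "\<beta> [p M - i \<rightarrow> p M - i + n] ! (i + L M) \<noteq> \<beta> [p M - i \<rightarrow> p M - i + n] ! (i + L M + Q)"
        using next_break[OF that(1) M(3), of "i + L M"] by simp
      ultimately have "i + L M = i \<or> i + L M = i + L M'"
        using next_break[OF that(2) M(3), of "i + L M"] that(3) by simp
      then show False using \<open>\<not> L M' \<le> L M\<close> \<open>0 < L M\<close> by simp
    qed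
    have "L M = L M'" using *[OF M(1,2)] *[OF M(2,1)] eq ii by (metis order_antisym)
    then show "M = M' \<and> i = i'" using inj M ii by (auto dest: inj_onD)
  qed
  moreover have "?g ` (J \<times> {..<h}) \<subseteq> ?F \<times> {..h div e}"
  proof (intro subsetI, elim imageE)
    fix y x assume "y = ?g x" "x \<in> J \<times> {..<h}"
    then obtain M i where y: "y = (\<beta> [p M - i \<rightarrow> p M - i + n], i div e)" "i < h" by auto
    have "\<beta> [p M - i \<rightarrow> p M - i + n] \<in> ?F" by blast
    moreover have "i div e \<le> h div e" using y(2) by (simp add: div_le_mono)
    ultimately show "y \<in> ?F \<times> {..h div e}" using y(1) by simp
  qed
  ultimately have "card (J \<times> {..<h}) \<le> card (?F \<times> {..h div e})"
    using finF by (intro card_inj_on_le) auto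
  then show ?thesis by (simp add: card_cartesian_product subword_complexity_def)
qed

lemma power_root_powr:
  fixes x :: real
  assumes "0 < x" "1 \<le> k"
  shows "(x powr (1 / real k)) ^ k = x"
  using assms by (simp add: powr_realpow[symmetric] powr_powr)

lemma bad_gaps_lower_bound:
  fixes \<beta> :: "'a::finite word"
  assumes "bad_gaps Q \<beta> k"
  shows "\<exists>c>0. \<forall>\<^sub>F n in sequentially. c * real n powr (1 + 1 / real k) \<le> real (subword_complexity \<beta> n)"
proof -
  have k: "1 \<le> k" using assms unfolding bad_gaps_def by blast
  obtain L where L: "poly_growth k L"
    "\<forall>\<^sub>F M in sequentially. consecutive_diff (word_breaks Q \<beta>) (L M)"
    using assms unfolding bad_gaps_def by blast
  obtain c0 C where c0: "c0 > 0" and ev: "\<forall>\<^sub>F M in sequentially. c0 * real M ^ k \<le> real_of_int (L M)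
      \<and> real_of_int (L M) \<le> C * real M ^ k \<and> L M < L (Suc M)"
    using L(1) unfolding poly_growth_def by blast
  obtain N where N: "\<And>M. M \<ge> N \<Longrightarrow> c0 * real M ^ k \<le> real_of_int (L M)"
    "\<And>M. M \<ge> N \<Longrightarrow> real_of_int (L M) \<le> C * real M ^ k"
    "\<And>M. M \<ge> N \<Longrightarrow> L M < L (Suc M)"
    "\<And>M. M \<ge> N \<Longrightarrow> consecutive_diff (word_breaks Q \<beta>) (L M)"
    using eventually_conj[OF ev L(2)] unfolding eventually_sequentially by blast
  have C: "0 < C"
  proof -
    have "0 < c0 * real (Suc N) ^ k" using c0 by simp
    also have "\<dots> \<le> C * real (Suc N) ^ k" using N(1,2)[of "Suc N"] by linarith
    finally show ?thesis by (simp add: zero_less_mult_iff)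
  qed
  have Lmono: "L M < L M'" if "N \<le> M" "M < M'" for M M'
    using that(2,1)
  proof (induction M' rule: less_Suc_induct)
    case (1 i)
    then show ?case using N(3) by simp
  next
    case (2 i j k)
    then show ?case by simp
  qed
  have "\<forall>M. \<exists>p. M \<ge> N \<longrightarrow> p \<in> word_breaks Q \<beta> \<and> p + nat (L M) \<in> word_breaks Q \<beta> \<and> 0 < L M \<and>
      (\<forall>i\<in>word_breaks Q \<beta>. i \<le> p \<or> p + nat (L M) \<le> i)"
  proof
    fix M
    show "\<exists>p. M \<ge> N \<longrightarrow> p \<in> word_breaks Q \<beta> \<and> p + nat (L M) \<in> word_breaks Q \<beta> \<and> 0 < L M \<and>
      (\<forall>i\<in>word_breaks Q \<beta>. i \<le> p \<or> p + nat (L M) \<le> i)"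
    proof (cases "M \<ge> N")
      case True
      then obtain p q where pq: "p \<in> word_breaks Q \<beta>" "q \<in> word_breaks Q \<beta>" "p < q"
        "int q - int p = L M" "\<forall>i\<in>word_breaks Q \<beta>. i \<le> p \<or> q \<le> i"
        using N(4) unfolding consecutive_diff_def by blast
      then have "q = p + nat (L M)" "0 < L M" by linarith+
      then show ?thesis using pq by blast
    qed simp
  qed
  then obtain p where p: "\<And>M. M \<ge> N \<Longrightarrow> p M \<in> word_breaks Q \<beta>"
    "\<And>M. M \<ge> N \<Longrightarrow> p M + nat (L M) \<in> word_breaks Q \<beta>" "\<And>M. M \<ge> N \<Longrightarrow> 0 < L M"
    "\<And>M i. M \<ge> N \<Longrightarrow> i \<in> word_breaks Q \<beta> \<Longrightarrow> i \<le> p M \<or> p M + nat (L M) \<le> i"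
    by metis
  \<comment> \<open>For \<open>X^k = n / (2 C)\<close> and \<open>M\<close> between
    \<open>X / 2\<close> and \<open>X\<close>, the gap lengths lie between
    \<open>c0 (X / 2)^k = \<epsilon> n\<close> and \<open>C X^k = n / 2\<close>.\<close>
  define \<epsilon> where "\<epsilon> = c0 / (2 ^ k * 2 * C)"
  have \<epsilon>: "0 < \<epsilon>" using c0 C by (simp add: \<epsilon>_def)
  \<comment> \<open>An upper bound for \<open>h div e + 1\<close> when \<open>h \<le> n / 4\<close>
    and \<open>e \<ge> \<epsilon> n\<close>.\<close>
  define K where "K = 1 / (4 * \<epsilon>) + 1"
  have K: "1 \<le> K" using \<epsilon> by (simp add: K_def)
  \<comment> \<open>\<open>X \<ge> Y\<close> gives \<open>X / 2 \<ge> N\<close> and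
    \<open>X / 4 \<ge> 1 + K\<close>: all indices considered are late enough, and of about
    \<open>X / 2\<close> of them at least \<open>X / 4\<close> survive the loss of
    \<open>1 + K\<close>.\<close>
  define Y where "Y = 2 * real N + 4 * (1 + K)"
  \<comment> \<open>The factor \<open>32\<close> comes from at least \<open>X / 4\<close> gaps times
    at least \<open>n / 8\<close> positions; dividing by \<open>K\<close> accounts for the second
    component of the injection.\<close>
  define c where "c = 1 / ((2 * C) powr (1 / real k) * 32 * K)"
  have "c * real n powr (1 + 1 / real k) \<le> real (subword_complexity \<beta> n)"
    if n: "8 \<le> n" "4 * Q + 4 \<le> n" "2 * C * Y ^ k \<le> real n" for n
  proof -
    define X where "X = (real n / (2 * C)) powr (1 / real k)"
    have X0: "0 < real n / (2 * C)" using n(1) C by simp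
    have Xk: "X ^ k = real n / (2 * C)" unfolding X_def using X0 k by (rule power_root_powr)
    have Xpos: "0 < X" using n(1) C by (simp add: X_def)
    have Y0: "0 < Y" using K by (simp add: Y_def)
    have YX: "Y \<le> X"
    proof (rule power_le_imp_le_base)
      show "Y ^ Suc (k - 1) \<le> X ^ Suc (k - 1)" using k n(3) C by (simp add: Xk field_simps)
      show "0 \<le> X" using Xpos by simp
    qed
    define e where "e = nat \<lceil>\<epsilon> * real n\<rceil>"
    have en: "0 < \<epsilon> * real n" using \<epsilon> n(1) by simp
    have e: "0 < e" "\<epsilon> * real n \<le> real e" unfolding e_def using en by (simp_all add: real_nat_ceiling_ge)
    define I where "I = {M. X / 2 \<le> real M \<and> real M \<le> X}"
    have finI: "finite I" by (rule finite_subset[of _ "{..nat \<lfloor>X\<rfloor>}"]) (auto simp: I_def le_nat_floor)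
    have IN: "M \<ge> N" if "M \<in> I" for M
      using that YX K unfolding I_def Y_def by auto
    have Llow: "e \<le> nat (L M)" if "M \<in> I" for M
    proof -
      have "\<epsilon> * real n = c0 * (X / 2) ^ k" using C by (simp add: \<epsilon>_def power_divide Xk)
      also have "\<dots> \<le> c0 * real M ^ k" using that Xpos c0 unfolding I_def
        by (intro mult_left_mono power_mono) auto
      also have "\<dots> \<le> real_of_int (L M)" using N(1) IN[OF that] by blast
      finally show ?thesis unfolding e_def by (simp add: ceiling_le_iff nat_mono)
    qed
    have Lup: "nat (L M) \<le> n div 2" if "M \<in> I" for M
    proof -
      have "real_of_int (L M) \<le> C * real M ^ k" using N(2) IN[OF that] by blast
      also have "\<dots> \<le> C * X ^ k" using that C unfolding I_def by (intro mult_left_mono power_mono) auto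
      also have "\<dots> = real n / 2" using C by (simp add: Xk)
      finally show ?thesis by linarith
    qed
    have injL: "inj_on (\<lambda>M. nat (L M)) I"
    proof (rule inj_onI)
      fix M M' assume M: "M \<in> I" "M' \<in> I" "nat (L M) = nat (L M')"
      then have "L M = L M'" using p(3) IN by (metis nat_eq_iff order_less_imp_le not_less)
      then show "M = M'" using Lmono[of M M'] Lmono[of M' M] IN M(1,2)
        by (metis less_irrefl linorder_neqE_nat)
    qed
    have spaced: "p M + e \<le> p M'" if "M \<in> I" "M' \<in> I" "p M < p M'" for M M'
      using p(4)[OF IN[OF that(1)] p(1)[OF IN[OF that(2)]]] that(3) Llow[OF that(1)] by linarith
    have injp: "inj_on p I"
    proof (rule inj_onI)
      fix M M' assume M: "M \<in> I" "M' \<in> I" "p M = p M'"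
      have "nat (L M) \<le> nat (L M')" if "M \<in> I" "M' \<in> I" "p M = p M'" for M M'
        using p(4)[OF IN[OF that(1)] p(2)[OF IN[OF that(2)]]] p(3)[OF IN[OF that(2)]] that(3) by simp
      then have "nat (L M) = nat (L M')" using M by (metis order_antisym)
      then show "M = M'" using injL M by (auto dest: inj_onD)
    qed
    define h where "h = n div 4"
    \<comment> \<open>Windows start up to \<open>h\<close> letters before the break, so gaps too
      close to the start of \<beta> are dropped. As their breaks are at least \<open>e\<close>
      apart, at most \<open>K\<close> are lost.\<close>
    define J where "J = {M \<in> I. h \<le> p M}"
    have hK: "real (h div e + 1) \<le> K"
    proof -
      have "real (h div e) \<le> real h / real e" by (rule of_nat_div_le_of_nat)
      also have "\<dots> \<le> (real n / 4) / (\<epsilon> * real n)"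
        using e en by (intro frac_le) (auto simp: h_def)
      also have "\<dots> = 1 / (4 * \<epsilon>)" using n(1) by simp
      finally show ?thesis by (simp add: K_def)
    qed
    have "card (I - J) \<le> h div e + 1"
      by (rule card_spaced_le[of _ e p]) (use finI e(1) injp spaced in \<open>auto simp: J_def intro: inj_on_subset\<close>)
    then have "real (card (I - J)) \<le> K" using hK by linarith
    moreover have "card I = card (I - J) + card J"
      using finI by (subst card_Diff_subset) (auto simp: J_def card_mono)
    moreover have "X / 2 - 1 \<le> real (card I)"
    proof -
      have "{nat \<lceil>X / 2\<rceil>..nat \<lfloor>X\<rfloor>} \<subseteq> I" unfolding I_def using Xpos by (auto simp: nat_ceiling_le_eq) linarith+
      then have "card {nat \<lceil>X / 2\<rceil>..nat \<lfloor>X\<rfloor>} \<le> card I" using finI by (intro card_mono)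
      then show ?thesis using Xpos by simp linarith
    qed
    ultimately have "X / 2 - 1 - K \<le> real (card J)" by linarith
    moreover have "1 + K \<le> X / 4" using YX by (simp add: Y_def)
    ultimately have cJ: "X / 4 \<le> real (card J)" by linarith
    have "card J * h \<le> subword_complexity \<beta> n * (h div e + 1)"
    proof (rule windows_around_gaps[of J e "\<lambda>M. nat (L M)" h "n div 2" Q n p \<beta>])
      show "finite J" using finI by (simp add: J_def)
      show "inj_on (\<lambda>M. nat (L M)) J" using injL by (rule inj_on_subset) (auto simp: J_def)
      show "h + n div 2 + Q < n" using n(2) unfolding h_def by linarith
      fix M assume "M \<in> J"
      then have "M \<in> I" "h \<le> p M" by (auto simp: J_def)
      then show "e \<le> nat (L M) \<and> nat (L M) \<le> n div 2 \<and> h \<le> p M \<and> p M \<in> word_breaks Q \<beta> \<and>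
          p M + nat (L M) \<in> word_breaks Q \<beta> \<and>
          (\<forall>i\<in>word_breaks Q \<beta>. i \<le> p M \<or> p M + nat (L M) \<le> i)"
        using Llow Lup p IN by blast
    qed (rule e(1))
    then have "real (card J) * real h \<le> real (subword_complexity \<beta> n) * real (h div e + 1)"
      unfolding of_nat_mult[symmetric] by (rule of_nat_mono)
    also have "\<dots> \<le> real (subword_complexity \<beta> n) * K" using hK by (intro mult_left_mono) auto
    finally have "real (card J) * real h \<le> real (subword_complexity \<beta> n) * K" .
    moreover have "X / 4 * (real n / 8) \<le> real (card J) * real h"
    proof (rule mult_mono[OF cJ])
      show "real n / 8 \<le> real h" unfolding h_def using n(1) by linarith
    qed auto
    ultimately have "X * real n / 32 \<le> real (subword_complexity \<beta> n) * K" by simp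
    then have main: "X * real n / (32 * K) \<le> real (subword_complexity \<beta> n)"
      using K by (simp add: field_simps)
    have "real n powr (1 + 1 / real k) = real n * real n powr (1 / real k)"
      using n(1) by (simp add: powr_add)
    moreover have "X = real n powr (1 / real k) / (2 * C) powr (1 / real k)"
      unfolding X_def using C by (simp add: powr_divide)
    ultimately have "c * real n powr (1 + 1 / real k) = X * real n / (32 * K)"
      by (simp add: c_def mult_ac)
    then show ?thesis using main by simp
  qed
  moreover have "\<forall>\<^sub>F n in sequentially. 8 \<le> n \<and> 4 * Q + 4 \<le> n \<and> 2 * C * Y ^ k \<le> real n"
    using eventually_ge_at_top[of 8] eventually_ge_at_top[of "4 * Q + 4"]
      eventually_ge_at_top[of "nat \<lceil>2 * C * Y ^ k\<rceil>"]
    by eventually_elim (simp add: nat_ceiling_le_eq)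
  ultimately have "\<forall>\<^sub>F n in sequentially. c * real n powr (1 + 1 / real k) \<le> real (subword_complexity \<beta> n)"
    by (auto elim: eventually_mono)
  moreover have "0 < c" using C K by (simp add: c_def)
  ultimately show ?thesis by blast
qed

section \<open>Reduction and the theorem\<close>

lemma bigo_powr_of_level_bound:
  fixes s :: "nat \<Rightarrow> nat"
  assumes c: "0 < c" and k: "1 \<le> k"
    and bound: "\<And>n m. n0 \<le> n \<Longrightarrow> M0 \<le> m \<Longrightarrow> (\<forall>M\<ge>m. real n \<le> c * real M ^ k) \<Longrightarrow> s n \<le> C * (n + 1) * (m + 1)"
  shows "(\<lambda>n. real (s n)) \<in> O(\<lambda>n. real n powr (1 + 1 / real k))"
proof (rule bigoI)
  define D where "D = real M0 + 2 + (1 / c) powr (1 / real k)"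
  show "\<forall>\<^sub>F n in sequentially. norm (real (s n)) \<le> real C * 2 * D * norm (real n powr (1 + 1 / real k))"
    using eventually_ge_at_top[of "max n0 1"]
  proof eventually_elim
    case (elim n)
    define x where "x = (real n / c) powr (1 / real k)"
    \<comment> \<open>\<open>x\<close> solves \<open>c x^k = n\<close>, so all levels from
      \<open>m\<close> on satisfy the hypothesis of \<open>bound\<close>.\<close>
    define m where "m = M0 + nat \<lceil>x\<rceil>"
    have x0: "0 < x" using elim c by (simp add: x_def)
    have "real n \<le> c * real M ^ k" if "m \<le> M" for M
    proof -
      have "x \<le> real M" using that x0 unfolding m_def by linarith
      then have "x ^ k \<le> real M ^ k" using x0 by (intro power_mono) auto
      moreover have "x ^ k = real n / c" unfolding x_def using elim c k by (intro power_root_powr) auto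
      ultimately show ?thesis using c by (simp add: field_simps)
    qed
    then have "s n \<le> C * (n + 1) * (m + 1)" using elim by (intro bound) (auto simp: m_def)
    then have "real (s n) \<le> real (C * (n + 1) * (m + 1))" by (rule of_nat_mono)
    also have "\<dots> = real C * real (n + 1) * real (m + 1)" by (simp only: of_nat_mult)
    also have "\<dots> \<le> real C * (2 * real n) * (D * real n powr (1 / real k))"
    proof (intro mult_mono mult_left_mono)
      show "real (n + 1) \<le> 2 * real n" using elim by simp
      have p1: "1 \<le> real n powr (1 / real k)" using elim by (intro ge_one_powr_ge_zero) auto
      have "real (m + 1) \<le> (real M0 + 2) * 1 + x" using x0 unfolding m_def by simp linarith
      also have "\<dots> \<le> (real M0 + 2) * real n powr (1 / real k) + x"
        using p1 by (intro add_right_mono mult_left_mono) auto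
      also have "x = (1 / c) powr (1 / real k) * real n powr (1 / real k)"
        unfolding x_def using c by (subst powr_mult[symmetric]) auto
      finally show "real (m + 1) \<le> D * real n powr (1 / real k)" by (simp add: D_def algebra_simps)
    qed auto
    also have "\<dots> = real C * 2 * D * real n powr (1 + 1 / real k)"
      using elim by (simp add: powr_add)
    finally show ?case by simp
  qed
qed

lemma bigo_log_of_level_bound:
  fixes s :: "nat \<Rightarrow> nat"
  assumes c: "0 < c"
    and bound: "\<And>n m. n0 \<le> n \<Longrightarrow> M0 \<le> m \<Longrightarrow> (\<forall>M\<ge>m. real n \<le> c * 2 ^ M) \<Longrightarrow> s n \<le> C * (n + 1) * (m + 1)"
  shows "(\<lambda>n. real (s n)) \<in> O(\<lambda>n. real n * ln (real n))"
proof (rule bigoI)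
  define D where "D = real M0 + 2 + (1 + \<bar>ln c\<bar>) / ln 2"
  show "\<forall>\<^sub>F n in sequentially. norm (real (s n)) \<le> real C * 2 * D * norm (real n * ln (real n))"
    using eventually_ge_at_top[of "max n0 3"]
  proof eventually_elim
    case (elim n)
    have ln1: "1 \<le> ln (real n)"
    proof -
      have "exp 1 \<le> real n" using elim exp_le by simp
      then show ?thesis using elim by (subst ln_ge_iff) auto
    qed
    define x where "x = log 2 (real n / c)"
    define m where "m = M0 + nat \<lceil>x\<rceil>"
    have "real n \<le> c * 2 ^ M" if "m \<le> M" for M
    proof -
      have "x \<le> real M" using that unfolding m_def by linarith
      then have "real n / c \<le> 2 powr real M" using elim c unfolding x_def by (subst (asm) log_le_iff) auto
      then show ?thesis using c by (simp add: powr_realpow field_simps)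
    qed
    then have "s n \<le> C * (n + 1) * (m + 1)" using elim by (intro bound) (auto simp: m_def)
    then have "real (s n) \<le> real (C * (n + 1) * (m + 1))" by (rule of_nat_mono)
    also have "\<dots> = real C * real (n + 1) * real (m + 1)" by (simp only: of_nat_mult)
    also have "\<dots> \<le> real C * (2 * real n) * (D * ln (real n))"
    proof (intro mult_mono mult_left_mono)
      show "real (n + 1) \<le> 2 * real n" using elim by simp
      have "x = (ln (real n) - ln c) / ln 2" using elim c by (simp add: x_def log_def ln_div)
      also have "\<dots> \<le> (ln (real n) + \<bar>ln c\<bar> * ln (real n)) / ln 2"
      proof (rule divide_right_mono)
        have "\<bar>ln c\<bar> * 1 \<le> \<bar>ln c\<bar> * ln (real n)" using ln1 by (intro mult_left_mono) auto
        then show "ln (real n) - ln c \<le> ln (real n) + \<bar>ln c\<bar> * ln (real n)" by linarith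
      qed simp
      also have "\<dots> = (1 + \<bar>ln c\<bar>) / ln 2 * ln (real n)" by (simp add: algebra_simps)
      finally have x: "x \<le> (1 + \<bar>ln c\<bar>) / ln 2 * ln (real n)" .
      have y0: "0 \<le> (1 + \<bar>ln c\<bar>) / ln 2 * ln (real n)" using ln1 by (intro mult_nonneg_nonneg) auto
      have "real (m + 1) \<le> (real M0 + 2) * 1 + max 0 x" unfolding m_def by simp linarith
      also have "\<dots> \<le> (real M0 + 2) * ln (real n) + (1 + \<bar>ln c\<bar>) / ln 2 * ln (real n)"
        using ln1 x y0 by (intro add_mono mult_left_mono) auto
      finally show "real (m + 1) \<le> D * ln (real n)" by (simp add: D_def algebra_simps)
    qed auto
    also have "\<dots> = real C * 2 * D * (real n * ln (real n))" by (simp add: algebra_simps)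
    finally show ?case using ln1 by simp
  qed
qed

lemma evpoly_poly_bounded:
  assumes "evpoly (\<lambda>M. int (s M))"
  shows "\<exists>\<kappa>. poly_bounded \<kappa> s"
proof -
  have "evconst (\<lambda>M. int (s M)) \<or> (\<exists>j\<ge>1. poly_growth j (\<lambda>M. int (s M)))"
    using assms by (rule evpoly_nonneg_cases) simp
  then show ?thesis
  proof (elim disjE exE conjE)
    assume "evconst (\<lambda>M. int (s M))"
    then obtain c where "\<forall>\<^sub>F M in sequentially. int (s M) = c" unfolding evconst_def by blast
    then have "\<forall>\<^sub>F M in sequentially. s M \<le> nat c" by eventually_elim simp
    then have "poly_bounded 0 s" by (rule poly_bounded_mono[OF poly_bounded_const])
    then show ?thesis ..
  next
    fix j assume "poly_growth j (\<lambda>M. int (s M))"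
    then have "poly_bounded j s"
      unfolding poly_growth_def poly_bounded_def by (auto elim!: eventually_mono)
    then show ?thesis ..
  qed
qed

lemma poly_bounded_exponent_mono:
  assumes "poly_bounded \<kappa> s" "\<kappa> \<le> \<kappa>'"
  shows "poly_bounded \<kappa>' s"
proof -
  obtain C where C: "C \<ge> 0" "\<forall>\<^sub>F M in sequentially. real (s M) \<le> C * real M ^ \<kappa>"
    using poly_boundedE[OF assms(1)] by blast
  have "\<forall>\<^sub>F M in sequentially. real (s M) \<le> C * real M ^ \<kappa>'"
    using C(2) eventually_ge_at_top[of 1]
  proof eventually_elim
    case (elim M)
    have "C * real M ^ \<kappa> \<le> C * real M ^ \<kappa>'"
      using elim C(1) assms(2) by (intro mult_left_mono power_increasing) auto
    then show ?case using elim by linarith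
  qed
  then show ?thesis unfolding poly_bounded_def by blast
qed

section \<open>Powers of the morphism and the common period\<close>

lemma finite_range_multiples:
  fixes x :: "nat \<Rightarrow> 'b"
  assumes "finite (range x)" and det: "\<And>i j. x i = x j \<Longrightarrow> x (Suc i) = x (Suc j)"
  shows "\<exists>N>0. \<forall>m>0. x (m * N) = x N"
proof -
  have "\<not> inj x" using assms(1) finite_imageD infinite_UNIV_nat by blast
  then obtain i j where ij: "i < j" "x i = x j"
    unfolding inj_def by (metis linorder_neqE_nat)
  define q where "q = j - i"
  have step: "x (i + n + q) = x (i + n)" for n
  proof (induction n)
    case 0
    show ?case using ij by (simp add: q_def)
  next
    case (Suc n)
    then show ?case using det[OF Suc] by simp
  qed
  have steps: "x (i + n + t * q) = x (i + n)" for n t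
  proof (induction t)
    case (Suc t)
    have "i + n + Suc t * q = i + (n + t * q) + q" by simp
    then show ?case using step[of "n + t * q"] Suc by (simp add: add_ac)
  qed simp
  \<comment> \<open>A multiple of the period \<open>q\<close> that is at least the preperiod
    \<open>i\<close>; all its positive multiples then give the same value.\<close>
  define N where "N = q * (i + 1)"
  have q: "q \<ge> 1" using ij by (simp add: q_def)
  have "i \<le> N" using mult_le_mono[OF q, of i "i + 1"] by (simp add: N_def)
  have "x (m * N) = x N" if "m > 0" for m
  proof -
    have "m * N = i + (N - i) + ((m - 1) * (i + 1)) * q"
      using that \<open>i \<le> N\<close> by (cases m) (simp_all add: N_def algebra_simps)
    then show ?thesis using steps[of "N - i" "(m - 1) * (i + 1)"] \<open>i \<le> N\<close> by simp
  qed
  moreover have "N > 0" using q by (simp add: N_def)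
  ultimately show ?thesis by blast
qed

lemma common_multiple:
  fixes P :: "'b::finite \<Rightarrow> nat \<Rightarrow> bool"
  assumes "\<And>b. \<exists>N>0. \<forall>m>0. P b (m * N)"
  shows "\<exists>N>0. \<forall>b. \<forall>m>0. P b (m * N)"
proof -
  obtain N where N: "\<And>b. N b > 0" "\<And>b m. m > 0 \<Longrightarrow> P b (m * N b)" using assms by metis
  have "P b (m * prod N UNIV)" if "m > 0" for b m
  proof -
    have "prod N UNIV = N b * prod N (UNIV - {b})" by (rule prod.remove) auto
    then have "m * prod N UNIV = (m * prod N (UNIV - {b})) * N b" by (simp add: mult_ac)
    moreover have "m * prod N (UNIV - {b}) > 0" using that N(1) by (simp add: prod_pos)
    ultimately show ?thesis using N(2) by metis
  qed
  moreover have "prod N UNIV > 0" using N(1) by (simp add: prod_pos)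
  ultimately show ?thesis by blast
qed

lemma remdups_append_absorb: "set xs \<subseteq> set ys \<Longrightarrow> remdups (xs @ ys) = remdups ys"
  by (induction xs) auto

lemma remdups_append_cong: "remdups ys = remdups zs \<Longrightarrow> remdups (xs @ ys) = remdups (xs @ zs)"
  by (metis remdups_append2)

text \<open>The reduced word of the next iterate depends only on the current reduced word. Reduced
  words thus run through a finite deterministic system, as \<open>finite_range_multiples\<close>
  requires.\<close>

lemma remdups_ext: "remdups (ext f u) = remdups (ext f (remdups u))"
proof (induction u)
  case (Cons b u)
  show ?case
  proof (cases "b \<in> set u")
    case True
    then have "set (f b) \<subseteq> set (ext f u)" by auto
    then show ?thesis using True Cons by (simp add: remdups_append_absorb)
  next
    case False
    then show ?thesis using remdups_append_cong[OF Cons] by simp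
  qed
qed simp

lemma ext_power:
  fixes f :: "'a \<Rightarrow> 'a list"
  shows "ext (\<lambda>b. (ext f ^^ N) [b]) u = (ext f ^^ N) u"
proof (induction u)
  case (Cons b u)
  then show ?case using ext_funpow_append[of N f "[b]" u] by simp
qed simp

lemma ext_power_funpow:
  fixes f :: "'a \<Rightarrow> 'a list"
  shows "(ext (\<lambda>b. (ext f ^^ N) [b]) ^^ M) u = (ext f ^^ (N * M)) u"
proof -
  have "ext (\<lambda>b. (ext f ^^ N) [b]) = ext f ^^ N" using ext_power by blast
  then show ?thesis by (simp add: funpow_mult)
qed

lemma count_list_power:
  fixes f :: "'a \<Rightarrow> 'a list"
  assumes "2 \<le> count_list ((ext f ^^ L) [b]) b" "0 < m"
  shows "2 \<le> count_list ((ext f ^^ (m * L)) [b]) b"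
  using assms(2)
proof (induction m rule: nat_induct_non_zero)
  case 1
  then show ?case using assms(1) by simp
next
  case (Suc m)
  have "2 * 2 \<le> count_list ((ext f ^^ L) [b]) b * count_list ((ext f ^^ (m * L)) [b]) b"
    using assms(1) Suc.IH by (rule mult_le_mono)
  also have "\<dots> \<le> count_list (ext (\<lambda>b. (ext f ^^ L) [b]) ((ext f ^^ (m * L)) [b])) b"
    by (rule count_list_ext)
  also have "\<dots> = count_list ((ext f ^^ (Suc m * L)) [b]) b"
    by (simp add: ext_power funpow_add)
  finally show ?case by simp
qed

lemma funpow_ext_ne:
  fixes f :: "'a \<Rightarrow> 'a list"
  assumes "\<And>b. f b \<noteq> []" "u \<noteq> []"
  shows "(ext f ^^ M) u \<noteq> []"
proof (induction M)
  case (Suc M)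
  then show ?case using length_ext_ge[of f "(ext f ^^ M) u", OF assms(1)] by auto
qed (simp add: assms(2))

text \<open>For each letter the reduced words agree along all positive multiples of some exponent,
  and a letter doubled after \<open>L\<close> steps is doubled after every positive multiple of
  \<open>L\<close>. A common multiple serves all letters.\<close>

lemma letter_morphism_power:
  fixes f g :: "'a::finite \<Rightarrow> 'a list"
  assumes f: "\<And>b. f b \<noteq> []" and g: "\<And>b. g b \<noteq> []"
  shows "\<exists>N>0. letter_morphism (\<lambda>b. (ext f ^^ N) [b]) g"
proof -
  let ?u = "\<lambda>n b. (ext f ^^ n) [b]"
  let ?dbl = "\<lambda>b. \<exists>L. 2 \<le> count_list (?u L b) b"
  have "\<exists>r r'. \<exists>N>0. \<forall>m>0. remdups (?u (m * N) b) = r \<and> remdups (rev (?u (m * N) b)) = r' \<and>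
      (?dbl b \<longrightarrow> 2 \<le> count_list (?u (m * N) b) b)" for b
  proof -
    let ?x = "\<lambda>n. (remdups (?u n b), remdups (rev (?u n b)))"
    have len: "length (remdups xs) \<le> card (UNIV :: 'a set)" for xs :: "'a list"
      by (metis distinct_card distinct_remdups card_mono finite_class.finite_UNIV top_greatest)
    have "range ?x \<subseteq> {xs. length xs \<le> card (UNIV :: 'a set)} \<times> {xs. length xs \<le> card (UNIV :: 'a set)}"
      using len by auto
    then have fin: "finite (range ?x)"
      by (rule finite_subset) (intro finite_cartesian_product finite_lists_le)
    have det: "?x (Suc i) = ?x (Suc j)" if eq: "?x i = ?x j" for i j
    proof -
      have "remdups (ext f (?u i b)) = remdups (ext f (?u j b))"
        using eq remdups_ext[of f "?u i b"] remdups_ext[of f "?u j b"] by simp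
      moreover have "remdups (rev (ext f (?u i b))) = remdups (rev (ext f (?u j b)))"
        using eq remdups_ext[of "\<lambda>b. rev (f b)" "rev (?u i b)"]
          remdups_ext[of "\<lambda>b. rev (f b)" "rev (?u j b)"] by (simp add: rev_ext)
      ultimately show ?thesis by simp
    qed
    obtain N where N: "N > 0" "\<And>m. m > 0 \<Longrightarrow> ?x (m * N) = ?x N"
      using finite_range_multiples[OF fin det] by blast
    obtain L where L: "L > 0" "?dbl b \<longrightarrow> 2 \<le> count_list (?u L b) b"
    proof (cases "?dbl b")
      case True
      then obtain L where L: "2 \<le> count_list (?u L b) b" by blast
      then have "L \<noteq> 0" by (auto split: if_splits intro: ccontr)
      then show ?thesis using that L by blast
    qed (use that[of 1] in simp)
    show ?thesis
    proof (rule exI[of _ "remdups (?u N b)"], rule exI[of _ "remdups (rev (?u N b))"],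
        rule exI[of _ "N * L"], intro conjI allI impI)
      fix m :: nat assume m: "m > 0"
      have "?x (m * (N * L)) = ?x N" using N(2)[of "m * L"] m L(1) by (simp add: mult_ac)
      then show "remdups (?u (m * (N * L)) b) = remdups (?u N b)"
        "remdups (rev (?u (m * (N * L)) b)) = remdups (rev (?u N b))" by simp_all
      assume "?dbl b"
      then show "2 \<le> count_list (?u (m * (N * L)) b) b"
        using count_list_power[of L f b "m * N"] L(2) m N(1) by (simp add: mult_ac)
    qed (use N L in simp)
  qed
  then obtain r r' where rr: "\<And>b. \<exists>N>0. \<forall>m>0. remdups (?u (m * N) b) = r b \<and>
      remdups (rev (?u (m * N) b)) = r' b \<and> (?dbl b \<longrightarrow> 2 \<le> count_list (?u (m * N) b) b)"
    by metis
  obtain N where N: "N > 0" "\<And>b m. m > 0 \<Longrightarrow> remdups (?u (m * N) b) = r b \<and>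
      remdups (rev (?u (m * N) b)) = r' b \<and> (?dbl b \<longrightarrow> 2 \<le> count_list (?u (m * N) b) b)"
    using common_multiple[of "\<lambda>b n. remdups (?u n b) = r b \<and> remdups (rev (?u n b)) = r' b \<and>
      (?dbl b \<longrightarrow> 2 \<le> count_list (?u n b) b)", OF rr] by blast
  have two: "ext (?u N) (?u N b) = ?u (2 * N) b" for b
    by (simp add: ext_power mult_2 funpow_add)
  have "letter_morphism (?u N) g"
  proof
    show "?u N b \<noteq> []" for b using f by (intro funpow_ext_ne) auto
    show "g b \<noteq> []" for b by (rule g)
    show "2 \<le> count_list (?u N b) b" if "2 \<le> count_list ((ext (?u N) ^^ L) [b]) b" for L b
    proof -
      have "?dbl b" using that unfolding ext_power_funpow by blast
      then show ?thesis using N(2)[of 1 b] by simp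
    qed
    show "remdups (ext (?u N) (?u N b)) = remdups (?u N b)" for b
      unfolding two using N(2)[of 1 b] N(2)[of 2 b] by simp
    show "remdups (rev (ext (?u N) (?u N b))) = remdups (rev (?u N b))" for b
      unfolding two using N(2)[of 1 b] N(2)[of 2 b] by simp
  qed
  then show ?thesis using N(1) by blast
qed

text \<open>The words \<open>f b\<close> have finitely many factors, and each has at most one
  eventual image, so the product of the lengths of these images is a suitable
  \<open>Q\<close>.\<close>

lemma common_period:
  fixes f g :: "'a::finite \<Rightarrow> 'a list"
  shows "\<exists>Q>0. \<forall>t b x. sublist t (f b) \<longrightarrow> (\<forall>\<^sub>F i in sequentially. img f g i t = x) \<longrightarrow>
    x \<noteq> [] \<longrightarrow> length x dvd Q"
proof -
  let ?lim = "\<lambda>t x. \<forall>\<^sub>F i in sequentially. img f g i t = x"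
  define X where "X = {x. x \<noteq> [] \<and> (\<exists>t b. sublist t (f b) \<and> ?lim t x)}"
  have uniq: "x = y" if "?lim t x" "?lim t y" for t x y
  proof -
    from that have "\<forall>\<^sub>F i::nat in sequentially. x = y" by eventually_elim simp
    then show ?thesis by simp
  qed
  have "X \<subseteq> (\<lambda>t. THE x. ?lim t x) ` (\<Union>b. set (sublists (f b)))"
  proof
    fix x assume "x \<in> X"
    then obtain t b where t: "sublist t (f b)" "?lim t x" unfolding X_def by blast
    have "x = (THE x. ?lim t x)" using t(2) uniq by (intro the_equality[symmetric]) blast+
    moreover have "t \<in> (\<Union>b. set (sublists (f b)))" using t(1) by (auto simp: set_sublists_eq)
    ultimately show "x \<in> (\<lambda>t. THE x. ?lim t x) ` (\<Union>b. set (sublists (f b)))" by blast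
  qed
  then have fin: "finite X" by (rule finite_subset) simp
  have "prod length X > 0" unfolding X_def by (intro prod_pos) auto
  moreover have "length x dvd prod length X" if "x \<in> X" for x using fin that by (rule dvd_prodI)
  ultimately show ?thesis unfolding X_def by blast
qed

lemma consecutive_diff_word_breaks:
  assumes "sublist w v" and pre: "\<And>i. i < length v \<Longrightarrow> v ! i = \<beta> i"
    and "consecutive_diff (breaks Q w) L"
  shows "consecutive_diff (word_breaks Q \<beta>) L"
proof -
  have iff: "d \<in> breaks Q v \<longleftrightarrow> d + Q < length v \<and> d \<in> word_breaks Q \<beta>" for d
    using pre by (auto simp: breaks_def word_breaks_def)
  obtain p q where pq: "p \<in> breaks Q v" "q \<in> breaks Q v" "p < q" "int q - int p = L"
    "\<forall>i\<in>breaks Q v. i \<le> p \<or> q \<le> i"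
    using consecutive_diff_sublist[OF assms(1,3)] unfolding consecutive_diff_def by blast
  have "i \<le> p \<or> q \<le> i" if "i \<in> word_breaks Q \<beta>" for i
    using that pq(2,5) iff[of i] iff[of q] by (cases "i < q") auto
  then show ?thesis unfolding consecutive_diff_def using pq iff by blast
qed

text \<open>If \<open>x\<close> occurs in an iterate of \<open>a\<close>, the gaps also occur in
  \<beta>, so a growing family would be bad with an exponent at most \<kappa>. Any other letter is a
  fixed point, whose image has constant length and no growing gaps.\<close>

lemma no_gap_of_not_bad:
  fixes f g :: "'a \<Rightarrow> 'a list" and \<beta> :: "'a word"
  assumes pre: "\<And>M i. i < length (img f g M [a]) \<Longrightarrow> img f g M [a] ! i = \<beta> i"
    and reach: "\<And>x. f x = [x] \<or> (\<exists>M. x \<in> set ((ext f ^^ M) [a]))"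
    and good: "\<And>j. j \<le> \<kappa> \<Longrightarrow> \<not> bad_gaps Q \<beta> j"
    and L: "evpoly L" "\<forall>\<^sub>F M in sequentially. consecutive_diff (breaks Q (img f g (M + j) [x])) (L M)"
      "poly_bounded \<kappa> (\<lambda>M. nat (L M))"
  shows "evconst L"
proof (rule ccontr)
  assume nc: "\<not> evconst L"
  have pos: "\<forall>\<^sub>F M in sequentially. L M \<ge> 0"
    using L(2) by eventually_elim (auto simp: consecutive_diff_def)
  then obtain i where i: "i \<ge> 1" "poly_growth i L"
    using evpoly_nonneg_cases[OF L(1)] nc by blast
  show False
  proof (cases "f x = [x]")
    case True
    have "(ext f ^^ M) [x] = [x]" for M by (induction M) (auto simp: True)
    then have W: "img f g M [x] = g x" for M by (simp add: img_def)
    from L(2) poly_growth_at_top[OF i(2,1), of "int (length (g x)) + 1"]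
    have "\<forall>\<^sub>F M::nat in sequentially. False"
      by eventually_elim (auto simp: consecutive_diff_def breaks_def W)
    then show False by simp
  next
    case False
    then obtain M1 where M1: "x \<in> set ((ext f ^^ M1) [a])" using reach by blast
    then have "sublist [x] ((ext f ^^ M1) [a])" by (auto simp: sublist_def dest: split_list)
    then have sub: "sublist (img f g m [x]) (img f g (m + M1) [a])" for m
      unfolding img_add by (rule img_sublist)
    have "\<forall>\<^sub>F M in sequentially. consecutive_diff (word_breaks Q \<beta>) (L M)"
      using L(2) by eventually_elim (rule consecutive_diff_word_breaks[OF sub pre])
    then have "bad_gaps Q \<beta> i" unfolding bad_gaps_def using i by blast
    moreover have "i \<le> \<kappa>"
    proof -
      obtain C where C: "\<forall>\<^sub>F M in sequentially. real (nat (L M)) \<le> C * real M ^ \<kappa>"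
        using L(3) unfolding poly_bounded_def by blast
      have "\<forall>\<^sub>F M in sequentially. real_of_int (L M) \<le> C * real M ^ \<kappa>"
        using C pos by eventually_elim simp
      then show ?thesis by (rule not_poly_growth_bounded[OF i(2)])
    qed
    ultimately show False using good by blast
  qed
qed

section \<open>The two scales and the dichotomy\<close>

context letter_morphism
begin

lemma evpoly_sum_img:
  assumes "\<forall>b\<in>set t. polynomial b"
  shows "evpoly (\<lambda>M. int (\<Sum>i<M. length (W i t)))"
proof -
  have "tame (\<lambda>M. W M t)" by (rule tame_word) (use assms polynomial_tame in blast)
  then have "tame (iconcat (\<lambda>i. W i t))" by (rule tame_iconcat)
  then show ?thesis unfolding tame_def length_iconcat by blast
qed

lemma not_polynomial_large:
  assumes "\<not> polynomial b"
  shows "large (\<lambda>M. 2 ^ M) (\<lambda>M. length (W M [b]))"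
proof -
  have "1 / 2 * 2 ^ M \<le> real (length (W M [b]))" for M
  proof -
    have "real (2 ^ M) \<le> real (2 * length (W M [b]))"
      using not_polynomial_exponential[OF assms] by (rule of_nat_mono)
    then show ?thesis by simp
  qed
  then show ?thesis unfolding large_def by (intro exI[of _ "1 / 2"]) simp
qed

lemma large_mono_scale:
  assumes "large \<sigma> s" "\<forall>\<^sub>F M in sequentially. \<tau> M \<le> \<sigma> M"
  shows "large \<tau> s"
proof -
  obtain c where c: "c > 0" "\<forall>\<^sub>F M in sequentially. c * \<sigma> M \<le> real (s M)"
    using assms(1) unfolding large_def by blast
  have "\<forall>\<^sub>F M in sequentially. c * \<tau> M \<le> real (s M)"
    using c(2) assms(2)
  proof eventually_elim
    case (elim M)
    have "c * \<tau> M \<le> c * \<sigma> M" using c(1) elim(2) by (intro mult_left_mono) auto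
    then show ?case using elim(1) by linarith
  qed
  then show ?thesis unfolding large_def using c(1) by blast
qed

text \<open>For polynomial letters the alternative between small and large is the integrality of
  exponents; all other letters grow exponentially and exceed
  \<open>M^(\<kappa> + 1)\<close>.\<close>

lemma scaled_morphism_polynomial:
  assumes "0 < Q"
    and "\<And>t b x. sublist t (f b) \<Longrightarrow> \<forall>\<^sub>F i in sequentially. W i t = x \<Longrightarrow> x \<noteq> [] \<Longrightarrow> length x dvd Q"
    and "\<And>L j x. evpoly L \<Longrightarrow>
      \<forall>\<^sub>F M in sequentially. consecutive_diff (breaks Q (W (M + j) [x])) (L M) \<Longrightarrow>
      poly_bounded \<kappa> (\<lambda>M. nat (L M)) \<Longrightarrow> evconst L"
  shows "scaled_morphism f g Q \<kappa> (\<lambda>M. real M ^ Suc \<kappa>)"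
proof (intro scaled_morphism.intro letter_morphism_axioms scaled_morphism_axioms.intro)
  have cases: "poly_bounded \<kappa> s \<or> large (\<lambda>M. real M ^ Suc \<kappa>) s" if "evpoly (\<lambda>M. int (s M))" for s
    using evpoly_nonneg_bound_or_large[OF that, of \<kappa>] unfolding poly_bounded_def large_def by simp
  show "\<forall>\<^sub>F M in sequentially. C * real M ^ \<kappa> \<le> real M ^ Suc \<kappa>" for C
    using eventually_ge_at_top[of "nat \<lceil>C\<rceil>"]
  proof eventually_elim
    case (elim M)
    then have "C \<le> real M" by (simp add: nat_ceiling_le_eq)
    then have "C * real M ^ \<kappa> \<le> real M * real M ^ \<kappa>" by (intro mult_right_mono) auto
    then show ?case by simp
  qed
  show "large (\<lambda>M. real M ^ Suc \<kappa>) (\<lambda>M. length (W M [b]))"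
    if "\<not> poly_bounded \<kappa> (\<lambda>M. length (W M [b]))" for b
  proof (cases "polynomial b")
    case True
    then have "evpoly (\<lambda>M. int (length (W M [b])))" using polynomial_tame unfolding tame_def by blast
    then show ?thesis using cases[of "\<lambda>M. length (W M [b])"] that by blast
  next
    case False
    have "\<forall>\<^sub>F M in sequentially. 1 * real M ^ Suc \<kappa> \<le> 2 ^ M" by (rule power_le_exponential)
    then show ?thesis by (intro large_mono_scale[OF not_polynomial_large[OF False]]) simp
  qed
  show "poly_bounded \<kappa> (\<lambda>M. \<Sum>i<M. length (W i t)) \<or>
      large (\<lambda>M. real M ^ Suc \<kappa>) (\<lambda>M. \<Sum>i<M. length (W i t))"
    if "\<forall>b\<in>set t. poly_bounded \<kappa> (\<lambda>M. length (W M [b]))" for t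
    using that poly_bounded_polynomial by (intro cases evpoly_sum_img) blast
qed (use assms in blast)+

lemma degree_bound:
  "\<exists>\<kappa>. \<forall>b. polynomial b \<longrightarrow> poly_bounded \<kappa> (\<lambda>M. \<Sum>i<M. length (W i [b]))"
proof -
  have "\<exists>\<kappa>. polynomial b \<longrightarrow> poly_bounded \<kappa> (\<lambda>M. \<Sum>i<M. length (W i [b]))" for b
    using evpoly_poly_bounded[OF evpoly_sum_img[of "[b]"]] by auto
  then obtain \<kappa> where \<kappa>: "\<And>b. polynomial b \<Longrightarrow> poly_bounded (\<kappa> b) (\<lambda>M. \<Sum>i<M. length (W i [b]))"
    by metis
  have "\<kappa> b \<le> sum \<kappa> UNIV" for b by (rule member_le_sum) auto
  then show ?thesis using \<kappa> poly_bounded_exponent_mono by blast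
qed

text \<open>With \<kappa> from \<open>degree_bound\<close>, every polynomial letter is small and so
  are the sums over words of such letters. All remaining letters reach the scale \<open>2^M\<close>.
  This needs \<open>no_gap\<close> for every exponent.\<close>

lemma scaled_morphism_exponential:
  assumes "0 < Q"
    and "\<And>t b x. sublist t (f b) \<Longrightarrow> \<forall>\<^sub>F i in sequentially. W i t = x \<Longrightarrow> x \<noteq> [] \<Longrightarrow> length x dvd Q"
    and "\<And>L j x \<kappa>. evpoly L \<Longrightarrow>
      \<forall>\<^sub>F M in sequentially. consecutive_diff (breaks Q (W (M + j) [x])) (L M) \<Longrightarrow>
      poly_bounded \<kappa> (\<lambda>M. nat (L M)) \<Longrightarrow> evconst L"
  shows "\<exists>\<kappa>. scaled_morphism f g Q \<kappa> (\<lambda>M. 2 ^ M)"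
proof -
  obtain \<kappa> where \<kappa>: "\<And>b. polynomial b \<Longrightarrow> poly_bounded \<kappa> (\<lambda>M. \<Sum>i<M. length (W i [b]))"
    using degree_bound by blast
  have "scaled_morphism f g Q \<kappa> (\<lambda>M. 2 ^ M)"
  proof (intro scaled_morphism.intro letter_morphism_axioms scaled_morphism_axioms.intro)
    show "\<forall>\<^sub>F M in sequentially. C * real M ^ \<kappa> \<le> 2 ^ M" for C by (rule power_le_exponential)
    show "large (\<lambda>M. 2 ^ M) (\<lambda>M. length (W M [b]))"
      if "\<not> poly_bounded \<kappa> (\<lambda>M. length (W M [b]))" for b
    proof (rule not_polynomial_large, rule notI)
      assume "polynomial b"
      from poly_bounded_Suc[OF \<kappa>[OF this]] have "poly_bounded \<kappa> (\<lambda>M. length (W M [b]))"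
        by (rule poly_bounded_mono) simp
      with that show False ..
    qed
    have sums: "poly_bounded \<kappa> (\<lambda>M. \<Sum>i<M. length (W i t))" if "\<forall>b\<in>set t. polynomial b" for t
      using that
    proof (induction t)
      case Nil
      show ?case using poly_bounded_const[of \<kappa> 0] by simp
    next
      case (Cons b t)
      then have "poly_bounded \<kappa> (\<lambda>M. (\<Sum>i<M. length (W i [b])) + (\<Sum>i<M. length (W i t)))"
        using \<kappa> by (intro poly_bounded_add) auto
      then show ?case by (simp add: img_Cons[of f g _ b t] sum.distrib)
    qed
    show "poly_bounded \<kappa> (\<lambda>M. \<Sum>i<M. length (W i t)) \<or> large (\<lambda>M. 2 ^ M) (\<lambda>M. \<Sum>i<M. length (W i t))"
      if "\<forall>b\<in>set t. poly_bounded \<kappa> (\<lambda>M. length (W M [b]))" for t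
      using sums[of t] that poly_bounded_polynomial by blast
  qed (use assms in blast)+
  then show ?thesis ..
qed

lemma complexity_dichotomy:
  fixes \<beta> :: "'a word"
  assumes pre: "\<And>M i. i < length (W M [a]) \<Longrightarrow> W M [a] ! i = \<beta> i"
    and len: "\<And>N. \<exists>M. N \<le> length (W M [a])"
    and reach: "\<And>x. f x = [x] \<or> (\<exists>M. x \<in> set ((ext f ^^ M) [a]))"
  shows "(\<exists>k::nat. k \<ge> 1 \<and>
            (\<lambda>n. real (subword_complexity \<beta> n)) \<in> \<Theta>(\<lambda>n. real n powr (1 + 1 / real k)))
       \<or> (\<lambda>n. real (subword_complexity \<beta> n)) \<in> O(\<lambda>n. real n * ln (real n))"
proof -
  obtain Q where Q: "Q > 0" "\<And>t b x. sublist t (f b) \<Longrightarrow> \<forall>\<^sub>F i in sequentially. W i t = x \<Longrightarrow>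
      x \<noteq> [] \<Longrightarrow> length x dvd Q"
    using common_period[of f g] by blast
  show ?thesis
  proof (cases "\<exists>k. bad_gaps Q \<beta> k")
    case True
    define k where "k = (LEAST k. bad_gaps Q \<beta> k)"
    have k: "bad_gaps Q \<beta> k" unfolding k_def using True by (auto intro: LeastI_ex)
    then have k1: "k \<ge> 1" unfolding bad_gaps_def by blast
    \<comment> \<open>Minimality of \<open>k\<close> excludes bad gaps with exponent up to \<kappa>,
      which the upper bound needs, while the bad gaps of exponent \<open>k\<close> give the matching
      lower bound.\<close>
    define \<kappa> where "\<kappa> = k - 1"
    have k\<kappa>: "k = Suc \<kappa>" using k1 by (simp add: \<kappa>_def)
    have good: "\<not> bad_gaps Q \<beta> j" if "j \<le> \<kappa>" for j
      using not_less_Least[of j "bad_gaps Q \<beta>"] that k1 unfolding k_def[symmetric] \<kappa>_def by auto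
    interpret scaled_morphism f g Q \<kappa> "\<lambda>M. real M ^ Suc \<kappa>"
      by (rule scaled_morphism_polynomial[OF Q], assumption+)
         (rule no_gap_of_not_bad[OF pre reach good])
    obtain C M0 c n0 where "0 < c" "\<forall>n\<ge>n0. \<forall>m\<ge>M0. (\<forall>M\<ge>m. real n \<le> c * real M ^ Suc \<kappa>) \<longrightarrow>
        subword_complexity \<beta> n \<le> C * (n + 1) * (m + 1)"
      using complexity_upper_bound[OF pre len] by blast
    then have "(\<lambda>n. real (subword_complexity \<beta> n)) \<in> O(\<lambda>n. real n powr (1 + 1 / real k))"
      using k1 unfolding k\<kappa>
      by (intro bigo_powr_of_level_bound[of c "Suc \<kappa>" n0 M0 "subword_complexity \<beta>" C]) auto
    moreover have "(\<lambda>n. real (subword_complexity \<beta> n)) \<in> \<Omega>(\<lambda>n. real n powr (1 + 1 / real k))"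
    proof -
      obtain c where c: "c > 0" "\<forall>\<^sub>F n in sequentially.
          c * real n powr (1 + 1 / real k) \<le> real (subword_complexity \<beta> n)"
        using bad_gaps_lower_bound[OF k] by blast
      show ?thesis by (rule landau_omega.bigI[OF c(1)]) (use c(2) in simp)
    qed
    ultimately show ?thesis using k1 by (auto simp: bigthetaI)
  next
    case False
    then have good: "\<not> bad_gaps Q \<beta> j" for j by blast
    obtain \<kappa> where "scaled_morphism f g Q \<kappa> (\<lambda>M. 2 ^ M)"
    proof -
      have "\<exists>\<kappa>. scaled_morphism f g Q \<kappa> (\<lambda>M. 2 ^ M)"
        by (rule scaled_morphism_exponential[OF Q], assumption+)
           (rule no_gap_of_not_bad[OF pre reach good])
      then show ?thesis using that by blast
    qed
    then interpret scaled_morphism f g Q \<kappa> "\<lambda>M. 2 ^ M" .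
    obtain C M0 c n0 where "0 < c" "\<forall>n\<ge>n0. \<forall>m\<ge>M0. (\<forall>M\<ge>m. real n \<le> c * 2 ^ M) \<longrightarrow>
        subword_complexity \<beta> n \<le> C * (n + 1) * (m + 1)"
      using complexity_upper_bound[OF pre len] by blast
    then have "(\<lambda>n. real (subword_complexity \<beta> n)) \<in> O(\<lambda>n. real n * ln (real n))"
      by (intro bigo_log_of_level_bound[of c n0 M0 "subword_complexity \<beta>" C]) auto
    then show ?thesis ..
  qed
qed

end

section \<open>Vanishing letters and the final assembly\<close>

lemma word_morphism_eq_ext:
  fixes \<phi> :: "'a list \<Rightarrow> 'a list"
  assumes "word_morphism \<phi>"
  shows "\<phi> = ext (\<lambda>b. \<phi> [b])"
proof
  fix u
  have app: "\<phi> (u @ v) = \<phi> u @ \<phi> v" for u v using assms unfolding word_morphism_def by blast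
  show "\<phi> u = ext (\<lambda>b. \<phi> [b]) u"
  proof (induction u)
    case Nil
    show ?case using app[of "[]" "[]"] by simp
  next
    case (Cons b u)
    then show ?case using app[of "[b]" u] by simp
  qed
qed

lemma ext_funpow_set_Nil:
  fixes F :: "'a \<Rightarrow> 'a list"
  assumes "(ext F ^^ n) u = []" "c \<in> set u"
  shows "(ext F ^^ n) [c] = []"
proof -
  obtain x y where "u = x @ [c] @ y" using assms(2) by (metis append_Cons append_Nil split_list)
  then show ?thesis using assms(1) ext_funpow_append[of n F "[c]" y] by simp
qed

lemma ext_funpow_Nil_mono:
  fixes F :: "'a \<Rightarrow> 'a list"
  assumes "(ext F ^^ n) u = []" "n \<le> m"
  shows "(ext F ^^ m) u = []"
proof -
  have "(ext F ^^ m) u = (ext F ^^ (m - n)) ((ext F ^^ n) u)"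
    using assms(2) by (metis comp_apply funpow_add le_add_diff_inverse2)
  then show ?thesis using assms(1) by simp
qed

lemma ext_cong: "(\<And>b. b \<in> set u \<Longrightarrow> f b = g b) \<Longrightarrow> ext f u = ext g u"
  by (induction u) auto

text \<open>Letters all of whose sufficiently late images are empty are deleted; the images of the other
  letters under a late power of the morphism, composed with the coding, recover what was deleted.
  Letters that do not occur are turned into fixed points.\<close>

lemma nonerasing_reduction:
  fixes F :: "'a::finite \<Rightarrow> 'a list" and h :: "'a \<Rightarrow> 'a"
  assumes a: "F a = a # \<gamma>" and ne: "\<And>n. (ext F ^^ n) [a] \<noteq> []"
  shows "\<exists>f g \<gamma>' N. (\<forall>b. f b \<noteq> []) \<and> (\<forall>b. g b \<noteq> []) \<and> f a = a # \<gamma>' \<and>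
    (\<forall>x. f x = [x] \<or> (\<exists>M. x \<in> set ((ext f ^^ M) [a]))) \<and>
    (\<forall>M. img f g M [a] = map h ((ext F ^^ (M + N)) [a]))"
proof -
  define live where "live = (\<lambda>b. \<forall>n. (ext F ^^ n) [b] \<noteq> [])"
  have "\<forall>b. \<exists>n. \<not> live b \<longrightarrow> (ext F ^^ n) [b] = []" unfolding live_def by blast
  then obtain n where n: "\<And>b. \<not> live b \<Longrightarrow> (ext F ^^ n b) [b] = []" by metis
  \<comment> \<open>An exponent that exceeds the lifetime of every vanishing letter.\<close>
  define N where "N = sum n UNIV"
  have "n b \<le> N" for b unfolding N_def by (rule member_le_sum) auto
  then have N: "(ext F ^^ N) [b] = []" if "\<not> live b" for b
    using ext_funpow_Nil_mono[OF n[OF that]] by blast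
  have dead: "\<not> live c" if nb: "\<not> live b" and c: "c \<in> set (F b)" for b c
  proof -
    obtain m where m: "(ext F ^^ m) [b] = []" using nb unfolding live_def by blast
    then have "m \<noteq> 0" by (auto intro: ccontr)
    then obtain k where "m = Suc k" by (cases m) auto
    then have "(ext F ^^ k) (F b) = []" using m by (simp add: funpow_swap1)
    then show ?thesis using ext_funpow_set_Nil[OF _ c] unfolding live_def by blast
  qed
  have liveD: "\<exists>c\<in>set (F b). live c" if "live b" for b
  proof (rule ccontr)
    assume "\<not> (\<exists>c\<in>set (F b). live c)"
    then have "\<forall>c\<in>set u. (ext F ^^ N) [c] = [] \<Longrightarrow> (ext F ^^ N) u = []" for u
    proof (induction u)
      case (Cons c u)
      then show ?case using ext_funpow_append[of N F "[c]" u] by simp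
    qed simp
    then have "(ext F ^^ N) (F b) = []" using N \<open>\<not> (\<exists>c\<in>set (F b). live c)\<close> by blast
    then have "(ext F ^^ Suc N) [b] = []" by (simp add: funpow_swap1)
    then show False using that unfolding live_def by blast
  qed
  define f0 where "f0 = (\<lambda>b. filter live (F b))"
  define g0 where "g0 = (\<lambda>b. map h ((ext F ^^ N) [b]))"
  have f0: "ext f0 (filter live u) = filter live (ext F u)" for u
  proof (induction u)
    case (Cons b u)
    have "filter live (F b) = []" if "\<not> live b" using dead[OF that] by (auto simp: filter_empty_conv)
    then show ?case using Cons by (auto simp: f0_def)
  qed simp
  have f0M: "(ext f0 ^^ M) (filter live u) = filter live ((ext F ^^ M) u)" for M u
    by (induction M) (auto simp: f0)
  have g0: "ext g0 (filter live u) = map h ((ext F ^^ N) u)" for u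
  proof (induction u)
    case (Cons b u)
    then show ?case using N[of b] ext_funpow_append[of N F "[b]" u] by (auto simp: g0_def)
  qed simp
  have la: "live a" using ne unfolding live_def by blast
  have img0: "img f0 g0 M [a] = map h ((ext F ^^ (M + N)) [a])" for M
  proof -
    have "img f0 g0 M [a] = ext g0 (filter live ((ext F ^^ M) [a]))"
      using f0M[of M "[a]"] la by (simp add: img_def)
    then show ?thesis by (simp add: g0 funpow_add add.commute[of M N])
  qed
  define A where "A = {x. \<exists>M. x \<in> set ((ext f0 ^^ M) [a])}"
  have A_live: "live x" if x: "x \<in> A" for x
  proof -
    obtain M where "x \<in> set ((ext f0 ^^ M) [a])" using x unfolding A_def by blast
    then have "x \<in> set ((ext f0 ^^ M) (filter live [a]))" using la by simp
    then show ?thesis unfolding f0M by simp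
  qed
  define f where "f = (\<lambda>b. if b \<in> A then f0 b else [b])"
  define g where "g = (\<lambda>b. if b \<in> A then g0 b else [b])"
  have sub: "set ((ext f0 ^^ M) [a]) \<subseteq> A" for M unfolding A_def by blast
  have fM: "(ext f ^^ M) [a] = (ext f0 ^^ M) [a]" for M
  proof (induction M)
    case (Suc M)
    have "ext f ((ext f0 ^^ M) [a]) = ext f0 ((ext f0 ^^ M) [a])"
      using sub by (intro ext_cong) (auto simp: f_def)
    then show ?case using Suc by simp
  qed simp
  have img: "img f g M [a] = map h ((ext F ^^ (M + N)) [a])" for M
  proof -
    have "ext g ((ext f0 ^^ M) [a]) = ext g0 ((ext f0 ^^ M) [a])"
      using sub by (intro ext_cong) (auto simp: g_def)
    then show ?thesis using img0[of M] by (simp add: img_def fM)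
  qed
  have "f b \<noteq> []" for b using liveD[OF A_live] by (auto simp: f_def f0_def filter_empty_conv)
  moreover have "g b \<noteq> []" for b using A_live by (auto simp: g_def g0_def live_def)
  moreover have "f a = a # filter live \<gamma>"
  proof -
    have "a \<in> A" unfolding A_def by (intro CollectI exI[of _ 0]) simp
    then show ?thesis using a la by (simp add: f_def f0_def)
  qed
  moreover have "f x = [x] \<or> (\<exists>M. x \<in> set ((ext f ^^ M) [a]))" for x
  proof (cases "x \<in> A")
    case True
    then show ?thesis unfolding fM A_def by blast
  qed (simp add: f_def)
  ultimately show ?thesis using img by blast
qed

theorem theorem1:
  fixes \<phi> \<psi> :: "'a::finite list \<Rightarrow> 'a list" and a :: 'a and \<gamma> :: "'a list"
    and \<alpha> \<beta> :: "'a word"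
  assumes "word_morphism \<phi>"
    and "\<phi> [a] = a # \<gamma>"
    and "\<And>n. (\<phi> ^^ n) \<gamma> \<noteq> []"
    and "\<alpha> = pure_morphic \<phi> a"
    and "coding \<psi>"
    and "\<beta> = image_word \<psi> \<alpha>"
  shows "(\<exists>k::nat. k \<ge> 1 \<and>
            (\<lambda>n. real (subword_complexity \<beta> n)) \<in> \<Theta>(\<lambda>n. real n powr (1 + 1 / real k)))
       \<or> (\<lambda>n. real (subword_complexity \<beta> n)) \<in> O(\<lambda>n. real n * ln (real n))"
proof -
  define F where "F = (\<lambda>b. \<phi> [b])"
  define h where "h = (\<lambda>b. hd (\<psi> [b]))"
  have \<phi>: "\<phi> = ext F" unfolding F_def using assms(1) by (rule word_morphism_eq_ext)
  let ?v = "\<lambda>n. (ext F ^^ n) [a]"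
  have conv: "words_converge ?v \<alpha>"
    using words_converge_pure_morphic[OF assms(1-3)] assms(4) unfolding \<phi> by simp
  have step: "?v (Suc n) = ?v n @ (ext F ^^ n) \<gamma>" for n
    using morphic_iterate_Suc[OF assms(1,2)] unfolding \<phi> .
  have mono: "\<exists>y. ?v (n + d) = ?v n @ y" for n d
  proof (induction d)
    case (Suc d)
    then show ?case using step[of "n + d"] by (metis add_Suc_right append.assoc)
  qed simp
  have pre\<alpha>: "?v n ! i = \<alpha> i" if "i < length (?v n)" for n i
  proof -
    obtain m where m: "\<And>k. k \<ge> m \<Longrightarrow> i < length (?v k) \<and> ?v k ! i = \<alpha> i"
      using conv unfolding words_converge_def eventually_sequentially by blast
    obtain y where "?v (n + m) = ?v n @ y" using mono by blast
    then show ?thesis using m[of "n + m"] that by (simp add: nth_append)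
  qed
  have long: "\<exists>n. K \<le> length (?v n)" for K
    using conv unfolding words_converge_def eventually_sequentially by (metis less_imp_le order_refl)
  have \<beta>: "\<beta> i = h (\<alpha> i)" for i
    using image_word_coding[OF assms(5), of \<alpha>] assms(6) by (simp add: h_def)
  have ne: "?v n \<noteq> []" for n
  proof (induction n)
    case (Suc n)
    then show ?case unfolding step by simp
  qed simp
  obtain f g \<gamma>' N where f: "\<And>b. f b \<noteq> []" and g: "\<And>b. g b \<noteq> []" and fa: "f a = a # \<gamma>'"
    and reach: "\<And>x. f x = [x] \<or> (\<exists>M. x \<in> set ((ext f ^^ M) [a]))"
    and img: "\<And>M. img f g M [a] = map h (?v (M + N))"
    using nonerasing_reduction[of F a \<gamma> h] assms(2) ne unfolding F_def by blast
  obtain K where K: "K > 0" and lm: "letter_morphism (\<lambda>b. (ext f ^^ K) [b]) g"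
    using letter_morphism_power[of f g, OF f g] by blast
  let ?f = "\<lambda>b. (ext f ^^ K) [b]"
  interpret letter_morphism ?f g by (rule lm)
  \<comment> \<open>The power only selects every \<open>K\<close>-th iterate, so these words are
    still prefixes of \<beta> of unbounded length.\<close>
  have W: "W M [a] = map h (?v (K * M + N))" for M
    using img[of "K * M"] by (simp add: img_def ext_power_funpow)
  show ?thesis
  proof (rule complexity_dichotomy)
    show "W M [a] ! i = \<beta> i" if "i < length (W M [a])" for M i
      using that pre\<alpha> unfolding W \<beta> by simp
    show "\<exists>M. n \<le> length (W M [a])" for n
    proof -
      obtain m where m: "n \<le> length (?v m)" using long by blast
      have "m \<le> K * m + N" using K by (cases K) auto
      then obtain y where "?v (K * m + N) = ?v m @ y" using mono[of m "K * m + N - m"] by auto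
      then have "n \<le> length (W m [a])" using m unfolding W by simp
      then show ?thesis ..
    qed
    show "?f x = [x] \<or> (\<exists>M. x \<in> set ((ext ?f ^^ M) [a]))" for x
      using reach[of x]
    proof
      assume fx: "f x = [x]"
      have "(ext f ^^ k) [x] = [x]" for k by (induction k) (auto simp: fx)
      then show ?thesis by blast
    next
      assume "\<exists>M. x \<in> set ((ext f ^^ M) [a])"
      then obtain M where M: "x \<in> set ((ext f ^^ M) [a])" by blast
      \<comment> \<open>Since \<open>f a\<close> starts with \<open>a\<close>, a letter that occurs
        at one level occurs at all later ones, in particular at a multiple of
        \<open>K\<close>.\<close>
      have up: "x \<in> set ((ext f ^^ (M + d)) [a])" for d
      proof (induction d)
        case (Suc d)
        have "(ext f ^^ Suc (M + d)) [a] = (ext f ^^ (M + d)) [a] @ (ext f ^^ (M + d)) \<gamma>'"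
          using ext_funpow_append[of "M + d" f "[a]" \<gamma>'] by (simp add: funpow_swap1 fa)
        then show ?case using Suc by simp
      qed (simp add: M)
      have "M \<le> K * M" using K by simp
      then have "x \<in> set ((ext f ^^ (K * M)) [a])" using up[of "K * M - M"] by simp
      then show ?thesis unfolding ext_power_funpow by blast
    qed
  qed
qed

end
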